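(* Let $E$ be a finite directed graph with disjoint cycles, $\mathsf k$ a field, $L_{\mathsf k}(E)$ its Leavitt path algebra and $T_E$ its talented monoid, regarded as a $\mathbb Z$-monoid. Let $S$ be the largest non-comparable $\mathbb Z$-order-ideal of $T_E$ and let $I$ be the leading ideal of the upper cyclic series of $T_E$. Let $d_1=l_c(T_E/S)$ and $d_2=l_c\big(T_E/(S+I)\big)$. Then $$\operatorname{GKdim} L_{\mathsf k}(E)=\begin{cases}2d_1 & \text{if } d_1=d_2,\\ 2d_1-1 & \text{if } d_1\neq d_2,\end{cases}$$ where $\operatorname{GKdim}$ denotes the Gelfand-Kirillov dimension.
   Context: A directed graph $E=(E^0,E^1,r,s)$ has vertex set $E^0$, edge set $E^1$ and range and source maps $r,s:E^1\to E^0$; it is finite if $E^0$ and $E^1$ are finite. A vertex $v$ is a sink if $s^{-1}(v)=\emptyset$. A path is a sequence of edges $e_1\cdots e_n$ with $r(e_i)=s(e_{i+1})$ (vertices are paths of length $0$). A cycle is a path $e_1\cdots e_n$, $n\ge 1$, with $r(e_n)=s(e_1)$ and $s(e_1),\dots,s(e_n)$ pairwise distinct; it is based at $s(e_1)$. $E$ is a graph with disjoint cycles if every vertex is the base of at most one cycle (acyclic graphs are allowed). The Leavitt path algebra $L_{\mathsf k}(E)$ of a finite graph is the $\mathsf k$-algebra generated by $v\in E^0$ and $e,e^*$ ($e\in E^1$) subject to: $vw=\delta_{v,w}v$; $s(e)e=e=er(e)$, $r(e)e^*=e^*=e^*s(e)$; $e^*f=\delta_{e,f}r(e)$; and $v=\sum_{e\in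 s^{-1}(v)}ee^*$ for every $v$ that is not a sink. The talented monoid $T_E$ is the commutative monoid generated by $\{v(i)\mid v\in E^0,\ i\in\mathbb Z\}$ subject to $v(i)=\sum_{e\in s^{-1}(v)}r(e)(i+1)$ for all $i\in\mathbb Z$ and all $v\in E^0$ that are not sinks. The group $\mathbb Z$ acts on it by ${}^nv(i)=v(i+n)$. Let $T$ be a commutative monoid on which an abelian group $\Gamma$ acts by monoid automorphisms (a $\Gamma$-monoid; here $\Gamma=\mathbb Z$). Write $a\le b$ if $b=a+c$ for some $c\in T$, and $a\parallel b$ if neither $a\le b$ nor $b\le a$. A $\Gamma$-order-ideal is a submonoid $I$ closed under the $\Gamma$-action such that $a+b\in I$ implies $a,b\in I$. $T/I$ is the quotient of $T$ by the congruence $a\sim_I b$ iff $a+i=b+j$ for some $i,j\in I$; $\Gamma$-order-ideals of $T/I$ correspond to $\Gamma$-order-ideals $J\supseteq I$ of $T$ via $J\mapsto J/I$. A $\Gamma$-order-ideal $I$ is cyclic if for every $x\in I$ there is $0\ne\alpha\in\Gamma$ with ${}^\alpha x=x$; it is non-comparable if ${}^\alpha x\parallel x$ for every $0\ne x\in I$ and every $0\neq\alpha\in\Gamma$. Every $\Gamma$-monoid considered here has a largest cyclic ideal, and $T_E$ has a largest non-comparable ideal. The upper cyclic series of $T$ is the chain of $\Gamma$-order-ideals $0=I_0\subset I_1\subset\dots\subset I_n$ (strict inclusions) in which $I_{i+1}/I_i$ is the largest cyclic ideal of $T/I_i$ for $0\le i\le n-1$, continued until $T/I_n$ has no non-zero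 cyclic ideal. $I_n$ is called the leading ideal of the series and $l_c(T):=n$. *)

theory Defs
  imports
    "HOL-Library.Poly_Mapping"
    "HOL-Library.Extended_Real"
    "HOL-Library.Liminf_Limsup"
    "HOL-Algebra.QuotRing"
    "Graph_Theory.Arc_Walk"
    "Jordan_Normal_Form.VS_Connect"
begin

section \<open>Graphs with disjoint cycles\<close>

text \<open>
  A directed graph is a \<^typ>\<open>('v, 'e) pre_digraph\<close>, with source map \<^const>\<open>tail\<close> and range
  map \<^const>\<open>head\<close>; finite graphs (loops and parallel edges allowed) are those satisfying
  \<^const>\<open>fin_digraph\<close>.  A cycle is a list of edges with a definite first edge, so
  two rotations of the same closed path are different cycles, with different bases.
\<close>

lemma (in pre_digraph) cycle_iff_distinct_sources:
  "cycle p \<longleftrightarrow> (\<exists>u. awalk u p u \<and> p \<noteq> [] \<and> distinct (map (tail G) p))"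
proof -
  have "distinct (tl (awalk_verts u p)) \<longleftrightarrow> distinct (map (tail G) p)"
    if "awalk u p u" "p \<noteq> []" for u
  proof -
    have c: "cas u p u" using that by (simp add: awalk_def)
    have u: "tail G (hd p) = u"
      using c that by (cases p) auto
    have e: "awalk_verts u p = u # map (head G) p"
      using awalk_verts_conv'[OF c] that u by simp
    have e': "awalk_verts u p = map (tail G) p @ [head G (last p)]"
      using awalk_verts_conv[of u p] that by simp
    have "head G (last p) = v" if "cas w p v" "p \<noteq> []" for w v
      using that by (induction p arbitrary: w) auto
    from this[OF c that(2)] have "head G (last p) = u" .
    then have "mset (u # map (head G) p) = mset (u # map (tail G) p)"
      using e e' by (metis append_Cons append_Nil mset_append union_commute)
    then have "mset (map (head G) p) = mset (map (tail G) p)" by simp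
    then show ?thesis
      using e by (metis list.sel(3) mset_eq_imp_distinct_iff)
  qed
  then show ?thesis unfolding cycle_def by blast
qed

definition disjoint_cycles :: "('v, 'e) pre_digraph \<Rightarrow> bool" where
  "disjoint_cycles E \<longleftrightarrow>
     (\<forall>u\<in>verts E. \<forall>p q.
        pre_digraph.cycle E p \<and> pre_digraph.awalk E u p u \<and>
        pre_digraph.cycle E q \<and> pre_digraph.awalk E u q u \<longrightarrow> p = q)"


section \<open>Monoids with a group action\<close>

text \<open>
  \<open>\<Gamma>\<close>-monoids are written multiplicatively, following \<^const>\<open>monoid.mult\<close>: the
  sum \<open>a + b\<close> is \<open>a \<otimes>\<^bsub>T\<^esub> b\<close> and \<open>0\<close> is \<open>\<one>\<^bsub>T\<^esub>\<close>.  The acting group \<open>\<Gamma>\<close> is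
  additive and given by a type.
\<close>

record ('g, 'a) gmonoid = "'a monoid" +
  act :: "'g \<Rightarrow> 'a \<Rightarrow> 'a"

locale gamma_monoid = comm_monoid T
  for T :: "('g::ab_group_add, 'a, 'm) gmonoid_scheme" (structure) +
  assumes act_closed: "x \<in> carrier T \<Longrightarrow> act T g x \<in> carrier T"
    and act_mult: "x \<in> carrier T \<Longrightarrow> y \<in> carrier T \<Longrightarrow> act T g (x \<otimes> y) = act T g x \<otimes> act T g y"
    and act_one: "act T g \<one> = \<one>"
    and act_0: "x \<in> carrier T \<Longrightarrow> act T 0 x = x"
    and act_add: "x \<in> carrier T \<Longrightarrow> act T (g + h) x = act T g (act T h x)"

locale gamma_congruence = gamma_monoid T
  for T :: "('g::ab_group_add, 'a, 'm) gmonoid_scheme" (structure) and r +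
  assumes equiv: "equiv (carrier T) r"
    and mult_cong: "(a, b) \<in> r \<Longrightarrow> c \<in> carrier T \<Longrightarrow> (a \<otimes> c, b \<otimes> c) \<in> r"
    and act_cong: "(a, b) \<in> r \<Longrightarrow> (act T g a, act T g b) \<in> r"

definition quot_gmonoid ::
  "('g, 'a, 'm) gmonoid_scheme \<Rightarrow> ('a \<times> 'a) set \<Rightarrow> ('g, 'a set) gmonoid" where
  "quot_gmonoid T r =
     \<lparr>carrier = carrier T // r,
      mult = (\<lambda>A B. \<Union>a\<in>A. \<Union>b\<in>B. r `` {a \<otimes>\<^bsub>T\<^esub> b}),
      one = r `` {\<one>\<^bsub>T\<^esub>},
      act = (\<lambda>g A. \<Union>a\<in>A. r `` {act T g a})\<rparr>"

context gamma_congruence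
begin

lemma mult_cong2:
  assumes "(a, a') \<in> r" "(b, b') \<in> r"
  shows "(a \<otimes> b, a' \<otimes> b') \<in> r"
proof -
  have c: "a \<in> carrier T" "a' \<in> carrier T" "b \<in> carrier T" "b' \<in> carrier T"
    using assms equiv_type[OF equiv] by auto
  have "(a \<otimes> b, a' \<otimes> b) \<in> r" using mult_cong assms c by blast
  moreover have "(b \<otimes> a', b' \<otimes> a') \<in> r" using mult_cong assms c by blast
  then have "(a' \<otimes> b, a' \<otimes> b') \<in> r" using c by (simp add: m_comm)
  ultimately show ?thesis using equiv by (meson equivE transD)
qed

lemma quot_mult:
  assumes "a \<in> carrier T" "b \<in> carrier T"
  shows "mult (quot_gmonoid T r) (r `` {a}) (r `` {b}) = r `` {a \<otimes> b}"
proof -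
  have "(\<lambda>a b. r `` {a \<otimes> b}) respects2 r"
    by (intro congruent2I' equiv_class_eq[OF equiv] mult_cong2)
  then show ?thesis
    unfolding quot_gmonoid_def
    using UN_equiv_class2[OF equiv equiv _ assms, where f = "\<lambda>a b. r `` {a \<otimes> b}"] by simp
qed

lemma quot_act:
  assumes "a \<in> carrier T"
  shows "act (quot_gmonoid T r) g (r `` {a}) = r `` {act T g a}"
proof -
  have "(\<lambda>a. r `` {act T g a}) respects r"
    by (intro congruentI equiv_class_eq[OF equiv] act_cong)
  then show ?thesis
    unfolding quot_gmonoid_def
    using UN_equiv_class[OF equiv _ assms, where f = "\<lambda>a. r `` {act T g a}"] by simp
qed

lemma quot_carrier: "carrier (quot_gmonoid T r) = (\<lambda>a. r `` {a}) ` carrier T"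
  by (auto simp: quot_gmonoid_def quotient_def)

lemma quot_one: "\<one>\<^bsub>quot_gmonoid T r\<^esub> = r `` {\<one>}"
  by (simp add: quot_gmonoid_def)

lemma gamma_monoid_quot: "gamma_monoid (quot_gmonoid T r)"
proof -
  note simps = quot_carrier quot_one quot_mult quot_act act_closed act_mult act_one act_0 act_add
  have "comm_monoid (quot_gmonoid T r)"
    by (rule comm_monoidI) (auto simp: simps m_ac)
  then interpret Q: comm_monoid "quot_gmonoid T r" .
  show ?thesis by unfold_locales (auto simp: simps)
qed

end


section \<open>Order-ideals and the upper cyclic series\<close>

definition alg_le :: "('g, 'a, 'm) gmonoid_scheme \<Rightarrow> 'a \<Rightarrow> 'a \<Rightarrow> bool" where
  "alg_le T a b \<longleftrightarrow> (\<exists>c\<in>carrier T. b = a \<otimes>\<^bsub>T\<^esub> c)"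

definition order_ideal :: "('g, 'a, 'm) gmonoid_scheme \<Rightarrow> 'a set \<Rightarrow> bool" where
  "order_ideal T I \<longleftrightarrow>
     submonoid I T \<and> (\<forall>g. \<forall>x\<in>I. act T g x \<in> I) \<and>
     (\<forall>a\<in>carrier T. \<forall>b\<in>carrier T. a \<otimes>\<^bsub>T\<^esub> b \<in> I \<longrightarrow> a \<in> I \<and> b \<in> I)"

definition cyclic_ideal :: "('g::ab_group_add, 'a, 'm) gmonoid_scheme \<Rightarrow> 'a set \<Rightarrow> bool" where
  "cyclic_ideal T I \<longleftrightarrow> order_ideal T I \<and> (\<forall>x\<in>I. \<exists>g. g \<noteq> 0 \<and> act T g x = x)"

definition noncomparable_ideal ::
  "('g::ab_group_add, 'a, 'm) gmonoid_scheme \<Rightarrow> 'a set \<Rightarrow> bool" where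
  "noncomparable_ideal T I \<longleftrightarrow>
     order_ideal T I \<and>
     (\<forall>x\<in>I. x \<noteq> \<one>\<^bsub>T\<^esub> \<longrightarrow>
        (\<forall>g. g \<noteq> 0 \<longrightarrow> \<not> alg_le T (act T g x) x \<and> \<not> alg_le T x (act T g x)))"

definition largest_noncomparable_ideal ::
  "('g::ab_group_add, 'a, 'm) gmonoid_scheme \<Rightarrow> 'a set" where
  "largest_noncomparable_ideal T = (GREATEST I. noncomparable_ideal T I)"

definition ideal_rel :: "('g, 'a, 'm) gmonoid_scheme \<Rightarrow> 'a set \<Rightarrow> ('a \<times> 'a) set" where
  "ideal_rel T I =
     {(a, b). a \<in> carrier T \<and> b \<in> carrier T \<and> (\<exists>i\<in>I. \<exists>j\<in>I. a \<otimes>\<^bsub>T\<^esub> i = b \<otimes>\<^bsub>T\<^esub> j)}"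

definition quot_ideal :: "('g, 'a, 'm) gmonoid_scheme \<Rightarrow> 'a set \<Rightarrow> ('g, 'a set) gmonoid" where
  "quot_ideal T I = quot_gmonoid T (ideal_rel T I)"

lemma (in gamma_monoid) gamma_congruence_ideal_rel:
  assumes "order_ideal T I"
  shows "gamma_congruence T (ideal_rel T I)"
proof (intro gamma_congruence.intro gamma_congruence_axioms.intro gamma_monoid_axioms)
  interpret I: submonoid I T using assms unfolding order_ideal_def by blast
  have I_act: "act T g x \<in> I" if "x \<in> I" for g x
    using assms that unfolding order_ideal_def by blast
  have relI: "(a, b) \<in> ideal_rel T I"
    if "a \<in> carrier T" "b \<in> carrier T" "i \<in> I" "j \<in> I" "a \<otimes> i = b \<otimes> j" for a b i j
    using that unfolding ideal_rel_def by blast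
  have relE: thesis
    if "(a, b) \<in> ideal_rel T I"
      "\<And>i j. a \<in> carrier T \<Longrightarrow> b \<in> carrier T \<Longrightarrow> i \<in> I \<Longrightarrow> j \<in> I \<Longrightarrow>
        a \<otimes> i = b \<otimes> j \<Longrightarrow> thesis" for a b thesis
    using that unfolding ideal_rel_def by blast
  show "equiv (carrier T) (ideal_rel T I)"
  proof (rule equivI)
    show "ideal_rel T I \<subseteq> carrier T \<times> carrier T" by (auto simp: ideal_rel_def)
    show "refl_on (carrier T) (ideal_rel T I)"
      by (rule refl_onI) (rule relI[OF _ _ I.one_closed I.one_closed HOL.refl])
    show "sym (ideal_rel T I)"
      by (rule symI, erule relE) (rule relI, assumption+, erule HOL.sym)
    show "trans (ideal_rel T I)"
    proof (rule transI)
      fix a b c assume "(a, b) \<in> ideal_rel T I" "(b, c) \<in> ideal_rel T I"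
      then obtain i j k l where carr: "a \<in> carrier T" "b \<in> carrier T" "c \<in> carrier T"
        and I: "i \<in> I" "j \<in> I" "k \<in> I" "l \<in> I"
        and eq: "a \<otimes> i = b \<otimes> j" "b \<otimes> k = c \<otimes> l"
        by (elim relE)
      note ic = I[THEN I.mem_carrier]
      have "a \<otimes> (i \<otimes> k) = (a \<otimes> i) \<otimes> k" using carr ic by (simp add: m_assoc)
      also have "\<dots> = (b \<otimes> k) \<otimes> j" unfolding eq(1) using carr ic by (simp add: m_ac)
      also have "\<dots> = c \<otimes> (l \<otimes> j)" unfolding eq(2) using carr ic by (simp add: m_assoc)
      finally show "(a, c) \<in> ideal_rel T I"
        by (rule relI[OF carr(1,3) I.m_closed[OF I(1,3)] I.m_closed[OF I(4,2)]])
    qed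
  qed
  fix a b c g
  assume "(a, b) \<in> ideal_rel T I"
  then obtain i j where carr: "a \<in> carrier T" "b \<in> carrier T"
    and I: "i \<in> I" "j \<in> I" and eq: "a \<otimes> i = b \<otimes> j"
    by (elim relE)
  note ic = I[THEN I.mem_carrier]
  show "(a \<otimes> c, b \<otimes> c) \<in> ideal_rel T I" if c: "c \<in> carrier T"
  proof (rule relI[OF _ _ I])
    have "(a \<otimes> c) \<otimes> i = (a \<otimes> i) \<otimes> c" using carr ic c by (simp add: m_ac)
    also have "\<dots> = (b \<otimes> c) \<otimes> j" unfolding eq using carr ic c by (simp add: m_ac)
    finally show "(a \<otimes> c) \<otimes> i = (b \<otimes> c) \<otimes> j" .
  qed (use carr c in simp_all)
  show "(act T g a, act T g b) \<in> ideal_rel T I"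
  proof (rule relI[OF _ _ I_act[OF I(1)] I_act[OF I(2)]])
    show "act T g a \<otimes> act T g i = act T g b \<otimes> act T g j"
      unfolding act_mult[OF carr(1) ic(1), symmetric] act_mult[OF carr(2) ic(2), symmetric] eq ..
  qed (use carr act_closed in simp_all)
qed

corollary (in gamma_monoid) gamma_monoid_quot_ideal:
  "order_ideal T I \<Longrightarrow> gamma_monoid (quot_ideal T I)"
  unfolding quot_ideal_def
  by (intro gamma_congruence.gamma_monoid_quot gamma_congruence_ideal_rel)

text \<open>
  The series is the list \<open>[I\<^sub>0, \<dots>, I\<^sub>n]\<close>; \<open>J // ideal_rel T I\<close> is the ideal \<open>J/I\<close> of \<open>T/I\<close>.
\<close>

definition upper_cyclic_series :: "('g::ab_group_add, 'a, 'm) gmonoid_scheme \<Rightarrow> 'a set list \<Rightarrow> bool"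
  where
  "upper_cyclic_series T Is \<longleftrightarrow>
     Is \<noteq> [] \<and> hd Is = {\<one>\<^bsub>T\<^esub>} \<and> (\<forall>I\<in>set Is. order_ideal T I) \<and>
     (\<forall>i. Suc i < length Is \<longrightarrow>
        Is ! i \<subset> Is ! Suc i \<and>
        cyclic_ideal (quot_ideal T (Is ! i)) (Is ! Suc i // ideal_rel T (Is ! i)) \<and>
        (\<forall>K. cyclic_ideal (quot_ideal T (Is ! i)) K \<longrightarrow>
             K \<subseteq> Is ! Suc i // ideal_rel T (Is ! i))) \<and>
     (\<forall>K. cyclic_ideal (quot_ideal T (last Is)) K \<longrightarrow> K = {\<one>\<^bsub>quot_ideal T (last Is)\<^esub>})"

lemma (in gamma_monoid) upper_cyclic_series_unique:
  assumes "upper_cyclic_series T Is" "upper_cyclic_series T Js"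
  shows "Is = Js"
proof -
  have ideal: "order_ideal T (Ks ! i)" if "upper_cyclic_series T Ks" "i < length Ks" for Ks i
    using that unfolding upper_cyclic_series_def by auto
  have step: "Ks ! i \<subset> Ks ! Suc i"
    "cyclic_ideal (quot_ideal T (Ks ! i)) (Ks ! Suc i // ideal_rel T (Ks ! i))"
    "\<And>K. cyclic_ideal (quot_ideal T (Ks ! i)) K \<Longrightarrow> K \<subseteq> Ks ! Suc i // ideal_rel T (Ks ! i)"
    if "upper_cyclic_series T Ks" "Suc i < length Ks" for Ks i
    using that unfolding upper_cyclic_series_def by blast+
  have pull: "x \<in> J"
    if "order_ideal T I" "order_ideal T J" "I \<subseteq> J" "x \<in> carrier T" "y \<in> J"
      "ideal_rel T I `` {x} = ideal_rel T I `` {y}" for I J x y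
  proof -
    interpret gamma_congruence T "ideal_rel T I"
      by (rule gamma_congruence_ideal_rel[OF that(1)])
    interpret I: submonoid I T using that(1) unfolding order_ideal_def by blast
    interpret J: submonoid J T using that(2) unfolding order_ideal_def by blast
    have "(x, y) \<in> ideal_rel T I"
      using eq_equiv_class[OF that(6) equiv J.mem_carrier[OF that(5)]] .
    then obtain i j where ij: "i \<in> I" "j \<in> I" "x \<otimes> i = y \<otimes> j"
      unfolding ideal_rel_def by blast
    have "y \<otimes> j \<in> J" using that(3,5) ij(2) by (intro J.m_closed) auto
    with ij(3) have "x \<otimes> i \<in> J" by metis
    then show "x \<in> J" using that(2,4) I.mem_carrier[OF ij(1)] unfolding order_ideal_def by blast
  qed
  have sub: "J \<subseteq> J'"
    if "order_ideal T I" "order_ideal T J" "order_ideal T J'" "I \<subseteq> J'"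
      "J // ideal_rel T I \<subseteq> J' // ideal_rel T I" for I J J'
  proof
    fix x assume x: "x \<in> J"
    interpret J: submonoid J T using that(2) unfolding order_ideal_def by blast
    have "ideal_rel T I `` {x} \<in> J' // ideal_rel T I" using that(5) quotientI[OF x] by blast
    then obtain y where "y \<in> J'" "ideal_rel T I `` {x} = ideal_rel T I `` {y}"
      by (auto elim: quotientE)
    then show "x \<in> J'" using pull[OF that(1,3,4) J.mem_carrier[OF x]] by blast
  qed
  have nth: "Ks ! i = Ls ! i"
    if "upper_cyclic_series T Ks" "upper_cyclic_series T Ls" "i < length Ks" "i < length Ls"
    for Ks Ls i
    using that(3,4)
  proof (induction i)
    case 0
    then show ?case
      using that(1,2) unfolding upper_cyclic_series_def by (metis hd_conv_nth)
  next
    case (Suc i)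
    then have IH: "Ks ! i = Ls ! i" by simp
    note K = step[OF that(1) Suc.prems(1)] and L = step[OF that(2) Suc.prems(2)]
    note iK = ideal[OF that(1) Suc.prems(1)] and iL = ideal[OF that(2) Suc.prems(2)]
    have i0: "order_ideal T (Ls ! i)" using ideal[OF that(2), of i] Suc.prems by simp
    show ?case
      using sub[OF i0 iK iL] sub[OF i0 iL iK] K L unfolding IH by blast
  qed
  have len: "length Ks \<le> length Ls"
    if K: "upper_cyclic_series T Ks" and L: "upper_cyclic_series T Ls" for Ks Ls
  proof (rule ccontr)
    define n where "n = length Ls - 1"
    assume "\<not> length Ks \<le> length Ls"
    moreover have ne: "Ls \<noteq> []" using L unfolding upper_cyclic_series_def by blast
    ultimately have n: "Suc n < length Ks" "n < length Ks" "n < length Ls"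
      unfolding n_def by (cases Ls; simp)+
    have eq: "Ks ! n = last Ls" using nth[OF K L n(2,3)] ne by (simp add: last_conv_nth n_def)
    have "Ks ! Suc n // ideal_rel T (Ks ! n) = {ideal_rel T (Ks ! n) `` {\<one>}}"
      using L step(2)[OF K n(1)] eq
      unfolding upper_cyclic_series_def quot_ideal_def quot_gmonoid_def by simp
    moreover have "ideal_rel T (Ks ! n) `` {\<one>} \<in> Ks ! n // ideal_rel T (Ks ! n)"
      by (rule quotientI, rule submonoid.one_closed)
         (rule ideal[OF K n(2), unfolded order_ideal_def, THEN conjunct1])
    ultimately have "Ks ! Suc n // ideal_rel T (Ks ! n) \<subseteq> Ks ! n // ideal_rel T (Ks ! n)"
      by simp
    then have "Ks ! Suc n \<subseteq> Ks ! n"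
      by (rule sub[OF ideal[OF K n(2)] ideal[OF K n(1)] ideal[OF K n(2)] order.refl])
    with step(1)[OF K n(1)] show False by blast
  qed
  show ?thesis
    by (rule nth_equalityI)
       (use assms len[OF assms] len[OF assms(2,1)] nth[OF assms] in auto)
qed

definition leading_ideal :: "('g::ab_group_add, 'a, 'm) gmonoid_scheme \<Rightarrow> 'a set" where
  "leading_ideal T = last (THE Is. upper_cyclic_series T Is)"

definition cyclic_length :: "('g::ab_group_add, 'a, 'm) gmonoid_scheme \<Rightarrow> nat" where
  "cyclic_length T = length (THE Is. upper_cyclic_series T Is) - 1"


section \<open>The talented monoid\<close>

text \<open>The pair \<open>(v, i)\<close> is the generator \<open>v(i)\<close>.\<close>

definition free_talented_monoid :: "('v, 'e) pre_digraph \<Rightarrow> (int, ('v \<times> int) multiset) gmonoid" where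
  "free_talented_monoid E =
     \<lparr>carrier = {M. set_mset M \<subseteq> verts E \<times> UNIV}, mult = (+), one = {#},
      act = (\<lambda>n. image_mset (\<lambda>(v, i). (v, i + n)))\<rparr>"

inductive_set talented_cong ::
  "('v, 'e) pre_digraph \<Rightarrow> (('v \<times> int) multiset \<times> ('v \<times> int) multiset) set"
  for E :: "('v, 'e) pre_digraph"
  where
  rel: "v \<in> verts E \<Longrightarrow> out_arcs E v \<noteq> {} \<Longrightarrow>
     ({#(v, i)#}, image_mset (\<lambda>e. (head E e, i + 1)) (mset_set (out_arcs E v))) \<in> talented_cong E"
| refl: "M \<in> carrier (free_talented_monoid E) \<Longrightarrow> (M, M) \<in> talented_cong E"
| sym: "(M, N) \<in> talented_cong E \<Longrightarrow> (N, M) \<in> talented_cong E"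
| trans: "(M, N) \<in> talented_cong E \<Longrightarrow> (N, P) \<in> talented_cong E \<Longrightarrow> (M, P) \<in> talented_cong E"
| add: "(M, N) \<in> talented_cong E \<Longrightarrow> P \<in> carrier (free_talented_monoid E) \<Longrightarrow>
     (M + P, N + P) \<in> talented_cong E"

definition talented_monoid :: "('v, 'e) pre_digraph \<Rightarrow> (int, ('v \<times> int) multiset set) gmonoid" where
  "talented_monoid E = quot_gmonoid (free_talented_monoid E) (talented_cong E)"

lemma gamma_monoid_free_talented: "gamma_monoid (free_talented_monoid E)"
proof -
  have "comm_monoid (free_talented_monoid E)"
    by (rule comm_monoidI) (auto simp: free_talented_monoid_def)
  then interpret comm_monoid "free_talented_monoid E" .
  show ?thesis
    by unfold_locales
       (auto simp: free_talented_monoid_def multiset.map_comp comp_def case_prod_unfold ac_simps)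
qed

lemma (in fin_digraph) gamma_congruence_talented:
  "gamma_congruence (free_talented_monoid G) (talented_cong G)"
proof -
  let ?F = "free_talented_monoid G"
  interpret F: gamma_monoid ?F by (rule gamma_monoid_free_talented)
  have carr: "M \<in> carrier ?F \<and> N \<in> carrier ?F" if "(M, N) \<in> talented_cong G" for M N
    using that
    by induction
       (auto simp: free_talented_monoid_def elem_mset_set[OF finite_subset[OF _ finite_arcs]] out_arcs_def)
  show ?thesis
  proof (intro gamma_congruence.intro gamma_congruence_axioms.intro gamma_monoid_free_talented)
    show "equiv (carrier ?F) (talented_cong G)"
    proof (intro equivI refl_onI symI transI)
      show "talented_cong G \<subseteq> carrier ?F \<times> carrier ?F" using carr by auto
    qed (fact talented_cong.refl talented_cong.sym talented_cong.trans)+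
    show "(a \<otimes>\<^bsub>?F\<^esub> c, b \<otimes>\<^bsub>?F\<^esub> c) \<in> talented_cong G"
      if "(a, b) \<in> talented_cong G" "c \<in> carrier ?F" for a b c
      using talented_cong.add[OF that] by (simp add: free_talented_monoid_def)
    show "(act ?F g a, act ?F g b) \<in> talented_cong G" if "(a, b) \<in> talented_cong G" for a b g
      using that
    proof induction
      case (rel v i)
      then show ?case
        using talented_cong.rel[of v G "i + g"]
        by (simp add: free_talented_monoid_def multiset.map_comp comp_def ac_simps)
    next
      case (add M N P)
      then show ?case
        using talented_cong.add[OF add.IH F.act_closed[of P g]]
        by (simp add: free_talented_monoid_def)
    next
      case (refl M)
      then show ?case by (intro talented_cong.refl F.act_closed)
    next
      case (sym M N)
      show ?case using sym.IH by (rule talented_cong.sym)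
    next
      case (trans M N P)
      show ?case using trans.IH by (rule talented_cong.trans)
    qed
  qed
qed

corollary (in fin_digraph) gamma_monoid_talented: "gamma_monoid (talented_monoid G)"
  unfolding talented_monoid_def
  by (intro gamma_congruence.gamma_monoid_quot gamma_congruence_talented)


section \<open>The Leavitt path algebra\<close>

datatype 'x free_word = Word (letters: "'x list")

instantiation free_word :: (type) monoid_add
begin

definition "0 = Word []"

definition "x + y = Word (letters x @ letters y)"

instance
  by standard (auto simp: zero_free_word_def plus_free_word_def)

end

datatype ('v, 'e) lpa_generator = Vertex 'v | Edge 'e | Ghost 'e

definition lpa_generators :: "('v, 'e) pre_digraph \<Rightarrow> ('v, 'e) lpa_generator set" where
  "lpa_generators E = Vertex ` verts E \<union> Edge ` arcs E \<union> Ghost ` arcs E"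

text \<open>
  With concatenation of words as the additive monoid of exponents, \<^typ>\<open>'x free_word \<Rightarrow>\<^sub>0 'k\<close>
  is the free associative unital \<open>'k\<close>-algebra.  Only letters that are vertices or edges of the
  graph may occur, hence the restricted carrier.
\<close>

type_synonym ('v, 'e, 'k) free_lpa = "('v, 'e) lpa_generator free_word \<Rightarrow>\<^sub>0 'k"

definition free_lpa :: "('v, 'e) pre_digraph \<Rightarrow> ('v, 'e, 'k::field) free_lpa ring" where
  "free_lpa E =
     class_ring\<lparr>carrier := {p. \<forall>w\<in>Poly_Mapping.keys p. set (letters w) \<subseteq> lpa_generators E}\<rparr>"

definition gen :: "('v, 'e) lpa_generator \<Rightarrow> ('v, 'e, 'k::field) free_lpa" where
  "gen x = Poly_Mapping.single (Word [x]) 1"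

definition lpa_relators :: "('v, 'e) pre_digraph \<Rightarrow> ('v, 'e, 'k::field) free_lpa set" where
  "lpa_relators E =
     {gen (Vertex v) * gen (Vertex w) - (if v = w then gen (Vertex v) else 0) | v w.
        v \<in> verts E \<and> w \<in> verts E} \<union>
     (\<Union>e\<in>arcs E.
        {gen (Vertex (tail E e)) * gen (Edge e) - gen (Edge e),
         gen (Edge e) * gen (Vertex (head E e)) - gen (Edge e),
         gen (Vertex (head E e)) * gen (Ghost e) - gen (Ghost e),
         gen (Ghost e) * gen (Vertex (tail E e)) - gen (Ghost e)}) \<union>
     {gen (Ghost e) * gen (Edge f) - (if e = f then gen (Vertex (head E e)) else 0) | e f.
        e \<in> arcs E \<and> f \<in> arcs E} \<union>
     {gen (Vertex v) - (\<Sum>e\<in>out_arcs E v. gen (Edge e) * gen (Ghost e)) | v.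
        v \<in> verts E \<and> out_arcs E v \<noteq> {}}"

definition lpa_ideal :: "('v, 'e) pre_digraph \<Rightarrow> ('v, 'e, 'k::field) free_lpa set" where
  "lpa_ideal E = genideal (free_lpa E) (lpa_relators E)"

text \<open>
  Generators and relations are taken in the category of not necessarily unital algebras: the
  carrier consists of the cosets of the polynomials without constant term, that is, of the
  elements of the free non-unital algebra.  (Keeping the constants would adjoin an extra unit.)
  The ideal of relations is the same in the free non-unital and the free unital algebra.  The
  unit of the result is the sum of the vertices.  A scalar \<open>c\<close> acts as multiplication by the
  coset of the constant polynomial \<open>c\<close>.
\<close>

definition leavitt_path_algebra ::
  "('v, 'e) pre_digraph \<Rightarrow> ('k::field, ('v, 'e, 'k) free_lpa set) module" where
  "leavitt_path_algebra E =
     (let F = free_lpa E; J = lpa_ideal E; Q = F Quot J in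
      \<lparr>carrier = {J +>\<^bsub>F\<^esub> p | p. p \<in> carrier F \<and> Poly_Mapping.lookup p 0 = 0},
       mult = mult Q,
       one = J +>\<^bsub>F\<^esub> (\<Sum>v\<in>verts E. gen (Vertex v)),
       zero = zero Q,
       add = add Q,
       smult = (\<lambda>c X. (J +>\<^bsub>F\<^esub> Poly_Mapping.single 0 c) \<otimes>\<^bsub>Q\<^esub> X)\<rparr>)"

lemma ring_free_lpa: "ring (free_lpa E :: ('v, 'e, 'k::field) free_lpa ring)"
proof -
  let ?C = "{p :: ('v, 'e, 'k) free_lpa.
    \<forall>w\<in>Poly_Mapping.keys p. set (letters w) \<subseteq> lpa_generators E}"
  have add: "p + q \<in> ?C" if "p \<in> ?C" "q \<in> ?C" for p q
    using that Poly_Mapping.keys_add[of p q] by blast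
  have neg: "- p \<in> ?C" if "p \<in> ?C" for p
    using that by simp
  have mult: "p * q \<in> ?C" if "p \<in> ?C" "q \<in> ?C" for p q
  proof -
    have "set (letters (a + b)) \<subseteq> lpa_generators E"
      if "a \<in> Poly_Mapping.keys p" "b \<in> Poly_Mapping.keys q" for a b
      using that \<open>p \<in> ?C\<close> \<open>q \<in> ?C\<close> by (auto simp: plus_free_word_def)
    then show ?thesis using keys_mult[of p q] by blast
  qed
  have one: "1 \<in> ?C"
    by (simp add: zero_free_word_def flip: single_one)
  have zero: "0 \<in> ?C" by simp
  have "ring (class_ring\<lparr>carrier := C\<rparr>)"
    if "\<And>p q. p \<in> C \<Longrightarrow> q \<in> C \<Longrightarrow> p + q \<in> C" "\<And>p. p \<in> C \<Longrightarrow> - p \<in> C"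
      "\<And>p q. p \<in> C \<Longrightarrow> q \<in> C \<Longrightarrow> p * q \<in> C" "1 \<in> C" "0 \<in> C"
    for C :: "('v, 'e, 'k) free_lpa set"
  proof (rule ringI)
    show "abelian_group (class_ring\<lparr>carrier := C\<rparr>)"
      by (rule abelian_groupI) (use that in \<open>auto simp: add.assoc add.commute intro!: bexI[of _ "- _"]\<close>)
    show "Group.monoid (class_ring\<lparr>carrier := C\<rparr>)"
      by (rule monoidI) (use that in \<open>auto simp: mult.assoc\<close>)
  qed (auto simp: algebra_simps)
  from this[OF add neg mult one zero] show ?thesis
    unfolding free_lpa_def .
qed

lemma (in fin_digraph) lpa_relators_closed:
  "lpa_relators G \<subseteq> carrier (free_lpa G :: ('a, 'b, 'k::field) free_lpa ring)"
proof -
  let ?F = "free_lpa G :: ('a, 'b, 'k) free_lpa ring"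
  interpret F: ring ?F by (rule ring_free_lpa)
  have gen: "gen x \<in> carrier ?F" if "x \<in> lpa_generators G" for x
    using that by (simp add: gen_def free_lpa_def)
  have G: "gen (Vertex v) \<in> carrier ?F" if "v \<in> verts G" for v
    using that by (intro gen) (auto simp: lpa_generators_def)
  have G': "gen (Edge e) \<in> carrier ?F" "gen (Ghost e) \<in> carrier ?F" if "e \<in> arcs G" for e
    using that by (auto intro!: gen simp: lpa_generators_def)
  have mult: "p * q \<in> carrier ?F" if "p \<in> carrier ?F" "q \<in> carrier ?F" for p q
    using F.m_closed[OF that] by (simp add: free_lpa_def)
  have zero: "0 \<in> carrier ?F" by (simp add: free_lpa_def)
  have add: "p + q \<in> carrier ?F" if "p \<in> carrier ?F" "q \<in> carrier ?F" for p q
    using F.a_closed[OF that] by (simp add: free_lpa_def)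
  have minus: "p - q \<in> carrier ?F" if "p \<in> carrier ?F" "q \<in> carrier ?F" for p q
  proof -
    have "- q \<in> carrier ?F" using that(2) by (simp add: free_lpa_def)
    with that(1) have "p + - q \<in> carrier ?F" by (rule add)
    then show ?thesis by simp
  qed
  have sum: "(\<Sum>i\<in>I. f i) \<in> carrier ?F" if "\<And>i. i \<in> I \<Longrightarrow> f i \<in> carrier ?F" for f :: "'b \<Rightarrow> _" and I
    using that by (induction I rule: infinite_finite_induct) (auto intro: add zero)
  show ?thesis
    unfolding lpa_relators_def
    by (auto intro!: minus mult sum zero G G')
qed

lemma (in fin_digraph) ideal_lpa_ideal:
  "ideal (lpa_ideal G) (free_lpa G :: ('a, 'b, 'k::field) free_lpa ring)"
  unfolding lpa_ideal_def by (rule ring.genideal_ideal[OF ring_free_lpa lpa_relators_closed])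

lemma (in fin_digraph) vectorspace_leavitt_path_algebra:
  "vectorspace (class_ring :: 'k::field ring) (leavitt_path_algebra G)"
proof -
  let ?F = "free_lpa G :: ('a, 'b, 'k) free_lpa ring"
  let ?J = "lpa_ideal G :: ('a, 'b, 'k) free_lpa set"
  let ?L = "leavitt_path_algebra G :: ('k, ('a, 'b, 'k) free_lpa set) module"
  let ?A = "{p \<in> carrier ?F. Poly_Mapping.lookup p 0 = 0}"
  define cl where "cl p = ?J +>\<^bsub>?F\<^esub> p" for p
  interpret F: ring ?F by (rule ring_free_lpa)
  interpret J: ideal ?J ?F by (rule ideal_lpa_ideal)
  have single: "Poly_Mapping.single 0 c \<in> carrier ?F" for c
    by (auto simp: free_lpa_def zero_free_word_def)
  have L_carrier: "carrier ?L = cl ` ?A"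
    by (auto simp: leavitt_path_algebra_def Let_def cl_def)
  have L_zero: "\<zero>\<^bsub>?L\<^esub> = cl 0"
    using J.a_rcos_const[OF J.zero_closed]
    by (simp add: leavitt_path_algebra_def Let_def cl_def FactRing_def free_lpa_def)
  have L_add: "cl p \<oplus>\<^bsub>?L\<^esub> cl q = cl (p + q)" if "p \<in> carrier ?F" "q \<in> carrier ?F" for p q
    using J.a_rcos_sum[OF that]
    by (simp add: leavitt_path_algebra_def Let_def cl_def FactRing_def free_lpa_def)
  have L_smult: "c \<odot>\<^bsub>?L\<^esub> cl p = cl (Poly_Mapping.single 0 c * p)" if "p \<in> carrier ?F" for c p
    using J.rcoset_mult_add[OF single that]
    by (simp add: leavitt_path_algebra_def Let_def cl_def FactRing_def free_lpa_def)
  have A_zero: "0 \<in> ?A" by (simp add: free_lpa_def)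
  have A_add: "p + q \<in> ?A" if "p \<in> ?A" "q \<in> ?A" for p q
  proof -
    have "p \<oplus>\<^bsub>?F\<^esub> q \<in> carrier ?F" using that by (intro F.a_closed) simp_all
    then have "p + q \<in> carrier ?F" by (simp add: free_lpa_def)
    then show ?thesis using that by (simp add: lookup_add)
  qed
  have A_neg: "- p \<in> ?A" if "p \<in> ?A" for p
    using that by (simp add: free_lpa_def)
  have lookup: "Poly_Mapping.lookup (Poly_Mapping.single 0 c * p) 0
      = c * Poly_Mapping.lookup p (0 :: ('a, 'b) lpa_generator free_word)" for c and p :: "('a, 'b, 'k) free_lpa"
    by (simp add: lookup_mult lookup_single when_mult eq_commute[of 0])
  have A_smult: "Poly_Mapping.single 0 c * p \<in> ?A" if "p \<in> ?A" for c p
  proof -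
    have "Poly_Mapping.single 0 c \<otimes>\<^bsub>?F\<^esub> p \<in> carrier ?F"
      using that by (intro F.m_closed single) simp
    then have "Poly_Mapping.single 0 c * p \<in> carrier ?F" by (simp add: free_lpa_def)
    then show ?thesis using that lookup[of c p] by simp
  qed
  show ?thesis
  proof (rule vs_criteria, goal_cases)
    case 1
    show ?case by (rule class_field)
  next
    case 4
    show ?case
    proof
      fix v assume "v \<in> carrier ?L"
      then obtain p where "p \<in> ?A" "v = cl p" by (auto simp: L_carrier)
      with A_neg[of p] show "\<exists>w\<in>carrier ?L. v \<oplus>\<^bsub>?L\<^esub> w = \<zero>\<^bsub>?L\<^esub>"
        by (intro bexI[of _ "cl (- p)"]) (auto simp: L_carrier L_zero L_add)
    qed
  next
    case 9
    show ?case
      by (auto simp: L_carrier L_smult A_smult[simplified] mult_single simp flip: mult.assoc)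
  qed (use A_zero A_add A_smult in
      \<open>force simp: L_carrier L_zero L_add L_smult algebra_simps single_add\<close>)+
qed


section \<open>Gelfand-Kirillov dimension\<close>

text \<open>
  For an algebra \<open>A\<close> over the field \<open>K\<close>, not necessarily unital, and a subspace \<open>V\<close>,
  \<open>subspace_power K A V n\<close> is \<open>V\<^sup>n\<close> for \<open>n \<ge> 1\<close>, and
  \<open>growth K A V n\<close> is the dimension of \<open>V + V\<^sup>2 + \<dots> + V\<^sup>n\<close>.
\<close>

definition subspace_power ::
  "('k, 'l) ring_scheme \<Rightarrow> ('k, 'a, 'm) module_scheme \<Rightarrow> 'a set \<Rightarrow> nat \<Rightarrow> 'a set" where
  "subspace_power K A V n = ((\<lambda>W. LinearCombinations.module.span K A (V <#>\<^bsub>A\<^esub> W)) ^^ (n - 1)) V"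

definition growth ::
  "('k, 'l) ring_scheme \<Rightarrow> ('k, 'a, 'm) module_scheme \<Rightarrow> 'a set \<Rightarrow> nat \<Rightarrow> nat" where
  "growth K A V n =
     vectorspace.dim K
       (A\<lparr>carrier := LinearCombinations.module.span K A (\<Union>i\<in>{1..n}. subspace_power K A V i)\<rparr>)"

text \<open>
  Since \<^prop>\<open>ln (0::real) = 0\<close> and the subspace \<open>0\<close> is admitted, the zero algebra has
  dimension \<open>0\<close> here.
\<close>

definition GKdim :: "('k, 'l) ring_scheme \<Rightarrow> ('k, 'a, 'm) module_scheme \<Rightarrow> ereal" where
  "GKdim K A =
     (SUP V\<in>{V. VectorSpace.subspace K V A \<and> vectorspace.fin_dim K (A\<lparr>carrier := V\<rparr>)}.
        limsup (\<lambda>n. ereal (log (real n) (real (growth K A V n)))))"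

end

theory Submission
  imports Defs
begin

text \<open>
  Both sides are expressed through chains of cycles, a chain being a sequence of cycles each of
  which leads to the next but not back.

  On the monoid side, order-ideals of quotients of \<open>T\<^sub>E\<close> correspond to hereditary saturated sets of
  vertices, and passing from one term of the upper cyclic series to the next adds the vertices
  whose longest chain of cycles is one longer.  That sinks and cycles with exits generate no
  periodic elements is seen from invariants of \<open>T\<^sub>E\<close> which count walks.  Hence \<open>d\<^sub>1\<close> is the length
  of the longest chain of cycles and \<open>d\<^sub>2\<close> the length of the longest chain of cycles whose last
  cycle reaches a sink.

  On the algebra side, \<open>L(E)\<close> is spanned by the monomials \<open>p q\<^sup>*\<close> with \<open>p\<close> and \<open>q\<close> ending at the same
  vertex \<open>w\<close>, and the number of walks of length at most \<open>n\<close> ending at \<open>w\<close> grows like \<open>n\<^sup>c\<close>, where \<open>c\<close> is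
  the length of the longest chain of cycles ending at \<open>w\<close>.  This gives \<open>n\<^sup>2\<^sup>c\<close> monomials, but only
  \<open>n\<^sup>2\<^sup>c\<^sup>-\<^sup>1\<close> if \<open>w\<close> lies on a cycle without exits.  The lower bound comes from the action on
  boundary paths.
\<close>

section \<open>Chains in a preorder\<close>

text \<open>For this proof, disjointness of the cycles means that a vertex on a cycle has just one
  outgoing and one incoming edge within its class of mutually reachable vertices. So a generator of
  \<open>T_E\<close> is carried around a cycle without exits unchanged but for a shift, and the
  number of walks stays polynomial.

  The ideal \<open>S\<close> lies over the vertices reaching no cycle, \<open>I\<close> over those
  reaching no sink. Dividing out both leaves the cycles that reach a sink, hence \<open>d2\<close>.
  If \<open>d1\<close> and \<open>d2\<close> differ, a longest chain ends in a cycle without exits,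
  as an exit would lead to a sink or to one more cycle. For a closed path \<open>c\<close> around
  such a cycle \<open>c c\<^sup>*\<close> is a vertex, so \<open>p c\<close> and \<open>q c\<close>
  give the same monomial as \<open>p\<close> and \<open>q\<close>. Only the difference of the
  numbers of rounds matters, which costs one power of \<open>n\<close>.

  No basis of \<open>L(E)\<close> is determined. Spanning suffices for the upper bound. For the
  lower bound it suffices to fix the vertex between \<open>p\<close> and \<open>q\<^sup>*\<close>
  and to restrict \<open>q\<close> so that a boundary path \<open>q \<tau>\<close> betrays where
  \<open>q\<close> ends: the matrix coefficients from \<open>q \<tau>\<close> to
  \<open>p \<tau>\<close> are then dual to the monomials.\<close>

definition chain :: "('a \<Rightarrow> 'a \<Rightarrow> bool) \<Rightarrow> 'a set \<Rightarrow> 'a list \<Rightarrow> bool" where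
  "chain R Z us \<longleftrightarrow> sorted_wrt (\<lambda>a b. R a b \<and> \<not> R b a) us \<and> set us \<subseteq> Z"

text \<open>\<open>v\<close> need not lie in \<open>Z\<close>, so every vertex has a rank. As no
  step of a chain can be reversed, a chain has at most one vertex in each class of mutually
  reachable vertices and thus stands for a chain of cycles. \<open>R\<close> is a parameter because
  both reachability and its converse are needed.\<close>

definition chain_rank :: "('a \<Rightarrow> 'a \<Rightarrow> bool) \<Rightarrow> 'a set \<Rightarrow> 'a \<Rightarrow> nat" where
  "chain_rank R Z v = Max (length ` {us. chain R Z us \<and> (\<forall>u\<in>set us. R v u)})"

lemma chain_rev: "chain (\<lambda>a b. R b a) Z (rev us) \<longleftrightarrow> chain R Z us"
  by (simp add: chain_def sorted_wrt_rev)

lemma chain_mono: "chain R Z us \<Longrightarrow> Z \<subseteq> Z' \<Longrightarrow> chain R Z' us"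
  by (auto simp: chain_def)

lemma chain_distinct: "chain R Z us \<Longrightarrow> distinct us"
  unfolding chain_def by (induction us) auto

locale preorder_on_finite =
  fixes R :: "'a \<Rightarrow> 'a \<Rightarrow> bool" and Z :: "'a set"
  assumes finite_Z: "finite Z"
    and trans_R: "R a b \<Longrightarrow> R b c \<Longrightarrow> R a c"
    and refl_R: "a \<in> Z \<Longrightarrow> R a a"
begin

lemma length_chain: "chain R Z us \<Longrightarrow> length us \<le> card Z"
  using card_mono[OF finite_Z, of "set us"] chain_distinct[of R Z us]
  by (simp add: chain_def distinct_card)

lemma finite_lengths: "finite (length ` {us. chain R Z us \<and> P us})"
  by (rule finite_subset[of _ "{..card Z}"]) (auto dest: length_chain)

lemma chain_rank_ge:
  "chain R Z us \<Longrightarrow> (\<And>u. u \<in> set us \<Longrightarrow> R v u) \<Longrightarrow> length us \<le> chain_rank R Z v"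
  unfolding chain_rank_def by (rule Max_ge[OF finite_lengths]) auto

lemma chain_rank_witness:
  obtains us where "chain R Z us" "\<And>u. u \<in> set us \<Longrightarrow> R v u" "length us = chain_rank R Z v"
proof -
  have "[] \<in> {us. chain R Z us \<and> (\<forall>u\<in>set us. R v u)}" by (simp add: chain_def)
  then have "Max (length ` {us. chain R Z us \<and> (\<forall>u\<in>set us. R v u)})
    \<in> length ` {us. chain R Z us \<and> (\<forall>u\<in>set us. R v u)}"
    by (intro Max_in finite_lengths) blast
  then show ?thesis using that unfolding chain_rank_def by auto
qed

lemma chain_rank_mono:
  assumes "R v w"
  shows "chain_rank R Z w \<le> chain_rank R Z v"
proof -
  obtain us where "chain R Z us" "\<And>u. u \<in> set us \<Longrightarrow> R w u" "length us = chain_rank R Z w"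
    using chain_rank_witness by metis
  then show ?thesis using chain_rank_ge[of us v] trans_R[OF assms] by simp
qed

text \<open>A longest chain ahead of \<open>w\<close> can be prolonged by \<open>u\<close> in front:
  a member leading back to \<open>u\<close> would give a way from \<open>w\<close> to
  \<open>u\<close>.\<close>

lemma chain_rank_less:
  assumes "u \<in> Z" "R u w" "\<not> R w u"
  shows "chain_rank R Z w < chain_rank R Z u"
proof -
  obtain us where us: "chain R Z us" "\<And>u. u \<in> set us \<Longrightarrow> R w u" "length us = chain_rank R Z w"
    using chain_rank_witness by metis
  have "R u a" "\<not> R a u" if "a \<in> set us" for a
    using us(2)[OF that] assms trans_R by blast+
  then have "chain R Z (u # us)" "\<And>a. a \<in> set (u # us) \<Longrightarrow> R u a"
    using us(1) assms(1) refl_R unfolding chain_def by auto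
  from chain_rank_ge[OF this] us(3) show ?thesis by simp
qed

lemma chain_rank_eq_0_iff: "chain_rank R Z v = 0 \<longleftrightarrow> (\<forall>u\<in>Z. \<not> R v u)"
proof -
  obtain us where us: "chain R Z us" "\<And>u. u \<in> set us \<Longrightarrow> R v u" "length us = chain_rank R Z v"
    using chain_rank_witness by metis
  have "us = []" if "\<forall>u\<in>Z. \<not> R v u"
    using us(1,2) that unfolding chain_def by (cases us) auto
  moreover have "0 < chain_rank R Z v" if "u \<in> Z" "R v u" for u
    using chain_rank_ge[of "[u]" v] that by (simp add: chain_def)
  ultimately show ?thesis using us(3) by auto
qed

lemma chain_rank_pos: "u \<in> Z \<Longrightarrow> 0 < chain_rank R Z u"
  using chain_rank_eq_0_iff refl_R by blast

text \<open>The rank of \<open>v\<close> is carried by the head \<open>u\<close> of a longest chain,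
  and the second entry of that chain has rank exactly one less. So ranks can be followed downwards
  without gaps.\<close>

lemma chain_rank_step:
  assumes "chain_rank R Z v = Suc k"
  obtains u where "u \<in> Z" "R v u" "chain_rank R Z u = Suc k"
    "k \<noteq> 0 \<Longrightarrow> \<exists>u'\<in>Z. R u u' \<and> \<not> R u' u \<and> chain_rank R Z u' = k"
proof -
  obtain us where us: "chain R Z us" "\<And>u. u \<in> set us \<Longrightarrow> R v u" "length us = Suc k"
    using chain_rank_witness assms by metis
  then obtain u us' where u: "us = u # us'" by (cases us) auto
  have uZ: "u \<in> Z" and ch': "chain R Z us'" and below: "\<And>a. a \<in> set us' \<Longrightarrow> R u a \<and> \<not> R a u"
    using us(1) unfolding u chain_def by auto
  have "R v u" using us(2) u by simp
  have rk: "chain_rank R Z u = Suc k"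
    using chain_rank_ge[OF us(1), of u] chain_rank_mono[OF \<open>R v u\<close>] below refl_R[OF uZ] us(3) assms
    unfolding u by force
  show ?thesis
  proof (rule that[OF uZ \<open>R v u\<close> rk])
    assume "k \<noteq> 0"
    then obtain u' us'' where u': "us' = u' # us''" using us(3) u by (cases us') auto
    then have "u' \<in> Z" "R u u'" "\<not> R u' u" using ch' below by (auto simp: chain_def)
    moreover have "k \<le> chain_rank R Z u'"
      using chain_rank_ge[OF ch', of u'] ch' refl_R[OF \<open>u' \<in> Z\<close>] us(3) unfolding u u' chain_def by auto
    moreover have "chain_rank R Z u' < chain_rank R Z u"
      using chain_rank_less uZ calculation by blast
    ultimately show "\<exists>u'\<in>Z. R u u' \<and> \<not> R u' u \<and> chain_rank R Z u' = k"
      using rk by (intro bexI[of _ u']) auto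
  qed
qed

end


section \<open>Reachability in finite digraphs\<close>

context fin_digraph
begin

definition cyclic_verts :: "'a set" where
  "cyclic_verts = {u. u \<rightarrow>\<^sup>+ u}"

definition sinks :: "'a set" where
  "sinks = {v \<in> verts G. out_arcs G v = {}}"

lemma cyclic_verts_subset: "cyclic_verts \<subseteq> verts G"
  using reachable1_in_verts by (auto simp: cyclic_verts_def)

lemma finite_out_arcs[simp]: "finite (out_arcs G v)"
  by (rule finite_subset[OF _ finite_arcs]) auto

lemma finite_in_arcs[simp]: "finite (in_arcs G v)"
  by (rule finite_subset[OF _ finite_arcs]) auto

lemma arc_reachable: "e \<in> arcs G \<Longrightarrow> tail G e \<rightarrow>\<^sup>* head G e"
  by (meson in_arcs_imp_in_arcs_ends reachable_adjI)

lemma reachable_head: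
  assumes "v \<rightarrow>\<^sup>+ w"
  obtains e where "e \<in> out_arcs G v" "head G e \<rightarrow>\<^sup>* w"
proof -
  obtain p where "awalk v p w" "p \<noteq> []" using assms reachable1_awalk by auto
  then show ?thesis
    by (cases p) (auto simp: awalk_Cons_iff intro!: that dest: reachable_awalkI)
qed

lemma reachable_tail:
  assumes "v \<rightarrow>\<^sup>+ w"
  obtains e where "e \<in> in_arcs G w" "v \<rightarrow>\<^sup>* tail G e"
proof -
  obtain p where "awalk v p w" "p \<noteq> []" using assms reachable1_awalk by auto
  then show ?thesis
    by (cases p rule: rev_cases) (auto simp: awalk_simps intro!: that dest: reachable_awalkI)
qed

lemma cyclic_if_arc_back: "e \<in> arcs G \<Longrightarrow> head G e \<rightarrow>\<^sup>* tail G e \<Longrightarrow> tail G e \<in> cyclic_verts"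
  unfolding cyclic_verts_def mem_Collect_eq reachable1_awalk reachable_awalk
  by (metis awalk_Cons_iff list.distinct(1))

lemma mutually_reachable_cyclic:
  assumes "u \<in> cyclic_verts" "u \<rightarrow>\<^sup>* w" "w \<rightarrow>\<^sup>* u"
  shows "w \<in> cyclic_verts"
  using assms unfolding cyclic_verts_def
  by (metis mem_Collect_eq reachable1_reachable_trans reachable_reachable1_trans)

lemma sink_reachable: "w \<in> sinks \<Longrightarrow> w \<rightarrow>\<^sup>* x \<Longrightarrow> x = w"
  by (auto simp: sinks_def elim: reachable_head dest!: reachable_neq_reachable1)

lemma sink_not_cyclic: "w \<in> sinks \<Longrightarrow> w \<notin> cyclic_verts"
  by (auto simp: sinks_def cyclic_verts_def elim: reachable_head)

text \<open>Induction over the classes of mutually reachable vertices without forming them: moving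
  to a vertex that cannot return strictly shrinks the finite set of reachable vertices.\<close>

lemma reachable_less_induct [consumes 1, case_names less]:
  assumes "v \<in> verts G"
    and step: "\<And>v. v \<in> verts G \<Longrightarrow> (\<And>w. v \<rightarrow>\<^sup>* w \<Longrightarrow> \<not> w \<rightarrow>\<^sup>* v \<Longrightarrow> P w) \<Longrightarrow> P v"
  shows "P v"
  using assms(1)
proof (induction "card {w. v \<rightarrow>\<^sup>* w}" arbitrary: v rule: less_induct)
  case less
  show ?case
  proof (rule step[OF less.prems])
    fix w assume w: "v \<rightarrow>\<^sup>* w" "\<not> w \<rightarrow>\<^sup>* v"
    have "{x. w \<rightarrow>\<^sup>* x} \<subset> {x. v \<rightarrow>\<^sup>* x}"
      using w less.prems reachable_trans by blast
    moreover have "finite {x. v \<rightarrow>\<^sup>* x}"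
      by (rule finite_subset[OF _ finite_verts]) (auto simp: reachable_in_verts)
    ultimately show "P w"
      using w by (intro less.hyps) (auto simp: reachable_in_verts psubset_card_mono)
  qed
qed

lemma coreachable_less_induct [consumes 1, case_names less]:
  assumes "v \<in> verts G"
    and step: "\<And>v. v \<in> verts G \<Longrightarrow> (\<And>w. w \<rightarrow>\<^sup>* v \<Longrightarrow> \<not> v \<rightarrow>\<^sup>* w \<Longrightarrow> P w) \<Longrightarrow> P v"
  shows "P v"
  using assms(1)
proof (induction "card {w. w \<rightarrow>\<^sup>* v}" arbitrary: v rule: less_induct)
  case less
  show ?case
  proof (rule step[OF less.prems])
    fix w assume w: "w \<rightarrow>\<^sup>* v" "\<not> v \<rightarrow>\<^sup>* w"
    have "{x. x \<rightarrow>\<^sup>* w} \<subset> {x. x \<rightarrow>\<^sup>* v}"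
      using w less.prems reachable_trans by blast
    moreover have "finite {x. x \<rightarrow>\<^sup>* v}"
      by (rule finite_subset[OF _ finite_verts]) (auto simp: reachable_in_verts)
    ultimately show "P w"
      using w by (intro less.hyps) (auto simp: reachable_in_verts psubset_card_mono)
  qed
qed

text \<open>A vertex that is neither a sink nor on a cycle has an edge whose head cannot return. So
  a vertex reaching no sink reaches a cycle, and one reaching no cycle reaches a sink.\<close>

lemma reaches_sink_or_cycle:
  assumes "v \<in> verts G"
  obtains w where "v \<rightarrow>\<^sup>* w" "w \<in> sinks \<union> cyclic_verts"
proof -
  from assms have "\<exists>w. v \<rightarrow>\<^sup>* w \<and> w \<in> sinks \<union> cyclic_verts"
  proof (induction rule: reachable_less_induct)
    case (less v)
    show ?case
    proof (cases "v \<in> sinks \<union> cyclic_verts")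
      case False
      then have "out_arcs G v \<noteq> {}" using less.hyps by (auto simp: sinks_def)
      then obtain e where e: "e \<in> arcs G" "tail G e = v"
        by (metis ex_in_conv in_out_arcs_conv)
      then have "v \<rightarrow>\<^sup>* head G e" "\<not> head G e \<rightarrow>\<^sup>* v"
        using arc_reachable cyclic_if_arc_back False by auto
      with less.IH show ?thesis using reachable_trans by blast
    qed (use less.hyps in auto)
  qed
  with that show thesis by blast
qed

end


section \<open>Longest chains of cycles ahead of a vertex\<close>

context fin_digraph
begin

lemma awalk_tails: "awalk u p v \<Longrightarrow> awalk_verts u p = map (tail G) p @ [v]"
  by (induction p arbitrary: u) (auto simp: awalk_simps)

abbreviation cycle_rank :: "'a set \<Rightarrow> 'a \<Rightarrow> nat" where
  "cycle_rank \<equiv> chain_rank (\<lambda>a b. a \<rightarrow>\<^sup>* b)"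

text \<open>The inserted \<open>0\<close> provides a value for the empty graph.\<close>

definition max_chain :: "'a set \<Rightarrow> nat" where
  "max_chain Z = Max (insert 0 (cycle_rank Z ` verts G))"

definition reaches_sink :: "'a set" where
  "reaches_sink = {v. \<exists>w\<in>sinks. v \<rightarrow>\<^sup>* w}"

lemma preorder_reachable: "Z \<subseteq> verts G \<Longrightarrow> preorder_on_finite (\<lambda>a b. a \<rightarrow>\<^sup>* b) Z"
  by unfold_locales (auto intro: finite_subset reachable_trans)

lemma preorder_coreachable: "Z \<subseteq> verts G \<Longrightarrow> preorder_on_finite (\<lambda>a b. b \<rightarrow>\<^sup>* a) Z"
  by unfold_locales (auto intro: finite_subset reachable_trans)

lemma cycle_rank_le_max_chain: "v \<in> verts G \<Longrightarrow> cycle_rank Z v \<le> max_chain Z"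
  unfolding max_chain_def by (intro Max_ge) auto

lemma chain_le_max_chain:
  assumes "Z \<subseteq> verts G" "chain (\<lambda>a b. a \<rightarrow>\<^sup>* b) Z us"
  shows "length us \<le> max_chain Z"
proof (cases us)
  case (Cons u us')
  interpret preorder_on_finite "\<lambda>a b. a \<rightarrow>\<^sup>* b" Z by (rule preorder_reachable[OF assms(1)])
  have "u \<in> verts G" "\<And>a. a \<in> set us \<Longrightarrow> u \<rightarrow>\<^sup>* a"
    using assms Cons refl_R by (auto simp: chain_def)
  then show ?thesis
    using order_trans[OF chain_rank_ge[OF assms(2)] cycle_rank_le_max_chain] by blast
qed simp

lemma max_chain_witness:
  assumes "Z \<subseteq> verts G"
  obtains us where "chain (\<lambda>a b. a \<rightarrow>\<^sup>* b) Z us" "length us = max_chain Z"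
proof -
  interpret preorder_on_finite "\<lambda>a b. a \<rightarrow>\<^sup>* b" Z by (rule preorder_reachable[OF assms(1)])
  have "max_chain Z \<in> insert 0 (cycle_rank Z ` verts G)"
    unfolding max_chain_def by (rule Max_in) auto
  then consider "max_chain Z = 0" | v where "max_chain Z = cycle_rank Z v" by auto
  then show thesis
  proof cases
    case 1
    then show ?thesis using that[of "[]"] by (simp add: chain_def)
  next
    case 2
    obtain us where "chain (\<lambda>a b. a \<rightarrow>\<^sup>* b) Z us" "length us = cycle_rank Z v"
      using chain_rank_witness by metis
    then show ?thesis using that 2 by simp
  qed
qed

end

section \<open>Disjoint cycles\<close>

locale disjoint_cycles_digraph = fin_digraph +
  assumes disjoint_cycles: "disjoint_cycles G"
begin

text \<open>A simple path back to the tail closes each edge to a cycle, \<open>apath\<close>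
  providing the distinct sources. Both cycles are based at the common tail, so they coincide, and
  with them their initial edges. Disjointness enters the later arguments only through this lemma and
  its mirror image.\<close>

lemma unique_arc_back:
  assumes "e \<in> arcs G" "f \<in> arcs G" "tail G e = tail G f"
    "head G e \<rightarrow>\<^sup>* tail G e" "head G f \<rightarrow>\<^sup>* tail G f"
  shows "e = f"
proof -
  have "\<exists>p. awalk (tail G e) (e # p) (tail G e) \<and> cycle (e # p)"
    if "e \<in> arcs G" "head G e \<rightarrow>\<^sup>* tail G e" for e
  proof -
    obtain p where p: "apath (head G e) p (tail G e)" using \<open>head G e \<rightarrow>\<^sup>* tail G e\<close> reachable_apath by blast
    then have "awalk (head G e) p (tail G e)" "distinct (map (tail G) p @ [tail G e])"
      by (auto simp: apath_def awalk_tails)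
    then show ?thesis
      unfolding cycle_iff_distinct_sources using that
      by (intro exI[of _ p] conjI exI[of _ "tail G e"]) (auto simp: awalk_Cons_iff)
  qed
  from this[OF assms(1,4)] this[OF assms(2,5)] obtain p q where
    "awalk (tail G e) (e # p) (tail G e)" "cycle (e # p)"
    "awalk (tail G e) (f # q) (tail G e)" "cycle (f # q)"
    using assms(3) by auto
  moreover have "tail G e \<in> verts G" using assms(1) by simp
  ultimately have "e # p = f # q" using disjoint_cycles unfolding disjoint_cycles_def by blast
  then show ?thesis by simp
qed

text \<open>Here the simple path precedes the edge, the cycles are based at the common head, and
  their last edges agree. This form serves for walks counted by their endpoint.\<close>

lemma unique_arc_from_back:
  assumes "e \<in> arcs G" "f \<in> arcs G" "head G e = head G f"
    "head G e \<rightarrow>\<^sup>* tail G e" "head G f \<rightarrow>\<^sup>* tail G f"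
  shows "e = f"
proof -
  have "\<exists>p. awalk (head G e) (p @ [e]) (head G e) \<and> cycle (p @ [e])"
    if "e \<in> arcs G" "head G e \<rightarrow>\<^sup>* tail G e" for e
  proof -
    obtain p where p: "apath (head G e) p (tail G e)" using \<open>head G e \<rightarrow>\<^sup>* tail G e\<close> reachable_apath by blast
    then have "awalk (head G e) p (tail G e)" "distinct (map (tail G) p @ [tail G e])"
      by (auto simp: apath_def awalk_tails)
    then show ?thesis
      unfolding cycle_iff_distinct_sources using that
      by (intro exI[of _ p] conjI exI[of _ "head G e"]) (auto simp: awalk_simps)
  qed
  from this[OF assms(1,4)] this[OF assms(2,5)] obtain p q where
    "awalk (head G e) (p @ [e]) (head G e)" "cycle (p @ [e])"
    "awalk (head G e) (q @ [f]) (head G e)" "cycle (q @ [f])"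
    using assms(3) by auto
  moreover have "head G e \<in> verts G" using assms(1) by simp
  ultimately have "p @ [e] = q @ [f]" using disjoint_cycles unfolding disjoint_cycles_def by blast
  then show ?thesis by simp
qed

end

section \<open>Multisets over vertex sets and walk counts\<close>

definition multisets_over :: "'v set \<Rightarrow> ('v \<times> int) multiset set" where
  "multisets_over H = {M. set_mset M \<subseteq> H \<times> UNIV}"

abbreviation shift :: "int \<Rightarrow> ('v \<times> int) multiset \<Rightarrow> ('v \<times> int) multiset" where
  "shift n \<equiv> image_mset (\<lambda>(v, i). (v, i + n))"

lemma multisets_over_simps [simp]:
  "{#} \<in> multisets_over H"
  "add_mset (v, i) M \<in> multisets_over H \<longleftrightarrow> v \<in> H \<and> M \<in> multisets_over H"
  "M + N \<in> multisets_over H \<longleftrightarrow> M \<in> multisets_over H \<and> N \<in> multisets_over H"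
  "shift n M \<in> multisets_over H \<longleftrightarrow> M \<in> multisets_over H"
  by (auto simp: multisets_over_def)

lemma multisets_over_mono: "M \<in> multisets_over H \<Longrightarrow> H \<subseteq> H' \<Longrightarrow> M \<in> multisets_over H'"
  by (auto simp: multisets_over_def)

lemma multisets_over_empty: "M \<in> multisets_over {} \<Longrightarrow> M = {#}"
  by (auto simp: multisets_over_def)

lemma free_talented_simps:
  "carrier (free_talented_monoid E) = multisets_over (verts E)"
  "mult (free_talented_monoid E) = (+)"
  "one (free_talented_monoid E) = {#}"
  "act (free_talented_monoid E) = shift"
  by (simp_all add: free_talented_monoid_def multisets_over_def)

context fin_digraph
begin

text \<open>Read from left to right the equivalence is heredity, from right to left
  saturation.\<close>

definition hereditary_saturated :: "'a set \<Rightarrow> bool" where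
  "hereditary_saturated H \<longleftrightarrow> H \<subseteq> verts G \<and>
     (\<forall>v\<in>verts G. out_arcs G v \<noteq> {} \<longrightarrow> (v \<in> H \<longleftrightarrow> (\<forall>e\<in>out_arcs G v. head G e \<in> H)))"

definition successors :: "'a \<Rightarrow> int \<Rightarrow> ('a \<times> int) multiset" where
  "successors v i = image_mset (\<lambda>e. (head G e, i + 1)) (mset_set (out_arcs G v))"

lemma successors_over: "successors v i \<in> multisets_over H \<longleftrightarrow> (\<forall>e\<in>out_arcs G v. head G e \<in> H)"
  by (auto simp: successors_def multisets_over_def)

lemma hereditary_saturatedD:
  assumes "hereditary_saturated H"
  shows "H \<subseteq> verts G" "e \<in> arcs G \<Longrightarrow> tail G e \<in> H \<Longrightarrow> head G e \<in> H"
proof -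
  show "H \<subseteq> verts G" using assms by (simp add: hereditary_saturated_def)
  assume e: "e \<in> arcs G" "tail G e \<in> H"
  then have "e \<in> out_arcs G (tail G e)" by simp
  moreover from this have "out_arcs G (tail G e) \<noteq> {}" by blast
  ultimately show "head G e \<in> H"
    using assms e unfolding hereditary_saturated_def by (meson tail_in_verts)
qed

lemma hereditary_reachable:
  assumes "hereditary_saturated H" "v \<rightarrow>\<^sup>* w" "v \<in> H"
  shows "w \<in> H"
proof -
  from assms(2) obtain p where "awalk v p w" using reachable_awalk by auto
  then show ?thesis using assms(3)
    by (induction p arbitrary: v) (auto simp: awalk_simps intro: hereditary_saturatedD(2)[OF assms(1)])
qed

lemma hereditary_saturated_empty: "hereditary_saturated {}"
  by (auto simp: hereditary_saturated_def)

text \<open>Heredity and saturation put both sides of a defining relation over \<open>H\<close> or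
  neither. So lying over \<open>H\<close> depends only on the class in \<open>T_E\<close>.\<close>

lemma talented_cong_over:
  assumes "(M, N) \<in> talented_cong G" "hereditary_saturated H"
  shows "M \<in> multisets_over H \<longleftrightarrow> N \<in> multisets_over H"
  using assms
proof induction
  case (rel v i)
  then show ?case
    unfolding successors_def[symmetric] successors_over by (simp add: hereditary_saturated_def)
qed auto

lemma talented_cong_carrier:
  "(M, N) \<in> talented_cong G \<Longrightarrow> M \<in> multisets_over (verts G) \<and> N \<in> multisets_over (verts G)"
  using equiv_type[OF gamma_congruence.equiv[OF gamma_congruence_talented]]
  by (auto simp: free_talented_simps)

section \<open>Walk counts as invariants of the talented monoid\<close>

primrec walk_count :: "'a set \<Rightarrow> nat \<Rightarrow> 'a \<Rightarrow> nat" where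
  "walk_count X 0 v = (if v \<in> X then 1 else 0)"
| "walk_count X (Suc n) v = (\<Sum>e\<in>out_arcs G v. walk_count X n (head G e))"

text \<open>A pair \<open>(v, i)\<close> is a walker placed at \<open>v\<close> at time
  \<open>i\<close>, and the sum counts the ways to be in \<open>X\<close> at time \<open>k\<close>.
  A walker placed after time \<open>k\<close> contributes nothing.\<close>

definition level_count :: "'a set \<Rightarrow> int \<Rightarrow> ('a \<times> int) multiset \<Rightarrow> nat" where
  "level_count X k M = (\<Sum>(v, i)\<in>#M. if i \<le> k then walk_count X (nat (k - i)) v else 0)"

lemma level_count_simps [simp]:
  "level_count X k {#} = 0"
  "level_count X k (add_mset (v, i) M) =
     (if i \<le> k then walk_count X (nat (k - i)) v else 0) + level_count X k M"
  "level_count X k (M + N) = level_count X k M + level_count X k N"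
  by (simp_all add: level_count_def)

lemma level_count_shift [simp]: "level_count X k (shift n M) = level_count X (k - n) M"
  by (induction M) (auto simp: algebra_simps)

text \<open>Unfolding a generator lets its walker make one step. At time \<open>k\<close> this is
  noticed only if the walker stands in \<open>X\<close> at that very time, for its successors start
  one unit later.\<close>

lemma level_count_successors:
  assumes "i < k \<or> v \<notin> X"
  shows "level_count X k (successors v i) = level_count X k {#(v, i)#}"
proof -
  have "nat (k - i) = Suc (nat (k - (i + 1)))" if "i < k" using that by simp
  moreover have "level_count X k (successors v i) =
      (\<Sum>e\<in>out_arcs G v. if i + 1 \<le> k then walk_count X (nat (k - (i + 1))) (head G e) else 0)"
    by (simp add: successors_def level_count_def image_mset.compositionality comp_def sum_unfold_sum_mset)
  ultimately show ?thesis using assms by (cases i k rule: linorder_cases) auto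
qed

text \<open>A sink is never on the left of a defining relation, so the exceptional case of
  \<open>level_count_successors\<close> does not arise and the count is invariant at every
  time.\<close>

lemma level_count_sink_cong:
  assumes "(M, N) \<in> talented_cong G" "w \<in> sinks"
  shows "level_count {w} k M = level_count {w} k N"
  using assms
proof induction
  case (rel v i)
  then have "v \<notin> {w}" by (auto simp: sinks_def)
  then show ?case unfolding successors_def[symmetric] by (subst level_count_successors) auto
qed auto

text \<open>A congruence results from finitely many unfoldings, each visible at one time at most, so
  late counts agree for an arbitrary set \<open>X\<close>.\<close>

lemma level_count_eventually_cong:
  assumes "(M, N) \<in> talented_cong G"
  shows "\<exists>k0. \<forall>k\<ge>k0. level_count X k M = level_count X k N"
  using assms
proof induction
  case (rel v i)
  show ?case unfolding successors_def[symmetric]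
    by (intro exI[of _ "i + 1"] allI impI level_count_successors[symmetric]) simp
next
  case (sym M N)
  then show ?case by metis
next
  case (trans M N P)
  then obtain a b where "\<forall>k\<ge>a. level_count X k M = level_count X k N" "\<forall>k\<ge>b. level_count X k N = level_count X k P"
    by blast
  then show ?case by (intro exI[of _ "max a b"]) auto
next
  case (add M N P)
  then show ?case by auto
qed auto

lemma walk_count_hereditary:
  assumes "hereditary_saturated H" "X \<inter> H = {}" "v \<in> H"
  shows "walk_count X n v = 0"
  using assms(3)
proof (induction n arbitrary: v)
  case (Suc n)
  then show ?case using hereditary_saturatedD(2)[OF assms(1)] by auto
qed (use assms in auto)

lemma level_count_hereditary:
  assumes "hereditary_saturated H" "X \<inter> H = {}" "M \<in> multisets_over H"
  shows "level_count X k M = 0"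
  using assms(3) by (induction M) (auto simp: walk_count_hereditary[OF assms(1,2)])

lemma walk_count_arc:
  "e \<in> arcs G \<Longrightarrow> walk_count X n (head G e) \<le> walk_count X (Suc n) (tail G e)"
  unfolding walk_count.simps
  using member_le_sum[of e "out_arcs G (tail G e)" "\<lambda>e. walk_count X n (head G e)"] by simp

lemma walk_count_awalk:
  "awalk v p w \<Longrightarrow> walk_count X n w \<le> walk_count X (n + length p) v"
proof (induction p arbitrary: v)
  case (Cons e p)
  then have "e \<in> arcs G" "tail G e = v" "awalk (head G e) p w" by (auto simp: awalk_simps)
  with Cons.IH[of "head G e"] walk_count_arc[of e X "n + length p"] show ?case by auto
qed (auto simp: awalk_simps)

lemma reachable_walk_count:
  assumes "v \<rightarrow>\<^sup>* w" "w \<in> X"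
  shows "\<exists>n. 0 < walk_count X n v"
proof -
  obtain p where "awalk v p w" using assms reachable_awalk by auto
  from walk_count_awalk[OF this, of X 0] assms(2) show ?thesis by (auto intro!: exI[of _ "length p"])
qed

text \<open>A closed walk through \<open>e\<close> of length \<open>l\<close> can be put in front of
  any walk from \<open>u\<close>; the walks beginning with \<open>f\<close> come on top of
  these.\<close>

lemma walk_count_exit:
  assumes "e \<in> out_arcs G u" "f \<in> out_arcs G u" "e \<noteq> f" "head G e \<rightarrow>\<^sup>* u"
  obtains l where "0 < l"
    "\<And>n. walk_count X n u + walk_count X (n + l - 1) (head G f) \<le> walk_count X (n + l) u"
proof -
  obtain p where p: "awalk (head G e) p u" using assms(4) reachable_awalk by auto
  show ?thesis
  proof (rule that[of "Suc (length p)"])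
    fix n
    have "(\<Sum>a\<in>{e, f}. walk_count X (n + length p) (head G a))
        \<le> (\<Sum>a\<in>out_arcs G u. walk_count X (n + length p) (head G a))"
      by (rule sum_mono2) (use assms in auto)
    then show "walk_count X n u + walk_count X (n + Suc (length p) - 1) (head G f)
        \<le> walk_count X (n + Suc (length p)) u"
      using assms(3) walk_count_awalk[OF p, of X n] by simp
  qed simp
qed

lemma walk_count_eventually_0:
  assumes "v \<in> verts G" "\<And>u. u \<in> cyclic_verts \<Longrightarrow> \<not> v \<rightarrow>\<^sup>* u"
  shows "\<exists>b. \<forall>n\<ge>b. walk_count X n v = 0"
  using assms
proof (induction rule: reachable_less_induct)
  case (less v)
  have "\<exists>b. \<forall>n\<ge>b. walk_count X n (head G e) = 0" if e: "e \<in> out_arcs G v" for e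
  proof (rule less.IH)
    show "v \<rightarrow>\<^sup>* head G e" using e arc_reachable by auto
    with less.prems show "\<not> head G e \<rightarrow>\<^sup>* u" if "u \<in> cyclic_verts" for u
      using that reachable_trans by blast
    show "\<not> head G e \<rightarrow>\<^sup>* v" using e cyclic_if_arc_back less by force
  qed
  then obtain b where b: "\<And>e n. e \<in> out_arcs G v \<Longrightarrow> b e \<le> n \<Longrightarrow> walk_count X n (head G e) = 0"
    by metis
  have "walk_count X n v = 0" if n: "n \<ge> Suc (\<Sum>e\<in>out_arcs G v. b e)" for n
  proof -
    obtain m where m: "n = Suc m" using n by (cases n) auto
    have "b e \<le> m" if "e \<in> out_arcs G v" for e
      using member_le_sum[of e "out_arcs G v" b] that n m by simp
    then show ?thesis using b m by simp
  qed
  then show ?case by blast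
qed

section \<open>The ideal generated by the vertices not reaching a cycle\<close>

definition acyclic_part :: "'a set" where
  "acyclic_part = {v \<in> verts G. \<forall>u\<in>cyclic_verts. \<not> v \<rightarrow>\<^sup>* u}"

lemma level_count_finite:
  assumes "M \<in> multisets_over acyclic_part"
  shows "finite {k. level_count X k M \<noteq> 0}"
  using assms
proof (induction M)
  case (add x M)
  obtain v i where x: "x = (v, i)" by force
  then obtain b where b: "\<And>n. n \<ge> b \<Longrightarrow> walk_count X n v = 0"
    using walk_count_eventually_0[of v X] add.prems by (auto simp: acyclic_part_def)
  have "{k. level_count X k (add_mset x M) \<noteq> 0} \<subseteq> {i..i + int b} \<union> {k. level_count X k M \<noteq> 0}"
  proof
    fix k assume k: "k \<in> {k. level_count X k (add_mset x M) \<noteq> 0}"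
    show "k \<in> {i..i + int b} \<union> {k. level_count X k M \<noteq> 0}"
    proof (cases "level_count X k M = 0")
      case True
      with k have "i \<le> k" "walk_count X (nat (k - i)) v \<noteq> 0" by (simp_all add: x split: if_splits)
      moreover from this have "nat (k - i) < b" using b[of "nat (k - i)"] by (meson not_le)
      then have "k \<le> i + int b" by linarith
      ultimately show ?thesis by simp
    qed simp
  qed
  moreover have "finite {k. level_count X k M \<noteq> 0}" using add.IH add.prems x by simp
  ultimately show ?case by (meson finite_UnI finite_atLeastAtMost_int finite_subset)
qed simp

lemma level_count_acyclic_pos:
  assumes "M \<in> multisets_over acyclic_part" "M \<noteq> {#}"
  obtains w k where "w \<in> sinks" "0 < level_count {w} k M"
proof -
  obtain v i N where M: "M = add_mset (v, i) N" using assms(2) by (metis multiset_cases surj_pair)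
  then have v: "v \<in> acyclic_part" using assms by auto
  then obtain w where w: "v \<rightarrow>\<^sup>* w" "w \<in> sinks"
    using reaches_sink_or_cycle[of v] by (auto simp: acyclic_part_def)
  then obtain n where "0 < walk_count {w} n v" using reachable_walk_count by blast
  then show ?thesis by (intro that[OF w(2), of "i + int n"]) (auto simp: M)
qed

text \<open>Positivity spreads from \<open>k\<close> to \<open>k + g\<close>, \<open>k + 2g\<close>
  and so on, against finiteness. Comparability of an element with its shift would force this
  behaviour on a walk count.\<close>

lemma finite_support_not_superperiodic:
  fixes f :: "int \<Rightarrow> nat"
  assumes "finite {k. f k \<noteq> 0}" "g \<noteq> 0" "\<And>k. f (k - g) \<le> f k" "0 < f k"
  shows False
proof -
  have "0 < f (k + int n * g)" for n
  proof (induction n)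
    case (Suc n)
    have "k + int (Suc n) * g - g = k + int n * g" by (simp add: algebra_simps)
    with Suc assms(3)[of "k + int (Suc n) * g"] show ?case by (metis less_le_trans)
  qed (use assms in auto)
  then have "range (\<lambda>n. k + int n * g) \<subseteq> {k. f k \<noteq> 0}" by auto
  moreover have "inj (\<lambda>n::nat. k + int n * g)" using assms(2) by (auto simp: inj_def)
  ultimately show False using assms(1) finite_subset range_inj_infinite by blast
qed

end


section \<open>Order-ideals of quotients of the talented monoid\<close>

context fin_digraph
begin

text \<open>The congruence of the quotient by the ideal over \<open>H\<close>, pulled back to
  multisets, where iterated quotients can be compared without classes of classes.\<close>

definition cong_mod :: "'a set \<Rightarrow> (('a \<times> int) multiset \<times> ('a \<times> int) multiset) set" where
  "cong_mod H = {(M, N). M \<in> multisets_over (verts G) \<and> N \<in> multisets_over (verts G) \<and>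
     (\<exists>A\<in>multisets_over H. \<exists>B\<in>multisets_over H. (M + A, N + B) \<in> talented_cong G)}"

lemma cong_modI:
  assumes "M \<in> multisets_over (verts G)" "N \<in> multisets_over (verts G)"
    "A \<in> multisets_over H" "B \<in> multisets_over H" "(M + A, N + B) \<in> talented_cong G"
  shows "(M, N) \<in> cong_mod H"
  using assms unfolding cong_mod_def by blast

lemma cong_mod_over:
  assumes "(M, N) \<in> cong_mod H" "hereditary_saturated H'" "H \<subseteq> H'"
  shows "M \<in> multisets_over H' \<longleftrightarrow> N \<in> multisets_over H'"
proof -
  obtain A B where AB: "A \<in> multisets_over H" "B \<in> multisets_over H" "(M + A, N + B) \<in> talented_cong G"
    using assms(1) by (auto simp: cong_mod_def)
  then have "A \<in> multisets_over H'" "B \<in> multisets_over H'"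
    using assms(3) multisets_over_mono by blast+
  with talented_cong_over[OF AB(3) assms(2)] show ?thesis by simp
qed

lemma cong_mod_empty: "cong_mod {} = talented_cong G"
  proof -
  have "multisets_over {} = {{#} :: ('a \<times> int) multiset}" using multisets_over_empty by auto
  then show ?thesis using talented_cong_carrier by (auto simp: cong_mod_def)
qed

end

text \<open>A monoid presented by \<open>\<phi>\<close> as the quotient of \<open>T_E\<close> by the
  ideal over \<open>H\<close>. This covers \<open>T_E\<close> itself, with \<open>H\<close> empty,
  and is stable under further quotients. So every step of an upper cyclic series, although it lives
  in a new quotient, is treated by the same lemmas.\<close>

locale talented_quotient = disjoint_cycles_digraph G + Q: gamma_monoid Q
  for G :: "('a, 'b) pre_digraph" (structure)
    and Q :: "(int, 'q, 'm) gmonoid_scheme" +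
  fixes \<phi> :: "('a \<times> int) multiset \<Rightarrow> 'q" and H :: "'a set"
  assumes hs: "hereditary_saturated H"
    and carrier_Q: "carrier Q = \<phi> ` multisets_over (verts G)"
    and \<phi>_add: "M \<in> multisets_over (verts G) \<Longrightarrow> N \<in> multisets_over (verts G) \<Longrightarrow>
      \<phi> (M + N) = \<phi> M \<otimes>\<^bsub>Q\<^esub> \<phi> N"
    and \<phi>_empty: "\<phi> {#} = \<one>\<^bsub>Q\<^esub>"
    and \<phi>_act: "M \<in> multisets_over (verts G) \<Longrightarrow> act Q n (\<phi> M) = \<phi> (shift n M)"
    and \<phi>_eq_iff: "M \<in> multisets_over (verts G) \<Longrightarrow> N \<in> multisets_over (verts G) \<Longrightarrow>
      \<phi> M = \<phi> N \<longleftrightarrow> (M, N) \<in> cong_mod H"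
begin

definition ideal_over :: "'a set \<Rightarrow> 'q set" where
  "ideal_over H' = \<phi> ` multisets_over H'"

lemma over_verts: "hereditary_saturated H' \<Longrightarrow> M \<in> multisets_over H' \<Longrightarrow> M \<in> multisets_over (verts G)"
  using hereditary_saturatedD(1) multisets_over_mono by blast

lemma in_ideal_over_iff:
  assumes "hereditary_saturated H'" "H \<subseteq> H'" "M \<in> multisets_over (verts G)"
  shows "\<phi> M \<in> ideal_over H' \<longleftrightarrow> M \<in> multisets_over H'"
proof
  assume "\<phi> M \<in> ideal_over H'"
  then obtain N where N: "N \<in> multisets_over H'" "\<phi> M = \<phi> N" by (auto simp: ideal_over_def)
  then have "(M, N) \<in> cong_mod H" using \<phi>_eq_iff assms over_verts by blast
  with cong_mod_over[OF _ assms(1,2)] N show "M \<in> multisets_over H'" by blast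
qed (auto simp: ideal_over_def)

lemma ideal_over_mono: "H' \<subseteq> H'' \<Longrightarrow> ideal_over H' \<subseteq> ideal_over H''"
  using multisets_over_mono unfolding ideal_over_def by blast

lemma ideal_over_subset_iff:
  assumes "hereditary_saturated H'" "hereditary_saturated H''" "H \<subseteq> H'" "H \<subseteq> H''"
  shows "ideal_over H' \<subseteq> ideal_over H'' \<longleftrightarrow> H' \<subseteq> H''"
proof
  assume sub: "ideal_over H' \<subseteq> ideal_over H''"
  show "H' \<subseteq> H''"
  proof
    fix v assume "v \<in> H'"
    then have v: "{#(v, 0)#} \<in> multisets_over H'" by simp
    then have "\<phi> {#(v, 0)#} \<in> ideal_over H''" using sub by (auto simp: ideal_over_def)
    then show "v \<in> H''" using in_ideal_over_iff[OF assms(2,4) over_verts[OF assms(1) v]] by simp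
  qed
qed (rule ideal_over_mono)

lemma \<phi>_over_H:
  assumes "M \<in> multisets_over H"
  shows "\<phi> M = \<one>\<^bsub>Q\<^esub>"
proof -
  have M: "M \<in> multisets_over (verts G)" using assms over_verts hs by blast
  then have "(M + {#}, {#} + M) \<in> talented_cong G"
    by (simp add: talented_cong.refl free_talented_simps)
  then have "(M, {#}) \<in> cong_mod H"
    using assms M by (intro cong_modI[of _ _ "{#}" H M]) auto
  then show ?thesis using \<phi>_eq_iff[OF M, of "{#}"] \<phi>_empty by simp
qed

lemma ideal_over_H: "ideal_over H = {\<one>\<^bsub>Q\<^esub>}"
  proof -
  have "\<phi> {#} \<in> ideal_over H" unfolding ideal_over_def by (intro imageI) simp
  then show ?thesis using \<phi>_over_H \<phi>_empty unfolding ideal_over_def by auto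
qed

lemma order_ideal_over:
  assumes "hereditary_saturated H'" "H \<subseteq> H'"
  shows "order_ideal Q (ideal_over H')"
  unfolding order_ideal_def
proof (intro conjI allI ballI impI)
  note v = over_verts[OF assms(1)]
  show "submonoid (ideal_over H') Q"
  proof
    show "ideal_over H' \<subseteq> carrier Q" using v by (auto simp: ideal_over_def carrier_Q)
    show "\<one>\<^bsub>Q\<^esub> \<in> ideal_over H'" using \<phi>_empty[symmetric] by (simp add: ideal_over_def)
    show "x \<otimes>\<^bsub>Q\<^esub> y \<in> ideal_over H'" if "x \<in> ideal_over H'" "y \<in> ideal_over H'" for x y
      using that \<phi>_add[symmetric] v by (auto simp: ideal_over_def)
  qed
  show "act Q g x \<in> ideal_over H'" if "x \<in> ideal_over H'" for g x
    using that \<phi>_act v by (auto simp: ideal_over_def)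
  fix a b assume "a \<in> carrier Q" "b \<in> carrier Q" "a \<otimes>\<^bsub>Q\<^esub> b \<in> ideal_over H'"
  then obtain M N where MN: "M \<in> multisets_over (verts G)" "N \<in> multisets_over (verts G)"
    "a = \<phi> M" "b = \<phi> N" "\<phi> (M + N) \<in> ideal_over H'"
    using \<phi>_add by (auto simp: carrier_Q)
  then have "M + N \<in> multisets_over H'" using in_ideal_over_iff[OF assms, of "M + N"] by simp
  then show "a \<in> ideal_over H'" "b \<in> ideal_over H'" using MN by (auto simp: ideal_over_def)
qed

lemma \<phi>_unfold:
  assumes "v \<in> verts G" "out_arcs G v \<noteq> {}"
  shows "\<phi> {#(v, i)#} = \<phi> (successors v i)"
proof -
  have "successors v i \<in> multisets_over (verts G)" by (auto simp: successors_over)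
  moreover have "({#(v, i)#} + {#}, successors v i + {#}) \<in> talented_cong G"
    using talented_cong.rel[OF assms] by (simp add: successors_def)
  ultimately have "({#(v, i)#}, successors v i) \<in> cong_mod H"
    using assms(1) \<open>successors v i \<in> _\<close> by (intro cong_modI[of _ _ "{#}" H "{#}"]) auto
  then show ?thesis using \<phi>_eq_iff assms(1) \<open>successors v i \<in> _\<close> by simp
qed

text \<open>An order-ideal contains a sum exactly when it contains the summands, so it is determined
  by its generators, and by shift invariance those of degree \<open>0\<close> suffice. The defining
  relations make their vertices a hereditary and saturated set.\<close>

lemma ideal_is_ideal_over:
  assumes I: "order_ideal Q I"
  obtains H' where "hereditary_saturated H'" "H \<subseteq> H'" "I = ideal_over H'"
proof -
  interpret I: submonoid I Q using I unfolding order_ideal_def by blast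
  have act: "act Q g x \<in> I" if "x \<in> I" for g x using I that unfolding order_ideal_def by blast
  define H' where "H' = {v \<in> verts G. \<phi> {#(v, 0)#} \<in> I}"
  have gen: "\<phi> {#(v, i)#} \<in> I \<longleftrightarrow> v \<in> H'" if "v \<in> verts G" for v i
    using act[of "\<phi> {#(v, 0)#}" i] act[of "\<phi> {#(v, i)#}" "- i"] \<phi>_act that by (auto simp: H'_def)
  have in_I: "\<phi> M \<in> I \<longleftrightarrow> M \<in> multisets_over H'" if "M \<in> multisets_over (verts G)" for M
    using that
  proof (induction M)
    case (add x M)
    obtain v i where x: "x = (v, i)" by force
    have eq: "\<phi> (add_mset x M) = \<phi> {#(v, i)#} \<otimes>\<^bsub>Q\<^esub> \<phi> M"
      using \<phi>_add[of "{#(v, i)#}" M] add.prems x by simp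
    have "\<phi> {#(v, i)#} \<otimes>\<^bsub>Q\<^esub> \<phi> M \<in> I \<longleftrightarrow> \<phi> {#(v, i)#} \<in> I \<and> \<phi> M \<in> I"
    proof
      assume "\<phi> {#(v, i)#} \<otimes>\<^bsub>Q\<^esub> \<phi> M \<in> I"
      moreover have "\<phi> {#(v, i)#} \<in> carrier Q" "\<phi> M \<in> carrier Q"
        using add.prems by (auto simp: carrier_Q x)
      ultimately show "\<phi> {#(v, i)#} \<in> I \<and> \<phi> M \<in> I" using I unfolding order_ideal_def by blast
    qed auto
    then show ?case using add x gen eq by simp
  qed (use \<phi>_empty in auto)
  show ?thesis
  proof (rule that[of H'])
    show "hereditary_saturated H'"
      unfolding hereditary_saturated_def
    proof (intro conjI ballI impI)
      fix v assume v: "v \<in> verts G" "out_arcs G v \<noteq> {}"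
      have "v \<in> H' \<longleftrightarrow> \<phi> (successors v 0) \<in> I"
        using \<phi>_unfold[OF v] v by (simp add: H'_def)
      also have "\<dots> \<longleftrightarrow> (\<forall>e\<in>out_arcs G v. head G e \<in> H')"
        by (subst in_I) (auto simp: successors_over)
      finally show "v \<in> H' \<longleftrightarrow> (\<forall>e\<in>out_arcs G v. head G e \<in> H')" .
    qed (auto simp: H'_def)
    show "H \<subseteq> H'"
      using \<phi>_over_H hereditary_saturatedD(1)[OF hs] by (auto simp: H'_def)
    show "I = ideal_over H'"
    proof
      show "I \<subseteq> ideal_over H'"
      proof
        fix x assume "x \<in> I"
        then obtain M where "M \<in> multisets_over (verts G)" "x = \<phi> M" using I.subset carrier_Q by auto
        then show "x \<in> ideal_over H'" using in_I \<open>x \<in> I\<close> by (auto simp: ideal_over_def)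
      qed
      show "ideal_over H' \<subseteq> I"
        using in_I multisets_over_mono[of _ H' "verts G"] by (auto simp: ideal_over_def H'_def)
    qed
  qed
qed

text \<open>A multiset over \<open>H\<close> is also one over \<open>H'\<close>, so the correction
  terms of the two successive quotients merge into a single pair over \<open>H'\<close>.\<close>

lemma talented_quotient_quot:
  assumes H': "hereditary_saturated H'" "H \<subseteq> H'"
  shows "talented_quotient G (quot_ideal Q (ideal_over H'))
    (\<lambda>M. ideal_rel Q (ideal_over H') `` {\<phi> M}) H'"
proof -
  let ?r = "ideal_rel Q (ideal_over H')"
  have o: "order_ideal Q (ideal_over H')" by (rule order_ideal_over[OF H'])
  interpret r: gamma_congruence Q ?r by (rule Q.gamma_congruence_ideal_rel[OF o])
  have c: "\<phi> M \<in> carrier Q" if "M \<in> multisets_over (verts G)" for M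
    using that carrier_Q by auto
  show ?thesis
  proof (intro talented_quotient.intro talented_quotient_axioms.intro
      disjoint_cycles_digraph_axioms Q.gamma_monoid_quot_ideal o H'(1))
    show "carrier (quot_ideal Q (ideal_over H')) = (\<lambda>M. ?r `` {\<phi> M}) ` multisets_over (verts G)"
      unfolding quot_ideal_def r.quot_carrier carrier_Q by (simp add: image_image)
    show "?r `` {\<phi> {#}} = \<one>\<^bsub>quot_ideal Q (ideal_over H')\<^esub>"
      unfolding quot_ideal_def r.quot_one \<phi>_empty ..
    fix M n assume M: "M \<in> multisets_over (verts G)"
    show "act (quot_ideal Q (ideal_over H')) n (?r `` {\<phi> M}) = ?r `` {\<phi> (shift n M)}"
      unfolding quot_ideal_def using r.quot_act[OF c[OF M]] \<phi>_act[OF M] by simp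
    fix N assume N: "N \<in> multisets_over (verts G)"
    show "?r `` {\<phi> (M + N)} = ?r `` {\<phi> M} \<otimes>\<^bsub>quot_ideal Q (ideal_over H')\<^esub> ?r `` {\<phi> N}"
      unfolding quot_ideal_def using r.quot_mult[OF c[OF M] c[OF N]] \<phi>_add[OF M N] by simp
    have "?r `` {\<phi> M} = ?r `` {\<phi> N} \<longleftrightarrow> (\<phi> M, \<phi> N) \<in> ?r"
      using eq_equiv_class_iff[OF r.equiv c[OF M] c[OF N]] .
    also have "\<dots> \<longleftrightarrow> (\<exists>A\<in>multisets_over H'. \<exists>B\<in>multisets_over H'. \<phi> M \<otimes>\<^bsub>Q\<^esub> \<phi> A = \<phi> N \<otimes>\<^bsub>Q\<^esub> \<phi> B)"
      using c[OF M] c[OF N] by (auto simp: ideal_rel_def ideal_over_def)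
    also have "\<dots> \<longleftrightarrow> (\<exists>A\<in>multisets_over H'. \<exists>B\<in>multisets_over H'. (M + A, N + B) \<in> cong_mod H)"
      using \<phi>_eq_iff \<phi>_add M N over_verts[OF H'(1)] by (intro bex_cong HOL.refl) (metis multisets_over_simps(3))
    also have "\<dots> \<longleftrightarrow> (M, N) \<in> cong_mod H'"
    proof
      assume "\<exists>A\<in>multisets_over H'. \<exists>B\<in>multisets_over H'. (M + A, N + B) \<in> cong_mod H"
      then obtain A B C D where AB: "A \<in> multisets_over H'" "B \<in> multisets_over H'"
        and CD: "C \<in> multisets_over H" "D \<in> multisets_over H"
        and eq: "(M + A + C, N + B + D) \<in> talented_cong G"
        by (auto simp: cong_mod_def)
      have "A + C \<in> multisets_over H'" "B + D \<in> multisets_over H'"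
        using AB CD multisets_over_mono[OF _ H'(2)] by auto
      with eq show "(M, N) \<in> cong_mod H'" using M N by (intro cong_modI) (auto simp: add.assoc)
    next
      assume "(M, N) \<in> cong_mod H'"
      then obtain A B where AB: "A \<in> multisets_over H'" "B \<in> multisets_over H'"
        "(M + A, N + B) \<in> talented_cong G" by (auto simp: cong_mod_def)
      then have "(M + A, N + B) \<in> cong_mod H"
        using M N over_verts[OF H'(1)] by (intro cong_modI[of _ _ "{#}" H "{#}"]) auto
      with AB show "\<exists>A\<in>multisets_over H'. \<exists>B\<in>multisets_over H'. (M + A, N + B) \<in> cong_mod H" by blast
    qed
    finally show "?r `` {\<phi> M} = ?r `` {\<phi> N} \<longleftrightarrow> (M, N) \<in> cong_mod H'" .
  qed
qed

lemma ideal_over_quotient: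
  "ideal_over H'' // ideal_rel Q I = (\<lambda>M. ideal_rel Q I `` {\<phi> M}) ` multisets_over H''"
  by (auto simp: ideal_over_def quotient_def)

end

section \<open>Cyclic ideals\<close>

context fin_digraph
begin

text \<open>The vertices of the largest cyclic ideal modulo \<open>H\<close>: a reachable sink
  outside \<open>H\<close>, or a reachable cycle with an exit not entering \<open>H\<close>, would
  put a non-periodic element into the ideal.\<close>

definition cyclic_step :: "'a set \<Rightarrow> 'a set" where
  "cyclic_step H = {v \<in> verts G. \<forall>w. v \<rightarrow>\<^sup>* w \<and> w \<notin> H \<longrightarrow> w \<notin> sinks \<and>
     (w \<in> cyclic_verts \<longrightarrow> (\<forall>e\<in>out_arcs G w. head G e \<rightarrow>\<^sup>* w \<or> head G e \<in> H))}"

lemma cyclic_step_reachable: "v \<in> cyclic_step H \<Longrightarrow> v \<rightarrow>\<^sup>* w \<Longrightarrow> w \<in> cyclic_step H"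
  using reachable_trans by (fastforce simp: cyclic_step_def reachable_in_verts)

text \<open>Take the earliest edge on a walk to \<open>w\<close> whose head cannot return to
  \<open>u\<close>; its tail is still mutually reachable with \<open>u\<close>.\<close>

lemma exit_arc:
  assumes "u \<rightarrow>\<^sup>* w" "\<not> w \<rightarrow>\<^sup>* u"
  obtains e where "e \<in> arcs G" "u \<rightarrow>\<^sup>* tail G e" "tail G e \<rightarrow>\<^sup>* u" "\<not> head G e \<rightarrow>\<^sup>* u" "head G e \<rightarrow>\<^sup>* w"
proof -
  have "\<exists>e\<in>arcs G. u \<rightarrow>\<^sup>* tail G e \<and> tail G e \<rightarrow>\<^sup>* u \<and> \<not> head G e \<rightarrow>\<^sup>* u \<and> head G e \<rightarrow>\<^sup>* w"
    if "awalk x p w" "u \<rightarrow>\<^sup>* x" "x \<rightarrow>\<^sup>* u" for x p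
    using that
  proof (induction p arbitrary: x)
    case (Cons e p)
    then have e: "e \<in> arcs G" "tail G e = x" "awalk (head G e) p w" by (auto simp: awalk_simps)
    show ?case
    proof (cases "head G e \<rightarrow>\<^sup>* u")
      case True
      moreover have "u \<rightarrow>\<^sup>* head G e" using Cons.prems(2) e arc_reachable reachable_trans by blast
      ultimately show ?thesis using Cons.IH e by blast
    next
      case False
      with Cons.prems e show ?thesis by (auto intro!: bexI[of _ e] dest: reachable_awalkI)
    qed
  qed (use assms in \<open>auto simp: awalk_simps\<close>)
  moreover obtain p where "awalk u p w" using assms(1) reachable_awalk by auto
  moreover have "u \<rightarrow>\<^sup>* u" using assms(1) by (auto simp: reachable_in_verts)
  ultimately show thesis using that by blast
qed

end

section \<open>Periodic elements\<close>

context talented_quotient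
begin

definition periodic :: "'q \<Rightarrow> bool" where
  "periodic x \<longleftrightarrow> (\<exists>n>0. act Q n x = x)"

lemma act_multiple:
  assumes "x \<in> carrier Q" "act Q n x = x"
  shows "act Q (int k * n) x = x"
proof (induction k)
  case 0
  then show ?case using Q.act_0 assms by simp
next
  case (Suc k)
  have "act Q (n + int k * n) x = act Q n (act Q (int k * n) x)" by (rule Q.act_add[OF assms(1)])
  then show ?case using Suc assms(2) by (simp add: algebra_simps)
qed

lemma periodic_iff:
  assumes "x \<in> carrier Q"
  shows "periodic x \<longleftrightarrow> (\<exists>g. g \<noteq> 0 \<and> act Q g x = x)"
proof
  assume "\<exists>g. g \<noteq> 0 \<and> act Q g x = x"
  then obtain g where g: "g \<noteq> 0" "act Q g x = x" by blast
  have "act Q (- g) x = act Q (- g + g) x" using Q.act_add[OF assms, of "- g" g] g by simp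
  then have "act Q (- g) x = x" using Q.act_0[OF assms] by simp
  with g show "periodic x" unfolding periodic_def by (cases "g > 0") (auto intro: exI[of _ "- g"])
next
  assume "periodic x"
  then obtain n where "0 < n" "act Q n x = x" by (auto simp: periodic_def)
  then show "\<exists>g. g \<noteq> 0 \<and> act Q g x = x" by (intro exI[of _ n]) simp
qed

lemma periodic_mult:
  assumes "x \<in> carrier Q" "y \<in> carrier Q" "periodic x" "periodic y"
  shows "periodic (x \<otimes>\<^bsub>Q\<^esub> y)"
proof -
  obtain m n where mn: "0 < m" "act Q m x = x" "0 < n" "act Q n y = y"
    using assms by (auto simp: periodic_def)
  have "act Q (n * m) x = x" using act_multiple[OF assms(1) mn(2), of "nat n"] mn by simp
  moreover have "act Q (n * m) y = y"
    using act_multiple[OF assms(2) mn(4), of "nat m"] mn by (simp add: mult.commute)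
  ultimately show ?thesis
    unfolding periodic_def using mn Q.act_mult[OF assms(1,2)] by (intro exI[of _ "n * m"]) simp
qed

lemma \<phi>_carrier: "M \<in> multisets_over (verts G) \<Longrightarrow> \<phi> M \<in> carrier Q"
  using carrier_Q by blast

lemma periodic_\<phi>:
  assumes "M \<in> multisets_over (verts G)" "\<And>v i. (v, i) \<in># M \<Longrightarrow> periodic (\<phi> {#(v, i)#})"
  shows "periodic (\<phi> M)"
  using assms
proof (induction M)
  case empty
  then show ?case using Q.act_one \<phi>_empty by (auto simp: periodic_def intro: exI[of _ 1])
next
  case (add x M)
  obtain v i where x: "x = (v, i)" by force
  have "\<phi> (add_mset x M) = \<phi> {#x#} \<otimes>\<^bsub>Q\<^esub> \<phi> M"
    using \<phi>_add[of "{#x#}" M] add.prems x by simp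
  moreover have "periodic (\<phi> {#x#} \<otimes>\<^bsub>Q\<^esub> \<phi> M)"
    using add x by (intro periodic_mult \<phi>_carrier) auto
  ultimately show ?case by simp
qed

lemma successors_remove:
  assumes "e \<in> out_arcs G v"
  shows "successors v i = {#(head G e, i + 1)#} +
    image_mset (\<lambda>e. (head G e, i + 1)) (mset_set (out_arcs G v - {e}))"
  unfolding successors_def using mset_set.remove[OF finite_out_arcs assms] by simp

text \<open>Unfolding a vertex of such a cycle leaves one summand, the head of the edge that stays
  on the cycle; all others lie over \<open>H\<close> and vanish. So each edge traversed costs a
  shift by one.\<close>

lemma \<phi>_along_cycle:
  assumes v: "v \<in> cyclic_step H" "v \<notin> H" "v \<in> cyclic_verts"
    and walk: "awalk w p v" and vw: "v \<rightarrow>\<^sup>* w"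
  shows "\<phi> {#(w, i)#} = \<phi> {#(v, i + int (length p))#}"
  using walk vw
proof (induction p arbitrary: w i)
  case Nil
  then show ?case by (simp add: awalk_simps)
next
  case (Cons e p)
  then have e: "e \<in> arcs G" "tail G e = w" "awalk (head G e) p v" by (auto simp: awalk_simps)
  have returns: "head G e \<rightarrow>\<^sup>* w" using e(3) Cons.prems(2) reachable_awalkI reachable_trans by blast
  have w: "w \<in> verts G" "w \<in> cyclic_verts" using e returns cyclic_if_arc_back by auto
  have "w \<notin> H"
    using hereditary_reachable[OF hs reachable_awalkI[OF Cons.prems(1)]] v(2) by blast
  \<comment> \<open>By disjointness a second edge cannot return to \<open>w\<close>, and
    \<open>cyclic_step\<close> sends it into \<open>H\<close>.\<close>
  have rest: "head G f \<in> H" if f: "f \<in> out_arcs G w - {e}" for f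
  proof -
    have "\<not> head G f \<rightarrow>\<^sup>* w" using unique_arc_back[of e f] e returns f by auto
    then show ?thesis using v(1) Cons.prems(2) \<open>w \<notin> H\<close> w(2) f unfolding cyclic_step_def by blast
  qed
  define M where "M = image_mset (\<lambda>f. (head G f, i + 1)) (mset_set (out_arcs G w - {e}))"
  have M: "M \<in> multisets_over H" using rest by (auto simp: M_def multisets_over_def)
  have h: "head G e \<in> verts G" using e by simp
  have "\<phi> {#(w, i)#} = \<phi> (successors w i)"
    by (rule \<phi>_unfold) (use w e in auto)
  also have "successors w i = {#(head G e, i + 1)#} + M"
    unfolding M_def by (rule successors_remove) (use e in auto)
  also have "\<phi> \<dots> = \<phi> {#(head G e, i + 1)#} \<otimes>\<^bsub>Q\<^esub> \<phi> M"
    by (rule \<phi>_add) (use h over_verts[OF hs M] in simp_all)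
  also have "\<dots> = \<phi> {#(head G e, i + 1)#}"
    using \<phi>_over_H[OF M] \<phi>_carrier[of "{#(head G e, i + 1)#}"] h by simp
  also have "\<dots> = \<phi> {#(v, i + 1 + int (length p))#}"
    by (rule Cons.IH[OF e(3)]) (use Cons.prems(2) e arc_reachable reachable_trans in blast)
  finally show ?case by (simp add: algebra_simps)
qed

text \<open>On a cycle the generator is carried once around. Elsewhere unfolding leads to vertices
  that cannot return, and finitely many periodic summands have a common period.\<close>

lemma periodic_generator:
  assumes "v \<in> verts G" "v \<in> cyclic_step H"
  shows "periodic (\<phi> {#(v, i)#})"
  using assms
proof (induction arbitrary: i rule: reachable_less_induct)
  case (less v)
  show ?case
  proof (cases "v \<in> H")
    case True
    then show ?thesis
      using \<phi>_over_H[of "{#(v, i)#}"] Q.act_one by (auto simp: periodic_def intro: exI[of _ 1])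
  next
    case vH: False
    then have v: "v \<notin> sinks" using less.prems less.hyps by (auto simp: cyclic_step_def)
    then have out: "out_arcs G v \<noteq> {}" using less.hyps by (auto simp: sinks_def)
    show ?thesis
    proof (cases "v \<in> cyclic_verts")
      case True
      then obtain p where p: "awalk v p v" "p \<noteq> []"
        by (auto simp: cyclic_verts_def reachable1_awalk)
      have "\<phi> {#(v, i)#} = \<phi> {#(v, i + int (length p))#}"
        by (rule \<phi>_along_cycle[OF less.prems vH True p(1)]) (use less.hyps in blast)
      then have "act Q (int (length p)) (\<phi> {#(v, i)#}) = \<phi> {#(v, i)#}"
        using \<phi>_act[of "{#(v, i)#}"] less.hyps by simp
      then show ?thesis using p(2) unfolding periodic_def by (intro exI[of _ "int (length p)"]) simp
    next
      case False
      have "periodic (\<phi> (successors v i))"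
      proof (rule periodic_\<phi>)
        fix w j assume "(w, j) \<in># successors v i"
        then obtain e where e: "e \<in> arcs G" "tail G e = v" "head G e = w"
          by (auto simp: successors_def)
        then have "v \<rightarrow>\<^sup>* w" "\<not> w \<rightarrow>\<^sup>* v" using arc_reachable cyclic_if_arc_back False by auto
        then show "periodic (\<phi> {#(w, j)#})"
          using less.IH cyclic_step_reachable[OF less.prems] by blast
      qed (auto simp: successors_over)
      then show ?thesis using \<phi>_unfold[OF less.hyps out] by simp
    qed
  qed
qed

lemma level_count_shift_eq:
  assumes "M \<in> multisets_over (verts G)" "act Q n (\<phi> M) = \<phi> M"
  obtains A B where "A \<in> multisets_over H" "B \<in> multisets_over H"
    "(shift n M + A, M + B) \<in> talented_cong G"
proof -
  have "\<phi> (shift n M) = \<phi> M" using assms \<phi>_act by simp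
  then have "(shift n M, M) \<in> cong_mod H" using \<phi>_eq_iff assms(1) by simp
  then show thesis using that by (auto simp: cong_mod_def)
qed

text \<open>The count of arrivals at \<open>w\<close> at time \<open>0\<close> sees
  \<open>w(0)\<close> but not \<open>w(n)\<close> with \<open>n > 0\<close>, and it ignores
  corrections over \<open>H\<close>, since no vertex of \<open>H\<close> reaches
  \<open>w\<close>.\<close>

lemma sink_not_periodic:
  assumes "w \<in> sinks" "w \<notin> H"
  shows "\<not> periodic (\<phi> {#(w, 0)#})"
proof
  assume "periodic (\<phi> {#(w, 0)#})"
  then obtain n where n: "0 < n" "act Q n (\<phi> {#(w, 0)#}) = \<phi> {#(w, 0)#}" by (auto simp: periodic_def)
  have "w \<in> verts G" using assms by (simp add: sinks_def)
  then obtain A B where AB: "A \<in> multisets_over H" "B \<in> multisets_over H"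
    "(shift n {#(w, 0)#} + A, {#(w, 0)#} + B) \<in> talented_cong G"
    using level_count_shift_eq[OF _ n(2)] by auto
  have 0: "level_count {w} 0 M = 0" if "M \<in> multisets_over H" for M
    by (rule level_count_hereditary[OF hs _ that]) (use assms(2) in auto)
  have "level_count {w} 0 (shift n {#(w, 0)#} + A) = level_count {w} 0 ({#(w, 0)#} + B)"
    by (rule level_count_sink_cong[OF AB(3) assms(1)])
  then show False using 0[OF AB(1)] 0[OF AB(2)] n(1) by simp
qed

text \<open>
  Every vertex outside \<open>H\<close> that reaches no sink outside \<open>H\<close> has walks of every length ending
  outside \<open>H\<close>.  So an exit makes the number of such walks from a cycle grow, while periodicity
  would make it eventually periodic.
\<close>

lemma walk_count_outside_pos:
  assumes "x \<in> verts G" "x \<notin> H" "\<And>w. x \<rightarrow>\<^sup>* w \<Longrightarrow> w \<in> sinks \<Longrightarrow> w \<in> H"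
  shows "0 < walk_count (- H) k x"
  using assms
proof (induction k arbitrary: x)
  case (Suc k)
  have "x \<notin> sinks" using Suc.prems by blast
  then have out: "out_arcs G x \<noteq> {}" using Suc.prems(1) by (simp add: sinks_def)
  obtain e where e: "e \<in> out_arcs G x" "head G e \<notin> H"
    using hs Suc.prems(1,2) out unfolding hereditary_saturated_def by blast
  have "x \<rightarrow>\<^sup>* head G e" using e arc_reachable by auto
  have "0 < walk_count (- H) k (head G e)"
  proof (rule Suc.IH)
    show "w \<in> H" if "head G e \<rightarrow>\<^sup>* w" "w \<in> sinks" for w
      using Suc.prems(3)[OF reachable_trans[OF \<open>x \<rightarrow>\<^sup>* head G e\<close> that(1)] that(2)] .
  qed (use e in auto)
  also have "\<dots> \<le> walk_count (- H) (Suc k) x" using walk_count_arc e by auto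
  finally show ?case .
qed simp

lemma exit_not_periodic:
  assumes e: "e \<in> out_arcs G u" "head G e \<rightarrow>\<^sup>* u"
    and f: "f \<in> out_arcs G u" "e \<noteq> f" "head G f \<notin> H"
    and sink: "\<And>w. head G f \<rightarrow>\<^sup>* w \<Longrightarrow> w \<in> sinks \<Longrightarrow> w \<in> H"
  shows "\<not> periodic (\<phi> {#(u, 0)#})"
proof
  let ?c = "walk_count (- H)"
  assume "periodic (\<phi> {#(u, 0)#})"
  then obtain n where n: "0 < n" "act Q n (\<phi> {#(u, 0)#}) = \<phi> {#(u, 0)#}" by (auto simp: periodic_def)
  obtain l where l: "0 < l" "\<And>m. ?c m u + ?c (m + l - 1) (head G f) \<le> ?c (m + l) u"
    using walk_count_exit[OF e(1) f(1,2) e(2)] by blast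
  \<comment> \<open>Every round brings a surplus of walks starting with \<open>f\<close>; it is
    enough to keep the last one.\<close>
  have grow: "?c m u + ?c (m + Suc j * l - 1) (head G f) \<le> ?c (m + Suc j * l) u" for m j
  proof (induction j)
    case (Suc j)
    have "?c m u \<le> ?c (m + Suc j * l) u" using Suc by linarith
    then show ?case using l(2)[of "m + Suc j * l"] by (simp add: algebra_simps)
  qed (use l(2) in simp)
  have u: "u \<in> verts G" using e by auto
  \<comment> \<open>A common multiple of the period and the length of the round: shifting by it
    would preserve late counts, while the rounds increase them.\<close>
  have "act Q (int l * n) (\<phi> {#(u, 0)#}) = \<phi> {#(u, 0)#}"
    using act_multiple n(2) \<phi>_carrier u by simp
  then obtain A B where AB: "A \<in> multisets_over H" "B \<in> multisets_over H"
    "(shift (int l * n) {#(u, 0)#} + A, {#(u, 0)#} + B) \<in> talented_cong G"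
    using level_count_shift_eq[of "{#(u, 0)#}" "int l * n"] u by auto
  obtain k0 where k0: "\<And>k. k0 \<le> k \<Longrightarrow> level_count (- H) k (shift (int l * n) {#(u, 0)#} + A)
      = level_count (- H) k ({#(u, 0)#} + B)"
    using level_count_eventually_cong[OF AB(3)] by blast
  define N where "N = nat n * l"
  have N: "int N = int l * n" using n(1) by (simp add: N_def)
  have 0: "level_count (- H) k M = 0" if "M \<in> multisets_over H" for M k
    by (rule level_count_hereditary[OF hs _ that]) simp
  define m where "m = nat k0"
  have "k0 \<le> int (m + N)" using N n(1) l(1) by (simp add: m_def)
  from k0[OF this] have "?c m u = ?c (m + N) u"
    using 0[OF AB(1)] 0[OF AB(2)] by (simp add: N[symmetric] nat_add_distrib)
  moreover obtain j where "nat n = Suc j" using n(1) by (cases "nat n") auto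
  then have "?c m u + ?c (m + N - 1) (head G f) \<le> ?c (m + N) u" using grow[of m j] by (simp add: N_def)
  moreover have "0 < ?c (m + N - 1) (head G f)"
    by (rule walk_count_outside_pos[OF _ f(3) sink]) (use f in auto)
  ultimately show False by simp
qed

lemma cyclic_ideal_over_iff:
  assumes H': "hereditary_saturated H'" "H \<subseteq> H'"
  shows "cyclic_ideal Q (ideal_over H') \<longleftrightarrow> H' \<subseteq> cyclic_step H"
proof
  assume sub: "H' \<subseteq> cyclic_step H"
  have "periodic (\<phi> M)" if M: "M \<in> multisets_over H'" for M
  proof (rule periodic_\<phi>[OF over_verts[OF H'(1) M]])
    fix v i assume "(v, i) \<in># M"
    then have "v \<in> H'" using M by (auto simp: multisets_over_def)
    then show "periodic (\<phi> {#(v, i)#})"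
      using periodic_generator sub hereditary_saturatedD(1)[OF H'(1)] by blast
  qed
  then show "cyclic_ideal Q (ideal_over H')"
    unfolding cyclic_ideal_def using order_ideal_over[OF H'] periodic_iff \<phi>_carrier over_verts[OF H'(1)]
    by (force simp: ideal_over_def)
next
  assume cyc: "cyclic_ideal Q (ideal_over H')"
  have per: "periodic (\<phi> {#(v, 0)#})" if "v \<in> H'" for v
  proof -
    have v: "{#(v, 0)#} \<in> multisets_over H'" using that by simp
    then have "\<phi> {#(v, 0)#} \<in> ideal_over H'" by (simp only: ideal_over_def image_eqI)
    then have "\<exists>g. g \<noteq> 0 \<and> act Q g (\<phi> {#(v, 0)#}) = \<phi> {#(v, 0)#}"
      using cyc unfolding cyclic_ideal_def by blast
    then show ?thesis using periodic_iff[OF \<phi>_carrier[OF over_verts[OF H'(1) v]]] by blast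
  qed
  \<comment> \<open>Sinks have to be settled before exits: the counting in
    \<open>exit_not_periodic\<close> relies on every sink behind the exit being in
    \<open>H\<close>.\<close>
  have sink: "w \<in> H" if "v \<in> H'" "v \<rightarrow>\<^sup>* w" "w \<in> sinks" for v w
    using sink_not_periodic per hereditary_reachable[OF H'(1)] that by blast
  show "H' \<subseteq> cyclic_step H"
  proof
    fix v assume v: "v \<in> H'"
    show "v \<in> cyclic_step H"
      unfolding cyclic_step_def
    proof (intro CollectI conjI allI impI ballI)
      show "v \<in> verts G" using v hereditary_saturatedD(1)[OF H'(1)] by blast
      fix w assume w: "v \<rightarrow>\<^sup>* w \<and> w \<notin> H"
      then show "w \<notin> sinks" using sink v by blast
      fix f assume wc: "w \<in> cyclic_verts" and f: "f \<in> out_arcs G w"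
      have wH': "w \<in> H'" using w v hereditary_reachable[OF H'(1)] by blast
      obtain e where e: "e \<in> out_arcs G w" "head G e \<rightarrow>\<^sup>* w"
        using wc reachable_head unfolding cyclic_verts_def by blast
      show "head G f \<rightarrow>\<^sup>* w \<or> head G f \<in> H"
      proof (rule ccontr)
        assume neg: "\<not> (head G f \<rightarrow>\<^sup>* w \<or> head G f \<in> H)"
        moreover have "w \<rightarrow>\<^sup>* head G f" using f arc_reachable by auto
        then have "head G f \<in> H'" using wH' hereditary_reachable[OF H'(1)] by blast
        ultimately have "\<not> periodic (\<phi> {#(w, 0)#})"
          using e f sink by (intro exit_not_periodic[of e w f]) auto
        then show False using per[OF wH'] by blast
      qed
    qed
  qed
qed

text \<open>The quotient by the ideal over \<open>Hs i\<close> is again a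
  \<open>talented_quotient\<close>, and its cyclic ideals are those over sets inside
  \<open>cyclic_step (Hs i)\<close>. So the largest one lies over \<open>Hs (Suc i)\<close>, and the
  series stops when the sets do.\<close>

lemma upper_cyclic_series_ideals:
  assumes Hs0: "Hs 0 = H" and hsH: "\<And>i. hereditary_saturated (Hs i)"
    and step: "\<And>i. cyclic_step (Hs i) = Hs (Suc i)"
    and strict: "\<And>i. i < n \<Longrightarrow> Hs i \<subset> Hs (Suc i)"
    and top: "Hs (Suc n) = Hs n"
  shows "upper_cyclic_series Q (map (\<lambda>i. ideal_over (Hs i)) [0..<Suc n])"
proof -
  \<comment> \<open>A hereditary set lies in its own \<open>cyclic_step\<close>, as nothing outside
    it is reachable.\<close>
  have mono_step: "Hs i \<subseteq> Hs (Suc i)" for i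
    unfolding step[symmetric] using hereditary_reachable[OF hsH] hereditary_saturatedD(1)[OF hsH]
    by (fastforce simp: cyclic_step_def)
  have mono: "Hs i \<subseteq> Hs j" if "i \<le> j" for i j
    using lift_Suc_mono_le[of Hs, OF mono_step that] .
  have HHs: "H \<subseteq> Hs i" for i using mono[of 0 i] Hs0 by simp
  have quot: "talented_quotient G (quot_ideal Q (ideal_over (Hs i)))
      (\<lambda>M. ideal_rel Q (ideal_over (Hs i)) `` {\<phi> M}) (Hs i)" for i
    by (rule talented_quotient_quot[OF hsH HHs])
  have cyc: "cyclic_ideal (quot_ideal Q (ideal_over (Hs i))) K \<Longrightarrow>
      K \<subseteq> ideal_over (Hs (Suc i)) // ideal_rel Q (ideal_over (Hs i))"
    "cyclic_ideal (quot_ideal Q (ideal_over (Hs i)))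
      (ideal_over (Hs (Suc i)) // ideal_rel Q (ideal_over (Hs i)))" for i K
  proof -
    interpret q: talented_quotient G "quot_ideal Q (ideal_over (Hs i))"
      "\<lambda>M. ideal_rel Q (ideal_over (Hs i)) `` {\<phi> M}" "Hs i" by (rule quot)
    have eq: "ideal_over (Hs (Suc i)) // ideal_rel Q (ideal_over (Hs i)) = q.ideal_over (Hs (Suc i))"
      by (simp add: ideal_over_quotient q.ideal_over_def)
    show "cyclic_ideal (quot_ideal Q (ideal_over (Hs i)))
        (ideal_over (Hs (Suc i)) // ideal_rel Q (ideal_over (Hs i)))"
      unfolding eq using q.cyclic_ideal_over_iff[OF hsH mono_step] step by simp
    assume K: "cyclic_ideal (quot_ideal Q (ideal_over (Hs i))) K"
    then obtain H' where H': "hereditary_saturated H'" "Hs i \<subseteq> H'" "K = q.ideal_over H'"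
      using q.ideal_is_ideal_over unfolding cyclic_ideal_def by blast
    with K q.cyclic_ideal_over_iff step have "H' \<subseteq> Hs (Suc i)" by simp
    then show "K \<subseteq> ideal_over (Hs (Suc i)) // ideal_rel Q (ideal_over (Hs i))"
      unfolding eq H'(3) by (rule q.ideal_over_mono)
  qed
  have ord: "order_ideal Q (ideal_over (Hs i))" for i by (rule order_ideal_over[OF hsH HHs])
  let ?Is = "map (\<lambda>i. ideal_over (Hs i)) [0..<Suc n]"
  show ?thesis
    unfolding upper_cyclic_series_def
  proof (intro conjI ballI allI impI)
    show "?Is \<noteq> []" by simp
    show "hd ?Is = {\<one>\<^bsub>Q\<^esub>}"
      using ideal_over_H Hs0 by (simp add: hd_map del: upt_Suc)
    show "order_ideal Q I" if "I \<in> set ?Is" for I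
      using that ord by auto
  next
    fix i assume "Suc i < length ?Is"
    then have i: "i < n" by simp
    have nth: "?Is ! j = ideal_over (Hs j)" if "j \<le> n" for j
      using that by (simp del: upt_Suc)
    note ni = nth[of i] nth[of "Suc i"]
    show "?Is ! i \<subset> ?Is ! Suc i"
      using ni i strict[OF i] ideal_over_subset_iff[OF hsH hsH HHs HHs] by (simp add: less_le_not_le del: upt_Suc)
    show "cyclic_ideal (quot_ideal Q (?Is ! i))
        (?Is ! Suc i //
          ideal_rel Q (?Is ! i))"
      using ni i cyc(2)[of i] by (simp del: upt_Suc)
    show "K \<subseteq> ?Is ! Suc i //
          ideal_rel Q (?Is ! i)"
      if "cyclic_ideal (quot_ideal Q (?Is ! i)) K" for K
      using ni i cyc(1)[of i K] that by (simp del: upt_Suc)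
  next
    fix K assume "cyclic_ideal (quot_ideal Q (last ?Is)) K"
    then have K: "cyclic_ideal (quot_ideal Q (ideal_over (Hs n))) K" by (simp add: last_map)
    interpret q: talented_quotient G "quot_ideal Q (ideal_over (Hs n))"
      "\<lambda>M. ideal_rel Q (ideal_over (Hs n)) `` {\<phi> M}" "Hs n" by (rule quot)
    have "K \<subseteq> q.ideal_over (Hs n)"
      using cyc(1)[OF K] top by (simp add: ideal_over_quotient q.ideal_over_def)
    moreover have "\<one>\<^bsub>quot_ideal Q (ideal_over (Hs n))\<^esub> \<in> K"
      using K unfolding cyclic_ideal_def order_ideal_def by (blast dest: submonoid.one_closed)
    ultimately show "K = {\<one>\<^bsub>quot_ideal Q (last ?Is)\<^esub>}"
      using q.ideal_over_H by (auto simp: last_map)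
  qed
qed

lemma upper_cyclic_series_length_leading:
  assumes "upper_cyclic_series Q Is"
  shows "cyclic_length Q = length Is - 1" "leading_ideal Q = last Is"
proof -
  have "(THE Is. upper_cyclic_series Q Is) = Is"
    using assms Q.upper_cyclic_series_unique by blast
  then show "cyclic_length Q = length Is - 1" "leading_ideal Q = last Is"
    by (simp_all add: cyclic_length_def leading_ideal_def)
qed

end

section \<open>The upper cyclic series in terms of chains of cycles\<close>

text \<open>
  The three instances needed are \<open>(D, Z) = ({}, all cycles)\<close> for the quotient by the
  non-comparable ideal, \<open>(vertices reaching a sink, all cycles)\<close> for the talented monoid itself,
  and \<open>({}, cycles reaching a sink)\<close> for the quotient by the sum of the two ideals.
\<close>

locale cycle_levels = disjoint_cycles_digraph +
  fixes D Z :: "'a set"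
  assumes Z_cyclic: "Z \<subseteq> cyclic_verts"
    and D_up: "v \<rightarrow>\<^sup>* w \<Longrightarrow> w \<in> D \<Longrightarrow> v \<in> D"
    and D_sink: "v \<in> D \<Longrightarrow> \<exists>w\<in>sinks \<inter> D. v \<rightarrow>\<^sup>* w"
    and other_cycles: "u \<in> cyclic_verts \<Longrightarrow> u \<notin> Z \<Longrightarrow> z \<in> Z \<Longrightarrow> \<not> u \<rightarrow>\<^sup>* z"
begin

sublocale preorder_on_finite "\<lambda>a b. a \<rightarrow>\<^sup>* b" Z
  using Z_cyclic cyclic_verts_subset by (intro preorder_reachable) blast

text \<open>\<open>level 0\<close> is the set divided out at the start. It contains the cycles
  outside \<open>Z\<close> and \<open>D\<close>, since they reach no cycle of \<open>Z\<close>.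
  Vertices of \<open>D\<close> never enter, because each reaches a sink of \<open>D\<close>.\<close>

definition level :: "nat \<Rightarrow> 'a set" where
  "level i = {v \<in> verts G - D. cycle_rank Z v \<le> i}"

lemma sink_rank: "w \<in> sinks \<Longrightarrow> cycle_rank Z w = 0"
  unfolding chain_rank_eq_0_iff using sink_reachable sink_not_cyclic Z_cyclic by blast

lemma level_reachable: "v \<in> level i \<Longrightarrow> v \<rightarrow>\<^sup>* w \<Longrightarrow> w \<in> level i"
  using chain_rank_mono[of v w] D_up[of v w] by (auto simp: level_def reachable_in_verts)

lemma hereditary_saturated_level: "hereditary_saturated (level i)"
  unfolding hereditary_saturated_def
proof (intro conjI ballI impI iffI)
  show "level i \<subseteq> verts G" by (auto simp: level_def)
  fix v assume v: "v \<in> verts G" "out_arcs G v \<noteq> {}"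
  show "head G e \<in> level i" if "v \<in> level i" "e \<in> out_arcs G v" for e
    using level_reachable[OF that(1)] arc_reachable[of e] that(2) by auto
  assume heads: "\<forall>e\<in>out_arcs G v. head G e \<in> level i"
  \<comment> \<open>A sink of \<open>D\<close> or a cycle of \<open>Z\<close> that would keep
    \<open>v\<close> out is reached by a nonempty walk, hence already from a head. If it is
    \<open>v\<close> itself, the cycle supplies that walk.\<close>
  have below: "w \<in> level i" if "v \<rightarrow>\<^sup>+ w" for w
    using reachable_head[OF that] heads level_reachable by metis
  have "v \<notin> D"
  proof
    assume "v \<in> D"
    then obtain w where w: "w \<in> sinks" "w \<in> D" "v \<rightarrow>\<^sup>* w" using D_sink by blast
    then have "v \<rightarrow>\<^sup>+ w" using v by (auto simp: sinks_def)
    then show False using below w(2) by (auto simp: level_def)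
  qed
  moreover have "cycle_rank Z v \<le> i"
  proof (cases "cycle_rank Z v")
    case (Suc k)
    then obtain u where u: "u \<in> Z" "v \<rightarrow>\<^sup>* u" "cycle_rank Z u = Suc k" using chain_rank_step by metis
    then have "v \<rightarrow>\<^sup>+ u" using Z_cyclic by (auto simp: cyclic_verts_def)
    then show ?thesis using below[of u] u(3) Suc by (simp add: level_def)
  qed simp
  ultimately show "v \<in> level i" using v by (simp add: level_def)
qed

text \<open>Leaving a cycle of \<open>Z\<close> for good lowers the rank, which gives one inclusion.
  Conversely, a vertex of rank above \<open>Suc i\<close> reaches a cycle with an exit towards a
  cycle of rank still above \<open>i\<close>, and that exit stays outside
  \<open>level i\<close>.\<close>

lemma cyclic_step_level: "cyclic_step (level i) = level (Suc i)"
proof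
  show "level (Suc i) \<subseteq> cyclic_step (level i)"
  proof
    fix v assume v: "v \<in> level (Suc i)"
    show "v \<in> cyclic_step (level i)"
      unfolding cyclic_step_def
    proof (intro CollectI conjI allI impI ballI)
      show "v \<in> verts G" using v by (simp add: level_def)
      fix w assume w: "v \<rightarrow>\<^sup>* w \<and> w \<notin> level i"
      then have wl: "w \<in> level (Suc i)" using level_reachable v by blast
      then have rk: "cycle_rank Z w = Suc i" "w \<notin> D" using w by (auto simp: level_def)
      then show "w \<notin> sinks" using sink_rank by force
      fix e assume wc: "w \<in> cyclic_verts" and e: "e \<in> out_arcs G w"
      have "w \<in> Z"
      proof (rule ccontr)
        assume "w \<notin> Z"
        then have "cycle_rank Z w = 0" unfolding chain_rank_eq_0_iff using other_cycles[OF wc] by blast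
        with rk(1) show False by simp
      qed
      have we: "w \<rightarrow>\<^sup>* head G e" using e arc_reachable by auto
      have "head G e \<in> level i" if "\<not> head G e \<rightarrow>\<^sup>* w"
        using chain_rank_less[OF \<open>w \<in> Z\<close> we that] rk level_reachable[OF wl we] by (simp add: level_def)
      then show "head G e \<rightarrow>\<^sup>* w \<or> head G e \<in> level i" by blast
    qed
  qed
  show "cyclic_step (level i) \<subseteq> level (Suc i)"
  proof
    fix v assume v: "v \<in> cyclic_step (level i)"
    have "v \<notin> D"
    proof
      assume "v \<in> D"
      then obtain w where "w \<in> sinks" "w \<in> D" "v \<rightarrow>\<^sup>* w" using D_sink by blast
      then show False using v by (auto simp: cyclic_step_def level_def)
    qed
    moreover have "cycle_rank Z v \<le> Suc i"
    proof (rule ccontr)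
      assume "\<not> cycle_rank Z v \<le> Suc i"
      then obtain k where k: "cycle_rank Z v = Suc k" "Suc i \<le> k" by (cases "cycle_rank Z v") auto
      obtain u where u: "u \<in> Z" "v \<rightarrow>\<^sup>* u" "cycle_rank Z u = Suc k"
        "k \<noteq> 0 \<Longrightarrow> \<exists>u'\<in>Z. u \<rightarrow>\<^sup>* u' \<and> \<not> u' \<rightarrow>\<^sup>* u \<and> cycle_rank Z u' = k"
        using chain_rank_step[OF k(1)] by metis
      then obtain u' where u': "u \<rightarrow>\<^sup>* u'" "\<not> u' \<rightarrow>\<^sup>* u" "cycle_rank Z u' = k" using k(2) by auto
      obtain e where e: "e \<in> arcs G" "u \<rightarrow>\<^sup>* tail G e" "tail G e \<rightarrow>\<^sup>* u" "\<not> head G e \<rightarrow>\<^sup>* u" "head G e \<rightarrow>\<^sup>* u'"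
        using exit_arc[OF u'(1,2)] by metis
      have "tail G e \<in> cyclic_verts"
        using mutually_reachable_cyclic[OF _ e(2,3)] u(1) Z_cyclic by blast
      moreover have "tail G e \<notin> level i"
        using chain_rank_mono[OF e(3)] u(3) k(2) by (simp add: level_def)
      moreover have "head G e \<notin> level i"
        using chain_rank_mono[OF e(5)] u'(3) k(2) by (simp add: level_def)
      moreover have "\<not> head G e \<rightarrow>\<^sup>* tail G e" using e(3,4) reachable_trans by blast
      moreover have "v \<rightarrow>\<^sup>* tail G e" using u(2) e(2) by (rule reachable_trans)
      moreover have "e \<in> out_arcs G (tail G e)" using e(1) by simp
      ultimately show False using v unfolding cyclic_step_def by blast
    qed
    moreover have "v \<in> verts G" using v by (simp add: cyclic_step_def)
    ultimately show "v \<in> level (Suc i)" by (simp add: level_def)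
  qed
qed

text \<open>Ranks fall by one along a longest chain, so the inclusions of the series are strict. The
  value \<open>0\<close> may be missing: outside \<open>reaches_sink\<close> every vertex reaches a
  cycle.\<close>

lemma rank_attained:
  assumes "v \<in> verts G - D" "j \<le> cycle_rank Z v" "0 < j"
  obtains w where "w \<in> verts G - D" "cycle_rank Z w = j"
proof -
  have "\<exists>w. w \<in> verts G - D \<and> cycle_rank Z w = j"
    using assms
  proof (induction "cycle_rank Z v" arbitrary: v rule: less_induct)
    case less
    show ?case
    proof (cases "cycle_rank Z v = j")
      case False
      then obtain k where k: "cycle_rank Z v = Suc k" "j \<le> k"
        using less.prems by (cases "cycle_rank Z v") auto
      obtain u where u: "v \<rightarrow>\<^sup>* u"
        "k \<noteq> 0 \<Longrightarrow> \<exists>u'\<in>Z. u \<rightarrow>\<^sup>* u' \<and> \<not> u' \<rightarrow>\<^sup>* u \<and> cycle_rank Z u' = k"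
        using chain_rank_step[OF k(1)] by metis
      then obtain u' where "u \<rightarrow>\<^sup>* u'" "cycle_rank Z u' = k" using k less.prems by auto
      moreover from this have vu: "v \<rightarrow>\<^sup>* u'" using u(1) reachable_trans by blast
      moreover have "u' \<in> verts G - D"
        using D_up[OF vu] less.prems(1) vu by (auto simp: reachable_in_verts)
      ultimately show ?thesis using less.hyps[of u'] k less.prems by simp
    qed (use less in blast)
  qed
  with that show thesis by blast
qed

lemma upper_cyclic_series_levels:
  assumes "talented_quotient G Q \<phi> (level 0)"
  shows "cyclic_length Q = Max (insert 0 (cycle_rank Z ` (verts G - D)))"
    and "leading_ideal Q = \<phi> ` multisets_over (verts G - D)"
proof -
  interpret q: talented_quotient G Q \<phi> "level 0" by (rule assms)
  define n where "n = Max (insert 0 (cycle_rank Z ` (verts G - D)))"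
  have le: "cycle_rank Z v \<le> n" if "v \<in> verts G - D" for v
    unfolding n_def using that by (intro Max_ge) auto
  have n_in: "n \<in> insert 0 (cycle_rank Z ` (verts G - D))" unfolding n_def by (rule Max_in) auto
  have top: "level (Suc n) = level n" "level n = verts G - D"
    using le by (force simp: level_def)+
  have strict: "level i \<subset> level (Suc i)" if i: "i < n" for i
  proof -
    obtain v where "v \<in> verts G - D" "cycle_rank Z v = n" using n_in i by auto
    then obtain w where "w \<in> verts G - D" "cycle_rank Z w = Suc i"
      using rank_attained[of v "Suc i"] i by auto
    then have "w \<in> level (Suc i) - level i" by (simp add: level_def)
    moreover have "level i \<subseteq> level (Suc i)" by (auto simp: level_def)
    ultimately show ?thesis by blast
  qed
  have ser: "upper_cyclic_series Q (map (\<lambda>i. q.ideal_over (level i)) [0..<Suc n])"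
    by (rule q.upper_cyclic_series_ideals[OF HOL.refl hereditary_saturated_level cyclic_step_level
          strict top(1)])
  show "cyclic_length Q = n"
    using q.upper_cyclic_series_length_leading(1)[OF ser] by simp
  show "leading_ideal Q = \<phi> ` multisets_over (verts G - D)"
    using q.upper_cyclic_series_length_leading(2)[OF ser] top(2) by (simp add: q.ideal_over_def)
qed

end


section \<open>The largest non-comparable ideal and the leading ideal\<close>

context disjoint_cycles_digraph
begin

sublocale talented: talented_quotient G "talented_monoid G" "\<lambda>M. talented_cong G `` {M}" "{}"
proof -
  interpret c: gamma_congruence "free_talented_monoid G" "talented_cong G"
    by (rule gamma_congruence_talented)
  note simps = free_talented_simps
  show "talented_quotient G (talented_monoid G) (\<lambda>M. talented_cong G `` {M}) {}"
  proof (intro talented_quotient.intro talented_quotient_axioms.intro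
      disjoint_cycles_digraph_axioms gamma_monoid_talented hereditary_saturated_empty)
    show "carrier (talented_monoid G) = (\<lambda>M. talented_cong G `` {M}) ` multisets_over (verts G)"
      by (simp add: talented_monoid_def c.quot_carrier simps)
    show "talented_cong G `` {{#}} = \<one>\<^bsub>talented_monoid G\<^esub>"
      by (simp add: talented_monoid_def c.quot_one simps)
    show "act (talented_monoid G) n (talented_cong G `` {M}) = talented_cong G `` {shift n M}"
      if "M \<in> multisets_over (verts G)" for M n
      using that c.quot_act[of M n] by (simp add: talented_monoid_def simps)
    show "talented_cong G `` {M + N} =
        talented_cong G `` {M} \<otimes>\<^bsub>talented_monoid G\<^esub> talented_cong G `` {N}"
      if "M \<in> multisets_over (verts G)" "N \<in> multisets_over (verts G)" for M N
      using that c.quot_mult[of M N] by (simp add: talented_monoid_def simps)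
    show "talented_cong G `` {M} = talented_cong G `` {N} \<longleftrightarrow> (M, N) \<in> cong_mod {}"
      if "M \<in> multisets_over (verts G)" "N \<in> multisets_over (verts G)" for M N
      using eq_equiv_class_iff[OF c.equiv] that by (simp add: simps cong_mod_empty)
  qed
qed

lemma all_cycle_levels: "cycle_levels G {} cyclic_verts"
  by unfold_locales auto

lemma talented_cycle_levels: "cycle_levels G reaches_sink cyclic_verts"
proof unfold_locales
  fix v w
  show "w \<in> reaches_sink \<Longrightarrow> v \<rightarrow>\<^sup>* w \<Longrightarrow> v \<in> reaches_sink"
    using reachable_trans by (auto simp: reaches_sink_def)
  assume "v \<in> reaches_sink"
  then obtain x where x: "x \<in> sinks" "v \<rightarrow>\<^sup>* x" by (auto simp: reaches_sink_def)
  then have "x \<in> reaches_sink" by (auto simp: reaches_sink_def intro!: bexI[of _ x] reachable_in_verts)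
  with x show "\<exists>w\<in>sinks \<inter> reaches_sink. v \<rightarrow>\<^sup>* w" by blast
qed auto

lemma sink_cycle_levels: "cycle_levels G {} (cyclic_verts \<inter> reaches_sink)"
  using reachable_trans by unfold_locales (auto simp: reaches_sink_def)

lemma level_acyclic: "cycle_levels.level G {} cyclic_verts 0 = acyclic_part"
proof -
  interpret cycle_levels G "{}" cyclic_verts by (rule all_cycle_levels)
  show ?thesis by (auto simp: level_def acyclic_part_def chain_rank_eq_0_iff)
qed

lemma level_talented: "cycle_levels.level G reaches_sink cyclic_verts 0 = {}"
proof -
  interpret cycle_levels G reaches_sink cyclic_verts by (rule talented_cycle_levels)
  have False if "v \<in> verts G" "v \<notin> reaches_sink" "\<And>u. u \<in> cyclic_verts \<Longrightarrow> \<not> v \<rightarrow>\<^sup>* u" for v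
    using reaches_sink_or_cycle[OF that(1)] that(2,3) by (auto simp: reaches_sink_def)
  then show ?thesis by (auto simp: level_def chain_rank_eq_0_iff)
qed

lemma hereditary_saturated_acyclic_part: "hereditary_saturated acyclic_part"
  using cycle_levels.hereditary_saturated_level[OF all_cycle_levels, of 0] level_acyclic by simp

text \<open>Unfold along the edges of the walk only and collect the by-products in \<open>N\<close>.
  On a cycle this makes a generator comparable with a shift of itself.\<close>

lemma \<phi>_ge_reachable:
  assumes "awalk u p w"
  shows "\<exists>N\<in>multisets_over (verts G).
    talented_cong G `` {{#(u, i)#}} = talented_cong G `` {add_mset (w, i + int (length p)) N}"
  using assms
proof (induction p arbitrary: u i)
  case Nil
  then show ?case by (auto simp: awalk_simps intro!: bexI[of _ "{#}"])
next
  case (Cons e p)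
  then have e: "e \<in> arcs G" "tail G e = u" "awalk (head G e) p w" by (auto simp: awalk_simps)
  define R where "R = image_mset (\<lambda>e. (head G e, i + 1)) (mset_set (out_arcs G u - {e}))"
  have R: "R \<in> multisets_over (verts G)" by (auto simp: R_def multisets_over_def)
  obtain N where N: "N \<in> multisets_over (verts G)" "talented_cong G `` {{#(head G e, i + 1)#}} =
      talented_cong G `` {add_mset (w, i + 1 + int (length p)) N}"
    using Cons.IH[OF e(3)] by blast
  have w: "w \<in> verts G" using Cons.prems by blast
  have "talented_cong G `` {{#(u, i)#}} = talented_cong G `` {successors u i}"
    by (rule talented.\<phi>_unfold) (use e in auto)
  also have "successors u i = {#(head G e, i + 1)#} + R"
    unfolding R_def by (rule talented.successors_remove) (use e in auto)
  also have "talented_cong G `` {{#(head G e, i + 1)#} + R} =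
      talented_cong G `` {add_mset (w, i + 1 + int (length p)) N + R}"
    using N R w e by (subst (1 2) talented.\<phi>_add) auto
  finally show ?case using N R
    by (intro bexI[of _ "N + R"]) (simp_all add: algebra_simps)
qed

text \<open>Some sink is reached from a non-zero element, and since no cycle is, the arrivals there
  occupy finitely many times. Comparability with a proper shift contradicts
  \<open>finite_support_not_superperiodic\<close>.\<close>

lemma noncomparable_acyclic_part:
  "noncomparable_ideal (talented_monoid G) (talented.ideal_over acyclic_part)"
  unfolding noncomparable_ideal_def
proof (intro conjI ballI impI allI)
  let ?T = "talented_monoid G" and ?cl = "\<lambda>M. talented_cong G `` {M}"
  show "order_ideal ?T (talented.ideal_over acyclic_part)"
    by (rule talented.order_ideal_over[OF hereditary_saturated_acyclic_part]) simp
  fix x and g :: int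
  assume "x \<in> talented.ideal_over acyclic_part" "x \<noteq> \<one>\<^bsub>?T\<^esub>" and g: "g \<noteq> 0"
  then obtain M where M: "M \<in> multisets_over acyclic_part" "x = ?cl M" "M \<noteq> {#}"
    using talented.\<phi>_empty by (auto simp: talented.ideal_over_def)
  have MV: "M \<in> multisets_over (verts G)"
    by (rule talented.over_verts[OF hereditary_saturated_acyclic_part M(1)])
  obtain w k where wk: "w \<in> sinks" "0 < level_count {w} k M"
    using level_count_acyclic_pos[OF M(1,3)] by blast
  have le: "level_count {w} j A \<le> level_count {w} j B"
    if "alg_le ?T (?cl A) (?cl B)" "A \<in> multisets_over (verts G)" "B \<in> multisets_over (verts G)" for A B j
  proof -
    have "\<exists>c\<in>carrier ?T. ?cl B = ?cl A \<otimes>\<^bsub>?T\<^esub> c" using that(1) unfolding alg_le_def .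
    then obtain c where c: "c \<in> carrier ?T" "?cl B = ?cl A \<otimes>\<^bsub>?T\<^esub> c" by (rule bexE)
    from c(1) obtain C where C: "c = ?cl C" "C \<in> multisets_over (verts G)"
      unfolding talented.carrier_Q by (rule imageE)
    note C = C(2) c(2)[unfolded C(1)]
    then have "?cl B = ?cl (A + C)" using talented.\<phi>_add that by simp
    then have "(B, A + C) \<in> talented_cong G"
      using talented.\<phi>_eq_iff[of B "A + C"] that C by (simp add: cong_mod_empty)
    from level_count_sink_cong[OF this wk(1), of j] show ?thesis by simp
  qed
  note fin = level_count_finite[OF M(1), of "{w}"]
  have act: "act ?T g x = ?cl (shift g M)" using talented.\<phi>_act[OF MV] M by simp
  show "\<not> alg_le ?T (act ?T g x) x"
  proof
    assume "alg_le ?T (act ?T g x) x"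
    then have "level_count {w} (j - g) M \<le> level_count {w} j M" for j
      using le[of "shift g M" M j] MV unfolding act unfolding M(2) by simp
    then show False by (rule finite_support_not_superperiodic[OF fin g _ wk(2)])
  qed
  show "\<not> alg_le ?T x (act ?T g x)"
  proof
    assume a: "alg_le ?T x (act ?T g x)"
    have sup: "level_count {w} (j - - g) M \<le> level_count {w} j M" for j
      using le[of M "shift g M" "j + g"] a MV unfolding act unfolding M(2) by simp
    have "- g \<noteq> 0" using g by simp
    then show False by (rule finite_support_not_superperiodic[OF fin _ sup wk(2)])
  qed
qed

text \<open>An ideal over a vertex that reaches a cycle contains a generator on the cycle, which
  lies above its own shift by the length of the cycle.\<close>

lemma largest_noncomparable_talented:
  "largest_noncomparable_ideal (talented_monoid G) = talented.ideal_over acyclic_part"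
  unfolding largest_noncomparable_ideal_def
proof (rule Greatest_equality)
  show "noncomparable_ideal (talented_monoid G) (talented.ideal_over acyclic_part)"
    by (rule noncomparable_acyclic_part)
next
  let ?T = "talented_monoid G" and ?cl = "\<lambda>M. talented_cong G `` {M}"
  fix I assume I: "noncomparable_ideal ?T I"
  then obtain H where H: "hereditary_saturated H" "I = talented.ideal_over H"
    using talented.ideal_is_ideal_over unfolding noncomparable_ideal_def by metis
  have "v \<in> acyclic_part" if v: "v \<in> H" for v
  proof (rule ccontr)
    assume "v \<notin> acyclic_part"
    then obtain u where u: "u \<in> cyclic_verts" "v \<rightarrow>\<^sup>* u"
      using v hereditary_saturatedD(1)[OF H(1)] by (auto simp: acyclic_part_def)
    then have uH: "u \<in> H" "u \<in> verts G"
      using hereditary_reachable[OF H(1) u(2) v] hereditary_saturatedD(1)[OF H(1)] by auto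
    obtain p where p: "awalk u p u" "p \<noteq> []" using u(1) by (auto simp: cyclic_verts_def reachable1_awalk)
    obtain N where N: "N \<in> multisets_over (verts G)"
      "?cl {#(u, 0)#} = ?cl (add_mset (u, int (length p)) N)"
      using \<phi>_ge_reachable[OF p(1), of 0] by auto
    have act: "act ?T (int (length p)) (?cl {#(u, 0)#}) = ?cl {#(u, int (length p))#}"
      using talented.\<phi>_act[of "{#(u, 0)#}"] uH by simp
    have "?cl {#(u, 0)#} = act ?T (int (length p)) (?cl {#(u, 0)#}) \<otimes>\<^bsub>?T\<^esub> ?cl N"
      unfolding act using N talented.\<phi>_add[of "{#(u, int (length p))#}" N] uH by simp
    then have "alg_le ?T (act ?T (int (length p)) (?cl {#(u, 0)#})) (?cl {#(u, 0)#})"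
      unfolding alg_le_def using talented.\<phi>_carrier[OF N(1)] by blast
    moreover have "?cl {#(u, 0)#} \<in> I"
      unfolding H(2) talented.ideal_over_def using uH by (intro imageI) simp
    moreover have "?cl {#(u, 0)#} \<noteq> \<one>\<^bsub>?T\<^esub>"
      using talented.in_ideal_over_iff[of "{}" "{#(u, 0)#}"] talented.ideal_over_H uH
        hereditary_saturated_empty by simp
    moreover have "int (length p) \<noteq> 0" using p(2) by simp
    ultimately show False using I unfolding noncomparable_ideal_def by blast
  qed
  then show "I \<le> talented.ideal_over acyclic_part"
    unfolding H(2) by (intro talented.ideal_over_mono) blast
qed

lemma leading_talented:
  "leading_ideal (talented_monoid G) = talented.ideal_over (verts G - reaches_sink)"
  using cycle_levels.upper_cyclic_series_levels(2)[OF talented_cycle_levels]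
    talented.talented_quotient_axioms level_talented by (simp add: talented.ideal_over_def)

text \<open>The union of the two vertex sets need not be saturated. A vertex of
  \<open>level 0\<close> in neither set is no sink and lies on no cycle, so it can be unfolded until
  each summand falls into one of them.\<close>

lemma sum_of_ideals:
  "talented.ideal_over acyclic_part <#>\<^bsub>talented_monoid G\<^esub> talented.ideal_over (verts G - reaches_sink)
    = talented.ideal_over (cycle_levels.level G {} (cyclic_verts \<inter> reaches_sink) 0)"
proof -
  let ?T = "talented_monoid G" and ?cl = "\<lambda>M. talented_cong G `` {M}"
  let ?S = acyclic_part and ?I = "verts G - reaches_sink"
  interpret cycle_levels G "{}" "cyclic_verts \<inter> reaches_sink" by (rule sink_cycle_levels)
  have lev: "level 0 = {v \<in> verts G. \<forall>u\<in>cyclic_verts \<inter> reaches_sink. \<not> v \<rightarrow>\<^sup>* u}"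
    by (auto simp: level_def chain_rank_eq_0_iff)
  have sub: "?S \<subseteq> level 0" "?I \<subseteq> level 0"
    using cycle_levels.D_up[OF talented_cycle_levels] by (auto simp: lev acyclic_part_def)
  have SV: "?S \<subseteq> verts G" by (auto simp: acyclic_part_def)
  let ?sum = "\<lambda>M. \<exists>A\<in>multisets_over ?S. \<exists>B\<in>multisets_over ?I. ?cl M = ?cl (A + B)"
  have sumI: "?sum M" if "M \<in> multisets_over (verts G)" "\<And>v i. (v, i) \<in># M \<Longrightarrow> ?sum {#(v, i)#}" for M
    using that
  proof (induction M)
    case empty
    show ?case by (intro bexI[of _ "{#}"]) simp_all
  next
    case (add x M)
    obtain v i where x: "x = (v, i)" by force
    have "?sum {#x#}" using add.prems(2)[of v i] x by simp
    then obtain A B where AB: "A \<in> multisets_over ?S" "B \<in> multisets_over ?I" "?cl {#x#} = ?cl (A + B)"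
      by blast
    have "?sum M" using add x by simp
    then obtain C D where CD: "C \<in> multisets_over ?S" "D \<in> multisets_over ?I" "?cl M = ?cl (C + D)"
      by blast
    have over: "A + B \<in> multisets_over (verts G)" "C + D \<in> multisets_over (verts G)"
      using AB CD multisets_over_mono[OF _ SV] multisets_over_mono[of _ ?I "verts G"] by auto
    have "?cl ({#x#} + M) = ?cl {#x#} \<otimes>\<^bsub>?T\<^esub> ?cl M"
      using add.prems x by (intro talented.\<phi>_add) auto
    also have "\<dots> = ?cl ((A + B) + (C + D))"
      unfolding AB(3) CD(3) by (rule talented.\<phi>_add[OF over, symmetric])
    also have "(A + B) + (C + D) = (A + C) + (B + D)" by simp
    finally have "?cl (add_mset x M) = ?cl ((A + C) + (B + D))" by simp
    moreover have "A + C \<in> multisets_over ?S" "B + D \<in> multisets_over ?I" using AB CD by auto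
    ultimately show ?case by blast
  qed
  have single: "?sum {#(v, i)#}" if "v \<in> verts G" "v \<in> level 0" for v i
    using that
  proof (induction arbitrary: i rule: reachable_less_induct)
    case (less v)
    consider "v \<in> ?S" | "v \<in> ?I" | "v \<notin> ?S" "v \<in> reaches_sink" using less.hyps by blast
    then show ?case
    proof cases
      case 1
      then show ?thesis by (intro bexI[of _ "{#(v, i)#}"] bexI[of _ "{#}"]) auto
    next
      case 2
      then show ?thesis by (intro bexI[of _ "{#(v, i)#}"] bexI[of _ "{#}"]) auto
    next
      case 3
      have vc: "v \<notin> cyclic_verts" using less.prems less.hyps 3(2) by (auto simp: lev)
      have "v \<notin> sinks"
      proof
        assume "v \<in> sinks"
        then have "v \<in> ?S"
          unfolding acyclic_part_def using less.hyps sink_reachable sink_not_cyclic by blast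
        with 3 show False by blast
      qed
      then have out: "out_arcs G v \<noteq> {}" using less.hyps by (simp add: sinks_def)
      have "?sum (successors v i)"
      proof (rule sumI)
        fix w j assume "(w, j) \<in># successors v i"
        then obtain e where e: "e \<in> arcs G" "tail G e = v" "head G e = w"
          by (auto simp: successors_def)
        then have "v \<rightarrow>\<^sup>* w" "\<not> w \<rightarrow>\<^sup>* v" using arc_reachable cyclic_if_arc_back vc by auto
        then show "?sum {#(w, j)#}" using less.IH level_reachable[OF less.prems] by blast
      qed (auto simp: successors_over)
      then show ?thesis using talented.\<phi>_unfold[OF less.hyps out] by simp
    qed
  qed
  show ?thesis
  proof
    show "talented.ideal_over ?S <#>\<^bsub>?T\<^esub> talented.ideal_over ?I \<subseteq> talented.ideal_over (level 0)"
    proof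
      fix x assume "x \<in> talented.ideal_over ?S <#>\<^bsub>?T\<^esub> talented.ideal_over ?I"
      then obtain A B where AB: "A \<in> multisets_over ?S" "B \<in> multisets_over ?I" "x = ?cl A \<otimes>\<^bsub>?T\<^esub> ?cl B"
        by (auto simp: set_mult_def talented.ideal_over_def)
      then have "x = ?cl (A + B)"
        using talented.\<phi>_add multisets_over_mono[OF _ SV] multisets_over_mono[of _ ?I "verts G"] by auto
      moreover have "A + B \<in> multisets_over (level 0)"
        using AB multisets_over_mono sub by auto
      ultimately show "x \<in> talented.ideal_over (level 0)" by (auto simp: talented.ideal_over_def)
    qed
    show "talented.ideal_over (level 0) \<subseteq> talented.ideal_over ?S <#>\<^bsub>?T\<^esub> talented.ideal_over ?I"
    proof
      fix x assume "x \<in> talented.ideal_over (level 0)"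
      then obtain M where M: "M \<in> multisets_over (level 0)" "x = ?cl M"
        by (auto simp: talented.ideal_over_def)
      have MV: "M \<in> multisets_over (verts G)"
        by (rule talented.over_verts[OF hereditary_saturated_level M(1)])
      have "?sum M"
      proof (rule sumI[OF MV])
        fix v i assume "(v, i) \<in># M"
        then have "v \<in> level 0" using M(1) by (auto simp: multisets_over_def)
        then show "?sum {#(v, i)#}" using single by (auto simp: level_def)
      qed
      then obtain A B where AB: "A \<in> multisets_over ?S" "B \<in> multisets_over ?I" "x = ?cl (A + B)"
        using M(2) by blast
      then have "x = ?cl A \<otimes>\<^bsub>?T\<^esub> ?cl B"
        using talented.\<phi>_add multisets_over_mono[OF _ SV] multisets_over_mono[of _ ?I "verts G"] by auto
      then show "x \<in> talented.ideal_over ?S <#>\<^bsub>?T\<^esub> talented.ideal_over ?I"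
        unfolding set_mult_def using AB by (auto simp: talented.ideal_over_def)
    qed
  qed
qed

theorem cyclic_length_quotients:
  defines "T \<equiv> talented_monoid G"
  defines "S \<equiv> largest_noncomparable_ideal T"
  shows "cyclic_length (quot_ideal T S) = max_chain cyclic_verts"
    and "cyclic_length (quot_ideal T (S <#>\<^bsub>T\<^esub> leading_ideal T)) = max_chain (cyclic_verts \<inter> reaches_sink)"
proof -
  have quot: "talented_quotient G (quot_ideal T (talented.ideal_over H))
      (\<lambda>M. ideal_rel T (talented.ideal_over H) `` {talented_cong G `` {M}}) H"
    if "hereditary_saturated H" for H
    unfolding T_def by (rule talented.talented_quotient_quot[OF that]) simp
  have *: "cyclic_length (quot_ideal T (talented.ideal_over (cycle_levels.level G {} Z 0))) = max_chain Z"
    if "cycle_levels G {} Z" for Z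
    using cycle_levels.upper_cyclic_series_levels(1)[OF that
        quot[OF cycle_levels.hereditary_saturated_level[OF that]]]
    unfolding max_chain_def by simp
  show "cyclic_length (quot_ideal T S) = max_chain cyclic_verts"
    using *[OF all_cycle_levels] unfolding S_def T_def largest_noncomparable_talented level_acyclic .
  show "cyclic_length (quot_ideal T (S <#>\<^bsub>T\<^esub> leading_ideal T)) = max_chain (cyclic_verts \<inter> reaches_sink)"
    using *[OF sink_cycle_levels]
    unfolding S_def T_def largest_noncomparable_talented leading_talented sum_of_ideals .
qed

end

section \<open>Dimension estimates in vector spaces\<close>

context Module.module
begin

lemma span_closed:
  assumes "S \<subseteq> carrier M"
  shows zero_in_span: "\<zero>\<^bsub>M\<^esub> \<in> span S"
    and add_in_span: "x \<in> span S \<Longrightarrow> y \<in> span S \<Longrightarrow> x \<oplus>\<^bsub>M\<^esub> y \<in> span S"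
    and smult_in_span: "c \<in> carrier R \<Longrightarrow> x \<in> span S \<Longrightarrow> c \<odot>\<^bsub>M\<^esub> x \<in> span S"
  using span_is_submodule[OF assms] unfolding submodule_def by auto

lemma span_minimal:
  assumes "S \<subseteq> span T" "T \<subseteq> carrier M"
  shows "span S \<subseteq> span T"
  by (rule span_is_subset[OF assms(1) span_is_submodule[OF assms(2)]])

lemma span_induct' [consumes 2, case_names zero add mem]:
  assumes "x \<in> span S" "S \<subseteq> carrier M"
    and "P \<zero>\<^bsub>M\<^esub>"
    and "\<And>x y. x \<in> carrier M \<Longrightarrow> y \<in> carrier M \<Longrightarrow> P x \<Longrightarrow> P y \<Longrightarrow> P (x \<oplus>\<^bsub>M\<^esub> y)"
    and "\<And>c x. c \<in> carrier R \<Longrightarrow> x \<in> S \<Longrightarrow> P (c \<odot>\<^bsub>M\<^esub> x)"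
  shows "P x"
proof -
  obtain a A where A: "finite A" "A \<subseteq> S" "a \<in> A \<rightarrow> carrier R" "x = lincomb a A"
    using assms(1) unfolding span_def by blast
  have "P (lincomb a A)" using A(1-3)
  proof (induction A)
    case empty
    then show ?case using assms(3) by (simp add: lincomb_def)
  next
    case (insert s A)
    have s: "s \<in> carrier M" "A \<subseteq> carrier M" "a s \<in> carrier R" "a \<in> A \<rightarrow> carrier R"
      using insert.prems assms(2) by auto
    have "lincomb a (insert s A) = (a s \<odot>\<^bsub>M\<^esub> s) \<oplus>\<^bsub>M\<^esub> lincomb a A"
      unfolding lincomb_def using insert s by (subst finsum_insert) auto
    moreover have "P (lincomb a A)" using insert s by auto
    ultimately show ?case
      using assms(4)[of "a s \<odot>\<^bsub>M\<^esub> s" "lincomb a A"] assms(5)[of "a s" s] insert.prems s by auto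
  qed
  then show ?thesis using A(4) by simp
qed

end

context vectorspace
begin

text \<open>The ambient space may be infinite-dimensional. Exchange bounds the independent subsets
  of \<open>W\<close> by \<open>card B\<close>, so a maximal one exists, and it is a basis.\<close>

lemma subspace_of_span_dim:
  assumes W: "subspace K W V" and B: "finite B" "B \<subseteq> carrier V" "W \<subseteq> span B"
  shows "vectorspace.fin_dim K (V\<lparr>carrier := W\<rparr>)"
    and "vectorspace.dim K (V\<lparr>carrier := W\<rparr>) \<le> card B"
proof -
  interpret W: vectorspace K "V\<lparr>carrier := W\<rparr>" by (rule subspace_is_vs[OF W])
  have sub: "submodule K W V" using W by simp
  have small: "card A \<le> card B" if "finite A" "A \<subseteq> W" "W.lin_indpt A" for A
  proof -
    have "lin_indpt A" using span_li_not_depend(2)[OF that(2) sub] that(3) by simp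
    moreover have "A \<subseteq> span B" using that(2) B(3) by blast
    ultimately show ?thesis using replacement[OF that(1) B(1,2)] by fastforce
  qed
  have fin: "finite A \<and> card A \<le> card B" if A: "A \<subseteq> W \<and> W.lin_indpt A" for A
  proof -
    have "finite A"
    proof (rule ccontr)
      assume "infinite A"
      then obtain C where C: "C \<subseteq> A" "finite C" "card C = Suc (card B)"
        using infinite_arbitrarily_large by blast
      then have "W.lin_indpt C" using A W.subset_li_is_li by blast
      with small[of C] C A show False by auto
    qed
    with small A show ?thesis by blast
  qed
  have "{} \<subseteq> W \<and> W.lin_indpt {}" by (auto simp: W.lin_dep_def)
  then obtain A where A: "finite A" "maximal A (\<lambda>S. S \<subseteq> W \<and> W.lin_indpt S)"
    using maximal_exists[of "\<lambda>S. S \<subseteq> W \<and> W.lin_indpt S" "card B" "{}"] fin by blast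
  then have basis: "W.basis A" using W.max_li_is_basis by simp
  then show "W.fin_dim" using A(1) unfolding W.fin_dim_def W.basis_def by blast
  have "card A \<le> card B" using fin A(2) unfolding maximal_def by blast
  then show "W.dim \<le> card B" using W.dim_basis[OF A(1) basis] by simp
qed

end

text \<open>Applying \<open>\<psi> t\<close> to a vanishing combination isolates the coefficient of
  \<open>b t\<close>, so the family is independent.\<close>

lemma dual_family_card_le_dim:
  assumes "vectorspace (class_ring :: 'k::field ring) V"
    and W: "VectorSpace.subspace (class_ring :: 'k ring) W V"
    and fin: "vectorspace.fin_dim (class_ring :: 'k ring) (V\<lparr>carrier := W\<rparr>)"
    and b: "\<And>t. t \<in> T \<Longrightarrow> b t \<in> W"
    and add: "\<And>t x y. t \<in> T \<Longrightarrow> x \<in> carrier V \<Longrightarrow> y \<in> carrier V \<Longrightarrow> \<psi> t (x \<oplus>\<^bsub>V\<^esub> y) = \<psi> t x + \<psi> t y"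
    and smult: "\<And>t c x. t \<in> T \<Longrightarrow> x \<in> carrier V \<Longrightarrow> \<psi> t (c \<odot>\<^bsub>V\<^esub> x) = c * (\<psi> t x :: 'k)"
    and dual: "\<And>s t. s \<in> T \<Longrightarrow> t \<in> T \<Longrightarrow> \<psi> t (b s) = (if s = t then 1 else 0)"
    and T: "finite T"
  shows "card T \<le> vectorspace.dim (class_ring :: 'k ring) (V\<lparr>carrier := W\<rparr>)"
proof -
  interpret V: vectorspace "class_ring :: 'k ring" V by fact
  interpret W: vectorspace "class_ring :: 'k ring" "V\<lparr>carrier := W\<rparr>" by (rule V.subspace_is_vs[OF W])
  have sub: "LinearCombinations.submodule class_ring W V" using W by simp
  have WV: "W \<subseteq> carrier V" using sub by (simp add: LinearCombinations.submodule_def)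
  have bV: "b ` T \<subseteq> carrier V" using b WV by blast
  have inj: "inj_on b T"
  proof (rule inj_onI)
    fix s t assume "s \<in> T" "t \<in> T" "b s = b t"
    then have "(if s = t then 1 else 0) = (1 :: 'k)" using dual[of s t] dual[of t t] by simp
    then show "s = t" by (simp split: if_splits)
  qed
  have lin: "\<psi> t (V.lincomb a A) = (\<Sum>v\<in>A. a v * \<psi> t v)"
    if "t \<in> T" "finite A" "A \<subseteq> carrier V" for t a A
    using that(2,3)
  proof (induction A)
    case empty
    have "\<psi> t (0 \<odot>\<^bsub>V\<^esub> \<zero>\<^bsub>V\<^esub>) = 0 * \<psi> t \<zero>\<^bsub>V\<^esub>" by (rule smult[OF that(1)]) simp
    then show ?case by (simp add: V.lincomb_def)
  next
    case (insert v A)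
    have "V.lincomb a (insert v A) = (a v \<odot>\<^bsub>V\<^esub> v) \<oplus>\<^bsub>V\<^esub> V.lincomb a A"
      unfolding V.lincomb_def using insert by (subst V.finsum_insert) auto
    then show ?case using insert add[OF that(1)] smult[OF that(1)] by simp
  qed
  have "V.lin_indpt (b ` T)"
  proof (rule V.finite_lin_indpt2)
    fix a :: "_ \<Rightarrow> 'k"
    assume 0: "V.lincomb a (b ` T) = \<zero>\<^bsub>V\<^esub>"
    have "a (b t) = 0" if t: "t \<in> T" for t
    proof -
      have "\<psi> t (V.lincomb a {}) = 0" using lin[OF t, of "{}"] by simp
      then have "\<psi> t \<zero>\<^bsub>V\<^esub> = 0" by (simp add: V.lincomb_def)
      then have "0 = (\<Sum>v\<in>b ` T. a v * \<psi> t v)" using lin[OF t _ bV, of a] T 0 by simp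
      also have "\<dots> = (\<Sum>s\<in>T. a (b s) * \<psi> t (b s))" by (simp add: sum.reindex[OF inj])
      also have "\<dots> = (\<Sum>s\<in>T. if s = t then a (b t) else 0)"
        by (intro sum.cong) (simp_all add: dual t)
      also have "\<dots> = a (b t)" using T t by simp
      finally show ?thesis by simp
    qed
    then show "\<forall>v\<in>b ` T. a v = \<zero>\<^bsub>class_ring\<^esub>" by simp
  qed (use T bV in auto)
  then have "W.lin_indpt (b ` T)" using V.span_li_not_depend(2)[OF _ sub, of "b ` T"] b by auto
  then have "card (b ` T) \<le> W.dim" using W.li_le_dim(2)[OF fin, of "b ` T"] b by auto
  then show ?thesis by (simp add: card_image[OF inj])
qed


section \<open>Words in a Leavitt path algebra\<close>

locale leavitt = fin_digraph G for G :: "('a, 'b) pre_digraph" (structure) +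
  fixes field_type :: "'k::field itself"
begin

abbreviation F :: "('a, 'b, 'k) free_lpa ring" where "F \<equiv> free_lpa G"
abbreviation J :: "('a, 'b, 'k) free_lpa set" where "J \<equiv> lpa_ideal G"
abbreviation L :: "('k, ('a, 'b, 'k) free_lpa set) module" where "L \<equiv> leavitt_path_algebra G"
abbreviation K :: "'k ring" where "K \<equiv> class_ring"

sublocale F: ring F by (rule ring_free_lpa)
sublocale J: ideal J F by (rule ideal_lpa_ideal)
sublocale L: vectorspace K L by (rule vectorspace_leavitt_path_algebra)

definition cl :: "('a, 'b, 'k) free_lpa \<Rightarrow> ('a, 'b, 'k) free_lpa set" where
  "cl p = J +>\<^bsub>F\<^esub> p"

lemma F_simps: "mult F = (*)" "add F = (+)" "zero F = 0" "one F = 1"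
  by (simp_all add: free_lpa_def)

lemma F_closed:
  "p \<in> carrier F \<Longrightarrow> q \<in> carrier F \<Longrightarrow> p * q \<in> carrier F"
  "p \<in> carrier F \<Longrightarrow> q \<in> carrier F \<Longrightarrow> p + q \<in> carrier F"
  "p \<in> carrier F \<Longrightarrow> q \<in> carrier F \<Longrightarrow> p - q \<in> carrier F"
  "0 \<in> carrier F"
  "Poly_Mapping.single 0 c \<in> carrier F"
proof -
  have add: "p + q \<in> carrier F" if "p \<in> carrier F" "q \<in> carrier F" for p q
    using F.a_closed[OF that] by (simp only: F_simps)
  then show "p \<in> carrier F \<Longrightarrow> q \<in> carrier F \<Longrightarrow> p + q \<in> carrier F" .
  show "p * q \<in> carrier F" if "p \<in> carrier F" "q \<in> carrier F"
    using F.m_closed[OF that] by (simp only: F_simps)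
  show "p - q \<in> carrier F" if "p \<in> carrier F" "q \<in> carrier F"
  proof -
    have "- q \<in> carrier F" using that(2) by (simp add: free_lpa_def)
    with that(1) have "p + - q \<in> carrier F" by (rule add)
    then show ?thesis by simp
  qed
qed (auto simp: free_lpa_def zero_free_word_def)

lemma cl_eq_iff:
  assumes "p \<in> carrier F" "q \<in> carrier F"
  shows "cl p = cl q \<longleftrightarrow> p - q \<in> J"
proof
  assume "cl p = cl q"
  then have "p \<in> J +>\<^bsub>F\<^esub> q" using J.a_rcos_self[OF assms(1)] by (simp add: cl_def)
  then obtain j where "j \<in> J" "p = j + q" by (auto simp: a_r_coset_def' F_simps)
  then show "p - q \<in> J" by simp
next
  assume "p - q \<in> J"
  then have "p \<in> J +>\<^bsub>F\<^esub> q"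
    by (auto simp: a_r_coset_def' F_simps intro!: bexI[of _ "p - q"])
  then show "cl p = cl q" using J.a_repr_independence'[OF _ assms(2)] by (simp add: cl_def)
qed

lemma L_carrier: "carrier L = cl ` {p \<in> carrier F. Poly_Mapping.lookup p 0 = 0}"
  by (auto simp: leavitt_path_algebra_def Let_def cl_def)

lemma L_zero: "\<zero>\<^bsub>L\<^esub> = cl 0"
  using J.a_rcos_const[OF J.zero_closed]
  by (simp add: leavitt_path_algebra_def Let_def cl_def FactRing_def F_simps)

lemma L_add: "p \<in> carrier F \<Longrightarrow> q \<in> carrier F \<Longrightarrow> cl p \<oplus>\<^bsub>L\<^esub> cl q = cl (p + q)"
  using J.a_rcos_sum[of p q]
  by (simp add: leavitt_path_algebra_def Let_def cl_def FactRing_def F_simps)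

lemma L_mult: "p \<in> carrier F \<Longrightarrow> q \<in> carrier F \<Longrightarrow> cl p \<otimes>\<^bsub>L\<^esub> cl q = cl (p * q)"
  using J.rcoset_mult_add[of p q]
  by (simp add: leavitt_path_algebra_def Let_def cl_def FactRing_def F_simps)

lemma L_smult: "p \<in> carrier F \<Longrightarrow> c \<odot>\<^bsub>L\<^esub> cl p = cl (Poly_Mapping.single 0 c * p)"
  using J.rcoset_mult_add[OF F_closed(5)[of c], of p]
  by (simp add: leavitt_path_algebra_def Let_def cl_def FactRing_def F_simps)

lemma single_0_commute:
  "Poly_Mapping.single 0 c * p = p * Poly_Mapping.single 0 (c :: 'k)" for p :: "('a, 'b, 'k) free_lpa"
proof (induction p rule: Poly_Mapping.update_induct)
  case (update f a b)
  have "Poly_Mapping.update a b f = f + Poly_Mapping.single a b"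
    using update(1) by (intro poly_mapping_eqI) (auto simp: lookup_update lookup_add lookup_single in_keys_iff when_def)
  with update show ?case by (simp add: algebra_simps mult_single)
qed simp

lemma L_elem:
  assumes "x \<in> carrier L"
  obtains p where "p \<in> carrier F" "x = cl p"
  using assms unfolding L_carrier by blast

lemma L_mult_closed: "x \<in> carrier L \<Longrightarrow> y \<in> carrier L \<Longrightarrow> x \<otimes>\<^bsub>L\<^esub> y \<in> carrier L"
proof -
  assume "x \<in> carrier L" "y \<in> carrier L"
  then obtain p q where pq: "p \<in> carrier F" "Poly_Mapping.lookup p 0 = 0" "x = cl p"
    "q \<in> carrier F" "Poly_Mapping.lookup q 0 = 0" "y = cl q"
    unfolding L_carrier by blast
  have "0 \<notin> Poly_Mapping.keys (p * q)"
  proof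
    assume "0 \<in> Poly_Mapping.keys (p * q)"
    then obtain a b where ab: "0 = a + b" "a \<in> Poly_Mapping.keys p" using keys_mult[of p q] by blast
    then have "a = 0" by (auto simp: zero_free_word_def plus_free_word_def intro: free_word.expand)
    with ab(2) pq(2) show False by (simp add: in_keys_iff)
  qed
  then show "x \<otimes>\<^bsub>L\<^esub> y \<in> carrier L"
    unfolding L_carrier using pq by (auto simp: L_mult F_closed in_keys_iff)
qed

lemma L_bilinear:
  assumes "x \<in> carrier L" "y \<in> carrier L" "z \<in> carrier L"
  shows "(x \<oplus>\<^bsub>L\<^esub> y) \<otimes>\<^bsub>L\<^esub> z = x \<otimes>\<^bsub>L\<^esub> z \<oplus>\<^bsub>L\<^esub> y \<otimes>\<^bsub>L\<^esub> z"
    and "z \<otimes>\<^bsub>L\<^esub> (x \<oplus>\<^bsub>L\<^esub> y) = z \<otimes>\<^bsub>L\<^esub> x \<oplus>\<^bsub>L\<^esub> z \<otimes>\<^bsub>L\<^esub> y"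
    and "(c \<odot>\<^bsub>L\<^esub> x) \<otimes>\<^bsub>L\<^esub> z = c \<odot>\<^bsub>L\<^esub> (x \<otimes>\<^bsub>L\<^esub> z)"
    and "z \<otimes>\<^bsub>L\<^esub> (c \<odot>\<^bsub>L\<^esub> x) = c \<odot>\<^bsub>L\<^esub> (z \<otimes>\<^bsub>L\<^esub> x)"
    and "\<zero>\<^bsub>L\<^esub> \<otimes>\<^bsub>L\<^esub> z = \<zero>\<^bsub>L\<^esub>" "z \<otimes>\<^bsub>L\<^esub> \<zero>\<^bsub>L\<^esub> = \<zero>\<^bsub>L\<^esub>"
proof -
  obtain p q r where pqr: "p \<in> carrier F" "x = cl p" "q \<in> carrier F" "y = cl q" "r \<in> carrier F" "z = cl r"
    using assms L_elem by metis
  note simps = pqr L_add L_mult L_smult L_zero F_closed distrib_left distrib_right mult.assoc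
  show "(x \<oplus>\<^bsub>L\<^esub> y) \<otimes>\<^bsub>L\<^esub> z = x \<otimes>\<^bsub>L\<^esub> z \<oplus>\<^bsub>L\<^esub> y \<otimes>\<^bsub>L\<^esub> z"
    "z \<otimes>\<^bsub>L\<^esub> (x \<oplus>\<^bsub>L\<^esub> y) = z \<otimes>\<^bsub>L\<^esub> x \<oplus>\<^bsub>L\<^esub> z \<otimes>\<^bsub>L\<^esub> y"
    "(c \<odot>\<^bsub>L\<^esub> x) \<otimes>\<^bsub>L\<^esub> z = c \<odot>\<^bsub>L\<^esub> (x \<otimes>\<^bsub>L\<^esub> z)"
    "\<zero>\<^bsub>L\<^esub> \<otimes>\<^bsub>L\<^esub> z = \<zero>\<^bsub>L\<^esub>" "z \<otimes>\<^bsub>L\<^esub> \<zero>\<^bsub>L\<^esub> = \<zero>\<^bsub>L\<^esub>"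
    by (simp_all add: simps)
  have "r * (Poly_Mapping.single 0 c * p) = Poly_Mapping.single 0 c * (r * p)"
    by (metis mult.assoc single_0_commute)
  then show "z \<otimes>\<^bsub>L\<^esub> (c \<odot>\<^bsub>L\<^esub> x) = c \<odot>\<^bsub>L\<^esub> (z \<otimes>\<^bsub>L\<^esub> x)"
    by (simp add: pqr L_mult L_smult F_closed)
qed

definition word :: "('a, 'b) lpa_generator list \<Rightarrow> ('a, 'b, 'k) free_lpa" where
  "word xs = Poly_Mapping.single (Word xs) 1"

abbreviation gens :: "('a, 'b) lpa_generator set" where "gens \<equiv> lpa_generators G"

definition wd :: "('a, 'b) lpa_generator list \<Rightarrow> ('a, 'b, 'k) free_lpa set" where
  "wd xs = cl (word xs)"

lemma gens_simps [simp]: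
  "Vertex v \<in> gens \<longleftrightarrow> v \<in> verts G" "Edge e \<in> gens \<longleftrightarrow> e \<in> arcs G" "Ghost e \<in> gens \<longleftrightarrow> e \<in> arcs G"
  by (auto simp: lpa_generators_def)

lemma finite_gens: "finite gens"
  by (simp add: lpa_generators_def)

lemma word_carrier: "word xs \<in> carrier F \<longleftrightarrow> set xs \<subseteq> gens"
  by (simp add: word_def free_lpa_def)

lemma word_append: "word (xs @ ys) = word xs * word ys"
  by (simp add: word_def mult_single plus_free_word_def)

lemma gen_word: "gen x = word [x]"
  by (simp add: gen_def word_def)

lemma wd_append:
  "set xs \<subseteq> gens \<Longrightarrow> set ys \<subseteq> gens \<Longrightarrow> wd (xs @ ys) = wd xs \<otimes>\<^bsub>L\<^esub> wd ys"
  by (simp add: wd_def word_append L_mult word_carrier)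

lemma wd_carrier: "set xs \<subseteq> gens \<Longrightarrow> xs \<noteq> [] \<Longrightarrow> wd xs \<in> carrier L"
  unfolding L_carrier wd_def
  by (intro imageI) (simp add: word_carrier, simp add: word_def lookup_single zero_free_word_def)

lemma wd_cong:
  assumes "wd xs = wd ys" "set xs \<subseteq> gens" "set ys \<subseteq> gens" "set as \<subseteq> gens" "set bs \<subseteq> gens"
  shows "wd (as @ xs @ bs) = wd (as @ ys @ bs)"
  using assms by (simp add: wd_append)

lemma wd_zero:
  assumes "wd xs = \<zero>\<^bsub>L\<^esub>" "set xs \<subseteq> gens" "set as \<subseteq> gens" "set bs \<subseteq> gens"
  shows "wd (as @ xs @ bs) = \<zero>\<^bsub>L\<^esub>"
proof -
  have "cl p \<otimes>\<^bsub>L\<^esub> cl 0 = cl 0" "cl 0 \<otimes>\<^bsub>L\<^esub> cl p = cl 0" if "p \<in> carrier F" for p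
    using that by (simp_all add: L_mult F_closed)
  then show ?thesis
    using assms by (simp add: wd_append L_zero) (simp add: wd_def word_carrier)
qed

lemma relator_wd:
  assumes "word xs - q \<in> lpa_relators G" "q \<in> carrier F" "set xs \<subseteq> gens"
  shows "wd xs = cl q"
proof -
  have "word xs - q \<in> J"
    unfolding lpa_ideal_def using F.genideal_self[OF lpa_relators_closed] assms(1) by blast
  then show ?thesis using assms by (simp add: wd_def cl_eq_iff word_carrier)
qed

text \<open>The last relation is the sum relation at a vertex with a single outgoing edge, where it
  equates two words.\<close>

lemma wd_relations:
  "v \<in> verts G \<Longrightarrow> wd [Vertex v, Vertex v] = wd [Vertex v]"
  "v \<in> verts G \<Longrightarrow> w \<in> verts G \<Longrightarrow> v \<noteq> w \<Longrightarrow> wd [Vertex v, Vertex w] = \<zero>\<^bsub>L\<^esub>"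
  "e \<in> arcs G \<Longrightarrow> wd [Vertex (tail G e), Edge e] = wd [Edge e]"
  "e \<in> arcs G \<Longrightarrow> wd [Edge e, Vertex (head G e)] = wd [Edge e]"
  "e \<in> arcs G \<Longrightarrow> wd [Vertex (head G e), Ghost e] = wd [Ghost e]"
  "e \<in> arcs G \<Longrightarrow> wd [Ghost e, Vertex (tail G e)] = wd [Ghost e]"
  "e \<in> arcs G \<Longrightarrow> wd [Ghost e, Edge e] = wd [Vertex (head G e)]"
  "e \<in> arcs G \<Longrightarrow> f \<in> arcs G \<Longrightarrow> e \<noteq> f \<Longrightarrow> wd [Ghost e, Edge f] = \<zero>\<^bsub>L\<^esub>"
  "e \<in> arcs G \<Longrightarrow> out_arcs G (tail G e) = {e} \<Longrightarrow> wd [Edge e, Ghost e] = wd [Vertex (tail G e)]"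
proof -
  have pair: "word [x, y] = gen x * gen y" for x y
    using word_append[of "[x]" "[y]"] by (simp add: gen_word)
  have single: "wd [x, y] = wd [z]"
    if "word [x, y] - word [z] \<in> lpa_relators G" "{x, y, z} \<subseteq> gens" for x y z
    unfolding wd_def[of "[z]"] by (rule relator_wd) (use that in \<open>auto simp: word_carrier\<close>)
  have zero: "wd [x, y] = \<zero>\<^bsub>L\<^esub>" if "word [x, y] \<in> lpa_relators G" "{x, y} \<subseteq> gens" for x y
    unfolding L_zero by (rule relator_wd) (use that in \<open>auto simp: F_closed(4)\<close>)
  show "v \<in> verts G \<Longrightarrow> wd [Vertex v, Vertex v] = wd [Vertex v]"
    "e \<in> arcs G \<Longrightarrow> wd [Vertex (tail G e), Edge e] = wd [Edge e]"
    "e \<in> arcs G \<Longrightarrow> wd [Edge e, Vertex (head G e)] = wd [Edge e]"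
    "e \<in> arcs G \<Longrightarrow> wd [Vertex (head G e), Ghost e] = wd [Ghost e]"
    "e \<in> arcs G \<Longrightarrow> wd [Ghost e, Vertex (tail G e)] = wd [Ghost e]"
    "e \<in> arcs G \<Longrightarrow> wd [Ghost e, Edge e] = wd [Vertex (head G e)]"
    by (rule single; auto simp: pair lpa_relators_def gen_word)+
  show "v \<in> verts G \<Longrightarrow> w \<in> verts G \<Longrightarrow> v \<noteq> w \<Longrightarrow> wd [Vertex v, Vertex w] = \<zero>\<^bsub>L\<^esub>"
    "e \<in> arcs G \<Longrightarrow> f \<in> arcs G \<Longrightarrow> e \<noteq> f \<Longrightarrow> wd [Ghost e, Edge f] = \<zero>\<^bsub>L\<^esub>"
    by (rule zero; auto simp: pair lpa_relators_def)+
  show "wd [Edge e, Ghost e] = wd [Vertex (tail G e)]" if e: "e \<in> arcs G" "out_arcs G (tail G e) = {e}"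
  proof -
    have "(gen (Vertex (tail G e)) :: ('a, 'b, 'k) free_lpa) - (\<Sum>e\<in>out_arcs G (tail G e). gen (Edge e) * gen (Ghost e)) \<in> lpa_relators G"
      unfolding lpa_relators_def
      by (intro UnI2 CollectI exI[of _ "tail G e"] conjI HOL.refl) (use e in auto)
    then have "word [Vertex (tail G e)] - word [Edge e, Ghost e] \<in> lpa_relators G"
      using e(2) by (simp add: pair gen_word)
    then have "wd [Vertex (tail G e)] = cl (word [Edge e, Ghost e])"
      by (rule relator_wd) (use e in \<open>auto simp: word_carrier\<close>)
    then show ?thesis by (simp add: wd_def)
  qed
qed

end

section \<open>Monomials\<close>

context fin_digraph
begin

definition walk_to :: "'a \<Rightarrow> 'b list \<Rightarrow> bool" where
  "walk_to w p \<longleftrightarrow> (\<exists>u. awalk u p w)"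

lemma walk_to_Nil [simp]: "walk_to w [] \<longleftrightarrow> w \<in> verts G"
  by (auto simp: walk_to_def awalk_simps)

lemma walk_to_Cons: "walk_to w (e # p) \<longleftrightarrow> e \<in> arcs G \<and> awalk (head G e) p w"
  by (auto simp: walk_to_def awalk_simps)

lemma walk_to_snoc: "walk_to w (p @ [e]) \<longleftrightarrow> e \<in> arcs G \<and> head G e = w \<and> walk_to (tail G e) p"
proof -
  have "awalk u (p @ [e]) w \<longleftrightarrow> awalk u p (tail G e) \<and> e \<in> arcs G \<and> head G e = w" for u
  proof
    assume "awalk u p (tail G e) \<and> e \<in> arcs G \<and> head G e = w"
    moreover from this have "awalk (tail G e) [e] w" by (auto simp: awalk_simps)
    ultimately show "awalk u (p @ [e]) w" using awalk_appendI by blast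
  qed (auto simp: awalk_simps)
  then show ?thesis by (auto simp: walk_to_def)
qed

lemma walk_to_arcs: "walk_to w p \<Longrightarrow> set p \<subseteq> arcs G"
  by (auto simp: walk_to_def)

lemma walk_to_vert: "walk_to w p \<Longrightarrow> w \<in> verts G"
  by (auto simp: walk_to_def)

definition walks_upto :: "nat \<Rightarrow> 'a \<Rightarrow> 'b list set" where
  "walks_upto n w = {p. walk_to w p \<and> length p \<le> n}"

lemma finite_walks_upto: "finite (walks_upto n w)"
  by (rule finite_subset[OF _ finite_lists_length_le[OF finite_arcs]])
     (auto simp: walks_upto_def dest: walk_to_arcs)

text \<open>
  If \<open>e\<close> is the only edge leaving its source then \<open>e e\<^sup>* = s(e)\<close>, so that a monomial
  \<open>p q\<^sup>*\<close> with both \<open>p\<close> and \<open>q\<close> ending in \<open>e\<close> may be shortened.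
\<close>

definition reducible :: "'b list \<Rightarrow> 'b list \<Rightarrow> bool" where
  "reducible p q \<longleftrightarrow> (\<exists>e p' q'. p = p' @ [e] \<and> q = q' @ [e] \<and> out_arcs G (tail G e) = {e})"

definition reduced_pairs :: "nat \<Rightarrow> 'a \<Rightarrow> ('b list \<times> 'b list) set" where
  "reduced_pairs n w = {(p, q) \<in> walks_upto n w \<times> walks_upto n w. \<not> reducible p q}"

lemma finite_reduced_pairs: "finite (reduced_pairs n w)"
  by (rule finite_subset[OF _ finite_cartesian_product[OF finite_walks_upto finite_walks_upto]])
     (auto simp: reduced_pairs_def)

end

context leavitt
begin

definition monomial :: "'b list \<Rightarrow> 'a \<Rightarrow> 'b list \<Rightarrow> ('a, 'b) lpa_generator list" where
  "monomial p w q = map Edge p @ [Vertex w] @ map Ghost (rev q)"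

lemma monomial_gens: "walk_to w p \<Longrightarrow> walk_to w q \<Longrightarrow> set (monomial p w q) \<subseteq> gens"
  using walk_to_arcs walk_to_vert by (fastforce simp: monomial_def)

lemma ghosts_gens: "walk_to w q \<Longrightarrow> set (map Ghost (rev q)) \<subseteq> gens"
  using walk_to_arcs by fastforce

lemma edges_gens: "set p \<subseteq> arcs G \<Longrightarrow> set (map Edge p) \<subseteq> gens"
  by auto

lemma wd_prefix:
  assumes "wd xs = wd ys" "set xs \<subseteq> gens" "set ys \<subseteq> gens" "set bs \<subseteq> gens"
  shows "wd (xs @ bs) = wd (ys @ bs)"
  using wd_cong[OF assms(1-3) _ assms(4), of "[]"] by simp

lemma wd_prefix_zero:
  assumes "wd xs = \<zero>\<^bsub>L\<^esub>" "set xs \<subseteq> gens" "set bs \<subseteq> gens"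
  shows "wd (xs @ bs) = \<zero>\<^bsub>L\<^esub>"
  using wd_zero[OF assms(1-2) _ assms(3), of "[]"] by simp

text \<open>Insert between \<open>x\<close> and \<open>t\<close> the letters \<open>y\<close> and
  \<open>z\<close> that they absorb. In the applications these are distinct vertices, whose product
  is zero.\<close>

lemma wd_pair_zero:
  assumes "wd [x, y] = wd [x]" "wd [z, t] = wd [t]" "wd [y, z] = \<zero>\<^bsub>L\<^esub>" "{x, y, z, t} \<subseteq> gens"
  shows "wd [x, t] = \<zero>\<^bsub>L\<^esub>"
proof -
  have "wd [x, t] = wd [x, y, t]" using wd_prefix[of "[x, y]" "[x]" "[t]"] assms by simp
  also have "\<dots> = wd [x, y, z, t]"
    using wd_cong[of "[z, t]" "[t]" "[x, y]" "[]"] assms by simp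
  also have "\<dots> = \<zero>\<^bsub>L\<^esub>" using wd_zero[of "[y, z]" "[x]" "[t]"] assms by simp
  finally show ?thesis .
qed

lemma wd_zero_products:
  assumes "e \<in> arcs G" "f \<in> arcs G" "v \<in> verts G"
  shows "head G e \<noteq> tail G f \<Longrightarrow> wd [Edge e, Edge f] = \<zero>\<^bsub>L\<^esub>"
    and "head G e \<noteq> v \<Longrightarrow> wd [Edge e, Vertex v] = \<zero>\<^bsub>L\<^esub>"
    and "v \<noteq> tail G e \<Longrightarrow> wd [Vertex v, Edge e] = \<zero>\<^bsub>L\<^esub>"
    and "tail G e \<noteq> v \<Longrightarrow> wd [Ghost e, Vertex v] = \<zero>\<^bsub>L\<^esub>"
proof -
  show "head G e \<noteq> tail G f \<Longrightarrow> wd [Edge e, Edge f] = \<zero>\<^bsub>L\<^esub>"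
    by (rule wd_pair_zero[of _ "Vertex (head G e)" "Vertex (tail G f)"])
       (use assms in \<open>simp_all add: wd_relations\<close>)
  show "head G e \<noteq> v \<Longrightarrow> wd [Edge e, Vertex v] = \<zero>\<^bsub>L\<^esub>"
    by (rule wd_pair_zero[of _ "Vertex (head G e)" "Vertex v"])
       (use assms in \<open>simp_all add: wd_relations\<close>)
  show "v \<noteq> tail G e \<Longrightarrow> wd [Vertex v, Edge e] = \<zero>\<^bsub>L\<^esub>"
    by (rule wd_pair_zero[of _ "Vertex v" "Vertex (tail G e)"])
       (use assms in \<open>simp_all add: wd_relations\<close>)
  show "tail G e \<noteq> v \<Longrightarrow> wd [Ghost e, Vertex v] = \<zero>\<^bsub>L\<^esub>"
    by (rule wd_pair_zero[of _ "Vertex (tail G e)" "Vertex v"])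
       (use assms in \<open>simp_all add: wd_relations\<close>)
qed

text \<open>Zero is allowed because letters need not fit together. The length of a word bounds both
  paths, which ties the growth of the algebra to \<open>walks_upto\<close>.\<close>

definition monomial_value :: "nat \<Rightarrow> ('a, 'b, 'k) free_lpa set \<Rightarrow> bool" where
  "monomial_value n x \<longleftrightarrow> x = \<zero>\<^bsub>L\<^esub> \<or>
     (\<exists>p w q. walk_to w p \<and> walk_to w q \<and> length p \<le> n \<and> length q \<le> n \<and> x = wd (monomial p w q))"

lemma monomial_valueI:
  "walk_to w p \<Longrightarrow> walk_to w q \<Longrightarrow> length p \<le> n \<Longrightarrow> length q \<le> n \<Longrightarrow> xs = monomial p w q \<Longrightarrow>
    monomial_value n (wd xs)"
  unfolding monomial_value_def by blast

lemma vertex_times_monomial: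
  assumes "v \<in> verts G" "walk_to w p" "walk_to w q" "length p \<le> n" "length q \<le> n"
  shows "monomial_value n (wd (Vertex v # monomial p w q))"
proof (cases p)
  case Nil
  have w: "w \<in> verts G" using assms walk_to_vert by blast
  have eq: "wd (Vertex v # monomial p w q) = wd ([Vertex v, Vertex w] @ map Ghost (rev q))"
    by (simp add: monomial_def Nil)
  show ?thesis
  proof (cases "v = w")
    case True
    have "wd ([Vertex v, Vertex w] @ map Ghost (rev q)) = wd ([Vertex w] @ map Ghost (rev q))"
      using wd_relations(1) ghosts_gens[OF assms(3)] w True by (intro wd_prefix) auto
    moreover have "monomial_value n (wd ([Vertex w] @ map Ghost (rev q)))"
      by (rule monomial_valueI[of w "[]" q]) (use assms w in \<open>auto simp: monomial_def\<close>)
    ultimately show ?thesis using eq by simp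
  next
    case False
    then have "wd ([Vertex v, Vertex w] @ map Ghost (rev q)) = \<zero>\<^bsub>L\<^esub>"
      using wd_relations(2) ghosts_gens[OF assms(3)] w assms(1) by (intro wd_prefix_zero) auto
    then show ?thesis using eq by (simp add: monomial_value_def)
  qed
next
  case (Cons f p')
  have f: "f \<in> arcs G" using assms(2) Cons by (simp add: walk_to_Cons)
  define bs where "bs = monomial p' w q"
  have bs: "set bs \<subseteq> gens" using monomial_gens[OF assms(2,3)] by (simp add: monomial_def bs_def Cons)
  have eq: "wd (Vertex v # monomial p w q) = wd ([Vertex v, Edge f] @ bs)"
    "monomial p w q = [Edge f] @ bs"
    by (simp_all add: monomial_def bs_def Cons)
  show ?thesis
  proof (cases "v = tail G f")
    case True
    then have "wd ([Vertex v, Edge f] @ bs) = wd ([Edge f] @ bs)"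
      using wd_relations(3) f bs by (intro wd_prefix) auto
    then show ?thesis
      unfolding eq(1) unfolding eq(2)[symmetric] using assms monomial_valueI by metis
  next
    case False
    then have "wd ([Vertex v, Edge f] @ bs) = \<zero>\<^bsub>L\<^esub>"
      using wd_zero_products(3)[OF f f assms(1)] f bs assms(1) by (intro wd_prefix_zero) auto
    then show ?thesis using eq by (simp add: monomial_value_def)
  qed
qed

text \<open>A fitting letter is absorbed, prolongs \<open>p\<close>, cancels the initial edge of
  \<open>p\<close>, or, as a ghost meeting an empty \<open>p\<close>, prolongs \<open>q\<close>. All
  other letters give zero.\<close>

lemma generator_times_monomial:
  assumes x: "x \<in> gens" and w: "walk_to w p" "walk_to w q" "length p \<le> n" "length q \<le> n"
  shows "monomial_value (Suc n) (wd (x # monomial p w q))"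
proof -
  have wv: "w \<in> verts G" using w(1) walk_to_vert by blast
  consider (V) v where "x = Vertex v" | (E) e where "x = Edge e" | (G) e where "x = Ghost e"
    by (cases x) auto
  then show ?thesis
  proof cases
    case V
    then show ?thesis using vertex_times_monomial[of v w p q "Suc n"] x w by simp
  next
    case E
    then have e: "e \<in> arcs G" using x by simp
    show ?thesis
    proof (cases p)
      case Nil
      show ?thesis
      proof (cases "head G e = w")
        case True
        show ?thesis
          by (rule monomial_valueI[of w "[e]" q])
             (use E Nil w e True wv in \<open>auto simp: monomial_def walk_to_Cons awalk_simps\<close>)
      next
        case False
        then have "wd ([Edge e, Vertex w] @ map Ghost (rev q)) = \<zero>\<^bsub>L\<^esub>"
          using wd_zero_products(2)[OF e e wv] ghosts_gens[OF w(2)] wv e by (intro wd_prefix_zero) auto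
        then show ?thesis using E Nil by (simp add: monomial_value_def monomial_def)
      qed
    next
      case (Cons f p')
      then have f: "f \<in> arcs G" "awalk (head G f) p' w" using w(1) by (auto simp: walk_to_Cons)
      show ?thesis
      proof (cases "head G e = tail G f")
        case True
        then have "walk_to w (e # p)"
          using e f Cons by (simp add: walk_to_Cons awalk_simps)
        then show ?thesis
          by (rule monomial_valueI[of w "e # p" q]) (use E w in \<open>auto simp: monomial_def\<close>)
      next
        case False
        have "set (monomial p' w q) \<subseteq> gens" using monomial_gens[OF w(1,2)] by (simp add: monomial_def Cons)
        then have "wd ([Edge e, Edge f] @ monomial p' w q) = \<zero>\<^bsub>L\<^esub>"
          using wd_zero_products(1)[OF e f(1) wv False] e f by (intro wd_prefix_zero) auto
        then show ?thesis using E Cons by (simp add: monomial_value_def monomial_def)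
      qed
    qed
  next
    case G
    then have e: "e \<in> arcs G" using x by simp
    show ?thesis
    proof (cases p)
      case Nil
      show ?thesis
      proof (cases "tail G e = w")
        case True
        \<comment> \<open>The ghost absorbs \<open>w\<close> as its source and emits its range as
          the new middle vertex, so \<open>e\<close> becomes the last edge of
          \<open>q\<close>.\<close>
        have "wd ([Ghost e, Vertex w] @ map Ghost (rev q)) = wd ([Ghost e] @ map Ghost (rev q))"
          using wd_relations(6)[OF e] ghosts_gens[OF w(2)] wv e True by (intro wd_prefix) auto
        also have "\<dots> = wd ([Vertex (head G e), Ghost e] @ map Ghost (rev q))"
          using wd_relations(5)[OF e] ghosts_gens[OF w(2)] wv e True by (intro wd_prefix) auto
        finally have "wd (x # monomial p w q) = wd (monomial [] (head G e) (q @ [e]))"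
          using G Nil by (simp add: monomial_def)
        moreover have "walk_to (head G e) (q @ [e])" using w(2) e True by (simp add: walk_to_snoc)
        ultimately show ?thesis using e w by (auto intro!: monomial_valueI[of "head G e" "[]" "q @ [e]"])
      next
        case False
        then have "wd ([Ghost e, Vertex w] @ map Ghost (rev q)) = \<zero>\<^bsub>L\<^esub>"
          using wd_zero_products(4)[OF e e wv] ghosts_gens[OF w(2)] wv e by (intro wd_prefix_zero) auto
        then show ?thesis using G Nil by (simp add: monomial_value_def monomial_def)
      qed
    next
      case (Cons f p')
      then have f: "f \<in> arcs G" "awalk (head G f) p' w" using w(1) by (auto simp: walk_to_Cons)
      have bs: "set (monomial p' w q) \<subseteq> gens" using monomial_gens[OF w(1,2)] by (simp add: monomial_def Cons)
      have eq: "wd (x # monomial p w q) = wd ([Ghost e, Edge f] @ monomial p' w q)"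
        using G Cons by (simp add: monomial_def)
      show ?thesis
      proof (cases "e = f")
        case True
        have "wd ([Ghost e, Edge f] @ monomial p' w q) = wd ([Vertex (head G f)] @ monomial p' w q)"
          using wd_relations(7)[OF e] bs f True by (intro wd_prefix) auto
        moreover have "walk_to w p'" using f by (auto simp: walk_to_def)
        then have "monomial_value (Suc n) (wd (Vertex (head G f) # monomial p' w q))"
          using vertex_times_monomial[of "head G f" w p' q "Suc n"] f w Cons by simp
        ultimately show ?thesis using eq by simp
      next
        case False
        then have "wd ([Ghost e, Edge f] @ monomial p' w q) = \<zero>\<^bsub>L\<^esub>"
          using wd_relations(8)[OF e f(1)] e f bs by (intro wd_prefix_zero) auto
        then show ?thesis using eq by (simp add: monomial_value_def)
      qed
    qed
  qed
qed

lemma word_is_monomial: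
  assumes "xs \<noteq> []" "set xs \<subseteq> gens"
  shows "monomial_value (length xs) (wd xs)"
  using assms
proof (induction xs rule: list_nonempty_induct)
  case (single x)
  consider (V) v where "x = Vertex v" | (E) e where "x = Edge e" | (G) e where "x = Ghost e"
    by (cases x) auto
  then show ?case
  proof cases
    case V
    then show ?thesis
      using single by (intro monomial_valueI[of v "[]" "[]"]) (auto simp: monomial_def)
  next
    case E
    then have "wd [x] = wd [Edge e, Vertex (head G e)]" using single wd_relations(4) by simp
    moreover have "monomial_value (length [x]) (wd [Edge e, Vertex (head G e)])"
      by (rule monomial_valueI[of "head G e" "[e]" "[]"])
         (use single E in \<open>auto simp: monomial_def walk_to_Cons awalk_simps\<close>)
    ultimately show ?thesis by simp
  next
    case G
    then have "wd [x] = wd [Vertex (head G e), Ghost e]" using single wd_relations(5) by simp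
    moreover have "monomial_value (length [x]) (wd [Vertex (head G e), Ghost e])"
      by (rule monomial_valueI[of "head G e" "[]" "[e]"])
         (use single G in \<open>auto simp: monomial_def walk_to_Cons awalk_simps\<close>)
    ultimately show ?thesis by simp
  qed
next
  case (cons x xs)
  then have IH: "monomial_value (length xs) (wd xs)" and x: "x \<in> gens" "set xs \<subseteq> gens" by auto
  have eq: "wd (x # xs) = wd [x] \<otimes>\<^bsub>L\<^esub> wd xs" using wd_append[of "[x]" xs] x by simp
  show ?case
  proof (cases "wd xs = \<zero>\<^bsub>L\<^esub>")
    case True
    have c: "wd [x] \<in> carrier L" using wd_carrier[of "[x]"] x by simp
    from True show ?thesis using eq L_bilinear(6)[OF c c c] by (simp add: monomial_value_def)
  next
    case False
    then obtain p w q where pq: "walk_to w p" "walk_to w q" "length p \<le> length xs" "length q \<le> length xs"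
      "wd xs = wd (monomial p w q)"
      using IH unfolding monomial_value_def by blast
    have "wd (x # xs) = wd (x # monomial p w q)"
      using eq pq(5) wd_append[of "[x]" "monomial p w q"] x monomial_gens[OF pq(1,2)] by simp
    then show ?thesis using generator_times_monomial[OF x(1) pq(1-4)] by simp
  qed
qed

lemma monomial_reduce:
  assumes "walk_to w p" "walk_to w q" "length p \<le> n" "length q \<le> n"
  shows "\<exists>w'\<in>verts G. \<exists>(p', q')\<in>reduced_pairs n w'. wd (monomial p w q) = wd (monomial p' w' q')"
  using assms
proof (induction p arbitrary: w q rule: rev_induct)
  case Nil
  then have "([], q) \<in> reduced_pairs n w"
    by (auto simp: reduced_pairs_def walks_upto_def reducible_def)
  then show ?case using Nil walk_to_vert by blast
next
  case (snoc e p)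
  show ?case
  proof (cases "reducible (p @ [e]) q")
    case False
    then have "(p @ [e], q) \<in> reduced_pairs n w"
      using snoc.prems by (auto simp: reduced_pairs_def walks_upto_def)
    then show ?thesis using snoc.prems walk_to_vert by blast
  next
    case True
    then obtain q' where q: "q = q' @ [e]" "out_arcs G (tail G e) = {e}" by (auto simp: reducible_def)
    have e: "e \<in> arcs G" "head G e = w" "walk_to (tail G e) p" "walk_to (tail G e) q'"
      using snoc.prems q by (auto simp: walk_to_snoc)
    have g: "set (map Edge p) \<subseteq> gens" "set (map Ghost (rev q')) \<subseteq> gens"
      using edges_gens[OF walk_to_arcs[OF e(3)]] ghosts_gens[OF e(4)] by auto
    have "monomial (p @ [e]) w q = map Edge p @ [Edge e, Vertex w] @ Ghost e # map Ghost (rev q')"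
      by (simp add: monomial_def q)
    also have "wd \<dots> = wd (map Edge p @ [Edge e] @ Ghost e # map Ghost (rev q'))"
      using wd_relations(4)[OF e(1)] e g by (intro wd_cong) auto
    also have "map Edge p @ [Edge e] @ Ghost e # map Ghost (rev q') =
        map Edge p @ [Edge e, Ghost e] @ map Ghost (rev q')" by simp
    also have "wd \<dots> = wd (map Edge p @ [Vertex (tail G e)] @ map Ghost (rev q'))"
      using wd_relations(9)[OF e(1) q(2)] e g by (intro wd_cong) auto
    finally have "wd (monomial (p @ [e]) w q) = wd (monomial p (tail G e) q')"
      by (simp add: monomial_def)
    moreover have "\<exists>w'\<in>verts G. \<exists>(p', q'')\<in>reduced_pairs n w'. wd (monomial p (tail G e) q') = wd (monomial p' w' q'')"
      by (rule snoc.IH) (use e snoc.prems q in auto)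
    ultimately show ?thesis by simp
  qed
qed


section \<open>Growth\<close>

text \<open>The empty word is excluded: it stands for the constant \<open>1\<close>, which the
  non-unital construction leaves out.\<close>

definition words_upto :: "nat \<Rightarrow> ('a, 'b, 'k) free_lpa set set" where
  "words_upto n = wd ` {xs. xs \<noteq> [] \<and> set xs \<subseteq> gens \<and> length xs \<le> n}"

lemma words_upto_carrier: "words_upto n \<subseteq> carrier L"
  using wd_carrier by (auto simp: words_upto_def)

lemma words_upto_mono: "m \<le> n \<Longrightarrow> words_upto m \<subseteq> words_upto n"
  by (auto simp: words_upto_def)

lemma finite_words_upto: "finite (words_upto n)"
  unfolding words_upto_def
  by (rule finite_imageI, rule finite_subset[OF _ finite_lists_length_le[OF finite_gens, of n]]) auto

definition reduced_monomials :: "nat \<Rightarrow> ('a, 'b, 'k) free_lpa set set" where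
  "reduced_monomials n = (\<lambda>(w, p, q). wd (monomial p w q)) ` (SIGMA w:verts G. reduced_pairs n w)"

lemma reduced_monomials_carrier: "reduced_monomials n \<subseteq> carrier L"
proof -
  have "wd (monomial p w q) \<in> carrier L" if "(p, q) \<in> reduced_pairs n w" for p w q
    using that by (intro wd_carrier monomial_gens) (auto simp: monomial_def reduced_pairs_def walks_upto_def)
  then show ?thesis by (auto simp: reduced_monomials_def)
qed

lemma card_reduced_monomials:
  "finite (reduced_monomials n)" "card (reduced_monomials n) \<le> (\<Sum>w\<in>verts G. card (reduced_pairs n w))"
proof -
  have fin: "finite (SIGMA w:verts G. reduced_pairs n w)"
    using finite_reduced_pairs by (intro finite_SigmaI) auto
  then show "finite (reduced_monomials n)" by (simp add: reduced_monomials_def)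
  show "card (reduced_monomials n) \<le> (\<Sum>w\<in>verts G. card (reduced_pairs n w))"
    unfolding reduced_monomials_def using card_image_le[OF fin] finite_reduced_pairs
    by (subst (asm) card_SigmaI) auto
qed

lemma words_in_span: "words_upto n \<subseteq> L.span (reduced_monomials n)"
proof
  fix x assume "x \<in> words_upto n"
  then obtain xs where xs: "x = wd xs" "xs \<noteq> []" "set xs \<subseteq> gens" "length xs \<le> n"
    by (auto simp: words_upto_def)
  show "x \<in> L.span (reduced_monomials n)"
  proof (cases "x = \<zero>\<^bsub>L\<^esub>")
    case True
    then show ?thesis using L.zero_in_span[OF reduced_monomials_carrier] by simp
  next
    case False
    then obtain p w q where pq: "walk_to w p" "walk_to w q" "length p \<le> n" "length q \<le> n"
      "x = wd (monomial p w q)"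
      using word_is_monomial[OF xs(2,3)] xs(1,4) unfolding monomial_value_def by (meson le_trans)
    from monomial_reduce[OF pq(1-4)] have "x \<in> reduced_monomials n"
      unfolding reduced_monomials_def pq(5) by force
    then show ?thesis using L.in_own_span[OF reduced_monomials_carrier] by blast
  qed
qed

lemma poly_in_span_words:
  assumes "\<And>w. w \<in> Poly_Mapping.keys p \<Longrightarrow>
    letters w \<noteq> [] \<and> set (letters w) \<subseteq> gens \<and> length (letters w) \<le> n"
  shows "p \<in> carrier F \<and> cl p \<in> L.span (words_upto n)"
  using assms
proof (induction p rule: Poly_Mapping.update_induct)
  case const
  then show ?case using L.zero_in_span[OF words_upto_carrier] L_zero F_closed(4) by simp
next
  case (update f a b)
  have eq: "Poly_Mapping.update a b f = f + Poly_Mapping.single 0 b * word (letters a)"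
    using update(1)
    by (intro poly_mapping_eqI)
       (auto simp: lookup_update lookup_add lookup_single in_keys_iff when_def word_def mult_single)
  have keys: "Poly_Mapping.keys (Poly_Mapping.update a b f) = insert a (Poly_Mapping.keys f)"
    using update(2) by (auto simp: in_keys_iff lookup_update split: if_splits)
  have f: "f \<in> carrier F" "cl f \<in> L.span (words_upto n)" using update.IH update.prems keys by auto
  have a: "letters a \<noteq> []" "set (letters a) \<subseteq> gens" "length (letters a) \<le> n"
    using update.prems keys by auto
  then have wa: "word (letters a) \<in> carrier F" "cl (word (letters a)) \<in> words_upto n"
    by (auto simp: word_carrier words_upto_def wd_def)
  have "cl (Poly_Mapping.update a b f) = cl f \<oplus>\<^bsub>L\<^esub> b \<odot>\<^bsub>L\<^esub> cl (word (letters a))"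
    unfolding eq using f wa by (simp add: L_add L_smult F_closed)
  moreover have "b \<odot>\<^bsub>L\<^esub> cl (word (letters a)) \<in> L.span (words_upto n)"
    using L.in_own_span[OF words_upto_carrier] wa by (intro L.smult_in_span[OF words_upto_carrier]) auto
  ultimately show ?case
    using L.add_in_span[OF words_upto_carrier f(2)] eq F_closed f wa by simp
qed

lemma carrier_in_span_words:
  assumes "x \<in> carrier L"
  shows "\<exists>n. x \<in> L.span (words_upto n)"
proof -
  obtain p where p: "p \<in> carrier F" "Poly_Mapping.lookup p 0 = 0" "x = cl p"
    using assms unfolding L_carrier by blast
  define n where "n = (\<Sum>w\<in>Poly_Mapping.keys p. length (letters w))"
  have "letters w \<noteq> [] \<and> set (letters w) \<subseteq> gens \<and> length (letters w) \<le> n"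
    if w: "w \<in> Poly_Mapping.keys p" for w
  proof (intro conjI)
    show "letters w \<noteq> []"
    proof
      assume "letters w = []"
      then have "w = 0" by (cases w) (simp add: zero_free_word_def)
      with w p(2) show False by (simp add: in_keys_iff)
    qed
    show "set (letters w) \<subseteq> gens" using p(1) w by (simp add: free_lpa_def)
    show "length (letters w) \<le> n" unfolding n_def using w by (intro member_le_sum) auto
  qed
  from poly_in_span_words[OF this] show ?thesis using p(3) by blast
qed

lemma span_words_mono: "m \<le> n \<Longrightarrow> L.span (words_upto m) \<subseteq> L.span (words_upto n)"
  by (rule L.span_is_monotone[OF words_upto_mono])

lemma span_words_subset: "L.span (words_upto n) \<subseteq> carrier L"
  by (rule L.span_is_subset2[OF words_upto_carrier])

lemma span_words_mult:
  assumes "x \<in> L.span (words_upto a)" "y \<in> L.span (words_upto b)"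
  shows "x \<otimes>\<^bsub>L\<^esub> y \<in> L.span (words_upto (a + b))"
proof -
  let ?S = "L.span (words_upto (a + b))"
  note c = words_upto_carrier and sc = subsetD[OF words_upto_carrier]
  have words: "x \<otimes>\<^bsub>L\<^esub> y \<in> ?S" if "x \<in> words_upto a" "y \<in> words_upto b" for x y
  proof -
    obtain xs ys where xy: "x = wd xs" "xs \<noteq> []" "set xs \<subseteq> gens" "length xs \<le> a"
      "y = wd ys" "set ys \<subseteq> gens" "length ys \<le> b"
      using \<open>x \<in> words_upto a\<close> \<open>y \<in> words_upto b\<close> by (auto simp: words_upto_def)
    then have "x \<otimes>\<^bsub>L\<^esub> y = wd (xs @ ys)" by (simp add: wd_append)
    moreover have "wd (xs @ ys) \<in> words_upto (a + b)" using xy by (auto simp: words_upto_def)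
    ultimately show ?thesis using L.in_own_span[OF c] by auto
  qed
  have right: "x \<otimes>\<^bsub>L\<^esub> y \<in> ?S" if x: "x \<in> words_upto a" and y: "y \<in> L.span (words_upto b)" for x y
    using y c
  proof (induction y rule: L.span_induct')
    case zero
    then show ?case using L_bilinear(6)[of x x x] sc[OF x] L.zero_in_span[OF c] by simp
  next
    case (add y z)
    then show ?case using L_bilinear(2)[of y z x] sc[OF x] L.add_in_span[OF c] by simp
  next
    case (mem k y)
    then show ?case using L_bilinear(4)[of y y x k] sc[OF x] sc[OF mem(2)] words[OF x] L.smult_in_span[OF c] by simp
  qed
  have y: "y \<in> carrier L" using assms(2) span_words_subset by blast
  show ?thesis using assms(1) c
  proof (induction x rule: L.span_induct')
    case zero
    then show ?case using L_bilinear(5)[of y y y] y L.zero_in_span[OF c] by simp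
  next
    case (add x z)
    then show ?case using L_bilinear(1)[of x z y] y L.add_in_span[OF c] by simp
  next
    case (mem k x)
    then show ?case
      using L_bilinear(3)[of x x y k] y sc[OF mem(2)] right[OF mem(2) assms(2)] L.smult_in_span[OF c] by simp
  qed
qed

lemma subspace_power_1: "subspace_power K L V 1 = V" "subspace_power K L V (Suc 0) = V"
  by (simp_all add: subspace_power_def)

lemma subspace_power_Suc:
  "i \<noteq> 0 \<Longrightarrow> subspace_power K L V (Suc i) = L.span (V <#>\<^bsub>L\<^esub> subspace_power K L V i)"
  by (cases i) (simp_all add: subspace_power_def)

lemma subspace_power_words:
  assumes "V \<subseteq> L.span (words_upto m)" "i \<noteq> 0"
  shows "subspace_power K L V i \<subseteq> L.span (words_upto (m * i))"
  using assms(2)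
proof (induction i)
  case (Suc i)
  show ?case
  proof (cases "i = 0")
    case True
    then show ?thesis using assms(1) by (simp add: subspace_power_1)
  next
    case False
    have "V <#>\<^bsub>L\<^esub> subspace_power K L V i \<subseteq> L.span (words_upto (m + m * i))"
      using assms(1) Suc.IH[OF False] span_words_mult by (fastforce simp: set_mult_def)
    then show ?thesis
      unfolding subspace_power_Suc[OF False]
      using L.span_minimal[OF _ words_upto_carrier] by simp
  qed
qed simp

lemma sum_of_powers_words:
  assumes "V \<subseteq> L.span (words_upto m)"
  shows "(\<Union>i\<in>{1..n}. subspace_power K L V i) \<subseteq> L.span (words_upto (m * n))"
proof
  fix x assume "x \<in> (\<Union>i\<in>{1..n}. subspace_power K L V i)"
  then obtain i where i: "i \<in> {1..n}" "x \<in> subspace_power K L V i" by blast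
  then have "x \<in> L.span (words_upto (m * i))" using subspace_power_words[OF assms, of i] by auto
  moreover have "m * i \<le> m * n" using i by simp
  ultimately show "x \<in> L.span (words_upto (m * n))" using span_words_mono by blast
qed

lemma growth_space:
  assumes "V \<subseteq> L.span (words_upto m)"
  defines "W n \<equiv> L.span (\<Union>i\<in>{1..n}. subspace_power K L V i)"
  shows "VectorSpace.subspace K (W n) L" "W n \<subseteq> L.span (words_upto (m * n))"
    "vectorspace.fin_dim K (L\<lparr>carrier := W n\<rparr>)"
proof -
  note sub = sum_of_powers_words[OF assms(1), of n]
  show W: "VectorSpace.subspace K (W n) L"
    unfolding W_def using sub span_words_subset by (intro L.span_is_subspace) blast
  show le: "W n \<subseteq> L.span (words_upto (m * n))"
    unfolding W_def by (rule L.span_minimal[OF sub words_upto_carrier])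
  show "vectorspace.fin_dim K (L\<lparr>carrier := W n\<rparr>)"
    by (rule L.subspace_of_span_dim(1)[OF W finite_words_upto words_upto_carrier le])
qed

text \<open>A finite spanning set of \<open>V\<close> lies in the span of words of some bounded
  length \<open>m\<close>, so products of at most \<open>n\<close> elements need words of length
  \<open>m * n\<close>. The factor \<open>m\<close> does not affect the dimension.\<close>

lemma growth_upper:
  assumes V: "VectorSpace.subspace K V L" "vectorspace.fin_dim K (L\<lparr>carrier := V\<rparr>)"
  obtains m where "\<And>n. growth K L V n \<le> (\<Sum>w\<in>verts G. card (reduced_pairs (m * n) w))"
proof -
  interpret V: vectorspace K "L\<lparr>carrier := V\<rparr>" by (rule L.subspace_is_vs[OF V(1)])
  obtain A where A: "finite A" "A \<subseteq> V" "V.span A = V"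
    using V(2) unfolding V.fin_dim_def by auto
  have sub: "LinearCombinations.submodule K V L" using V(1) by simp
  then have VL: "V \<subseteq> carrier L" by (simp add: LinearCombinations.submodule_def)
  obtain k where k: "\<And>x. x \<in> carrier L \<Longrightarrow> x \<in> L.span (words_upto (k x))"
    using carrier_in_span_words by metis
  define m where "m = (\<Sum>x\<in>A. k x)"
  have "A \<subseteq> L.span (words_upto m)"
  proof
    fix x assume x: "x \<in> A"
    then have "k x \<le> m" unfolding m_def using A(1) by (intro member_le_sum) auto
    moreover have "x \<in> L.span (words_upto (k x))" using k x A(2) VL by blast
    ultimately show "x \<in> L.span (words_upto m)" using span_words_mono by blast
  qed
  then have "L.span A \<subseteq> L.span (words_upto m)" by (rule L.span_minimal[OF _ words_upto_carrier])
  then have Vm: "V \<subseteq> L.span (words_upto m)"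
    using L.span_li_not_depend(1)[OF A(2) sub] A(3) by simp
  show ?thesis
  proof (rule that[of m])
    fix n
    note W = growth_space[OF Vm, of n]
    have "L.span (\<Union>i\<in>{1..n}. subspace_power K L V i) \<subseteq> L.span (reduced_monomials (m * n))"
      using W(2) L.span_minimal[OF words_in_span reduced_monomials_carrier] by blast
    from L.subspace_of_span_dim(2)[OF W(1) card_reduced_monomials(1) reduced_monomials_carrier this]
    have "growth K L V n \<le> card (reduced_monomials (m * n))" by (simp add: growth_def)
    also note card_reduced_monomials(2)
    finally show "growth K L V n \<le> (\<Sum>w\<in>verts G. card (reduced_pairs (m * n) w))" .
  qed
qed

text \<open>The span of the letters. The dimension is a supremum over subspaces, so this one
  suffices for lower bounds.\<close>

definition generating_space :: "('a, 'b, 'k) free_lpa set set" where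
  "generating_space = L.span (words_upto 1)"

lemma generating_space:
  "VectorSpace.subspace K generating_space L"
  "vectorspace.fin_dim K (L\<lparr>carrier := generating_space\<rparr>)"
proof -
  show *: "VectorSpace.subspace K generating_space L"
    unfolding generating_space_def by (rule L.span_is_subspace[OF words_upto_carrier])
  show "vectorspace.fin_dim K (L\<lparr>carrier := generating_space\<rparr>)"
    by (rule L.subspace_of_span_dim(1)[OF * finite_words_upto[of 1] words_upto_carrier])
       (simp add: generating_space_def)
qed

lemma wd_in_subspace_power:
  assumes "xs \<noteq> []" "set xs \<subseteq> gens"
  shows "wd xs \<in> subspace_power K L generating_space (length xs)"
  using assms
proof (induction xs rule: list_nonempty_induct)
  case (single x)
  then have "wd [x] \<in> words_upto 1" by (auto simp: words_upto_def)
  then show ?case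
    using L.in_own_span[OF words_upto_carrier] by (auto simp: subspace_power_1 generating_space_def)
next
  case (cons x xs)
  have "wd [x] \<in> words_upto 1" using cons.prems by (auto simp: words_upto_def)
  then have x: "wd [x] \<in> generating_space"
    unfolding generating_space_def using L.in_own_span[OF words_upto_carrier] by blast
  have sub: "generating_space <#>\<^bsub>L\<^esub> subspace_power K L generating_space (length xs) \<subseteq> carrier L"
  proof -
    have "subspace_power K L generating_space (length xs) \<subseteq> carrier L"
      using subspace_power_words[of generating_space 1 "length xs"] cons.hyps span_words_subset
      by (auto simp: generating_space_def)
    moreover have "generating_space \<subseteq> carrier L" using span_words_subset by (simp add: generating_space_def)
    ultimately show ?thesis
      unfolding set_mult_def by (intro UN_least) (simp add: L_mult_closed subset_iff)
  qed
  have "wd (x # xs) = wd [x] \<otimes>\<^bsub>L\<^esub> wd xs" using wd_append[of "[x]" xs] cons.prems by simp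
  moreover have "wd [x] \<otimes>\<^bsub>L\<^esub> wd xs \<in> generating_space <#>\<^bsub>L\<^esub> subspace_power K L generating_space (length xs)"
    using x cons.IH cons.prems by (auto simp: set_mult_def)
  ultimately have "wd (x # xs) \<in> L.span (generating_space <#>\<^bsub>L\<^esub> subspace_power K L generating_space (length xs))"
    using L.in_own_span[OF sub] by auto
  then show ?case using cons.hyps by (simp add: subspace_power_Suc)
qed

lemma growth_lower:
  assumes "finite T" "\<And>t. t \<in> T \<Longrightarrow> b t \<noteq> [] \<and> set (b t) \<subseteq> gens \<and> length (b t) \<le> n"
    and add: "\<And>t x y. t \<in> T \<Longrightarrow> x \<in> carrier L \<Longrightarrow> y \<in> carrier L \<Longrightarrow> \<psi> t (x \<oplus>\<^bsub>L\<^esub> y) = \<psi> t x + \<psi> t y"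
    and smult: "\<And>t c x. t \<in> T \<Longrightarrow> x \<in> carrier L \<Longrightarrow> \<psi> t (c \<odot>\<^bsub>L\<^esub> x) = c * (\<psi> t x :: 'k)"
    and dual: "\<And>s t. s \<in> T \<Longrightarrow> t \<in> T \<Longrightarrow> \<psi> t (wd (b s)) = (if s = t then 1 else 0)"
  shows "card T \<le> growth K L generating_space n"
  unfolding growth_def
proof (rule dual_family_card_le_dim[where \<psi> = \<psi> and b = "\<lambda>t. wd (b t)"])
  have le: "generating_space \<subseteq> L.span (words_upto 1)" by (simp add: generating_space_def)
  show "vectorspace K L" by (rule vectorspace_leavitt_path_algebra)
  show "VectorSpace.subspace K (L.span (\<Union>i\<in>{1..n}. subspace_power K L generating_space i)) L"
    "vectorspace.fin_dim K (L\<lparr>carrier := L.span (\<Union>i\<in>{1..n}. subspace_power K L generating_space i)\<rparr>)"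
    using growth_space(1,3)[OF le] .
  fix t assume t: "t \<in> T"
  have "wd (b t) \<in> subspace_power K L generating_space (length (b t))"
    by (rule wd_in_subspace_power) (use assms(2)[OF t] in auto)
  moreover have "length (b t) \<in> {1..n}" using assms(2)[OF t] by (cases "b t") auto
  ultimately have "wd (b t) \<in> (\<Union>i\<in>{1..n}. subspace_power K L generating_space i)" by blast
  moreover have "(\<Union>i\<in>{1..n}. subspace_power K L generating_space i) \<subseteq> carrier L"
    using sum_of_powers_words[OF le] span_words_subset by blast
  ultimately show "wd (b t) \<in> L.span (\<Union>i\<in>{1..n}. subspace_power K L generating_space i)"
    using L.in_own_span by blast
qed (use assms in auto)

end

section \<open>Representations on boundary paths\<close>

lemma poly_mapping_keys_induct [consumes 1, case_names zero add]:
  assumes "Poly_Mapping.keys p \<subseteq> A" "P 0" "\<And>f a b. P f \<Longrightarrow> a \<in> A \<Longrightarrow> P (f + Poly_Mapping.single a b)"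
  shows "P p"
  using assms(1)
proof (induction p rule: Poly_Mapping.update_induct)
  case (update f a b)
  have "Poly_Mapping.update a b f = f + Poly_Mapping.single a b"
    using update(1)
    by (intro poly_mapping_eqI) (auto simp: lookup_update lookup_add lookup_single in_keys_iff when_def)
  moreover have "Poly_Mapping.keys (Poly_Mapping.update a b f) = insert a (Poly_Mapping.keys f)"
    using update(2) by (auto simp: in_keys_iff lookup_update split: if_splits)
  ultimately show ?case using update assms(3) by auto
qed (rule assms(2))

lemma poly_mapping_add_induct [case_names zero add]:
  assumes "P 0" "\<And>f a b. P f \<Longrightarrow> P (f + Poly_Mapping.single a b)"
  shows "P p"
  using subset_UNIV assms by (rule poly_mapping_keys_induct)

section \<open>Linear extension of functions on words\<close>

definition lin_ext :: "('x \<Rightarrow> 'k::field) \<Rightarrow> ('x \<Rightarrow>\<^sub>0 'k) \<Rightarrow> 'k" where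
  "lin_ext f p = (\<Sum>w\<in>Poly_Mapping.keys p. Poly_Mapping.lookup p w * f w)"

lemma lin_ext_superset:
  "finite A \<Longrightarrow> Poly_Mapping.keys p \<subseteq> A \<Longrightarrow> lin_ext f p = (\<Sum>w\<in>A. Poly_Mapping.lookup p w * f w)"
  unfolding lin_ext_def by (rule sum.mono_neutral_left) (auto simp: in_keys_iff)

lemma lin_ext_add: "lin_ext f (p + q) = lin_ext f p + lin_ext f q"
proof -
  let ?A = "Poly_Mapping.keys p \<union> Poly_Mapping.keys q"
  have "lin_ext f r = (\<Sum>w\<in>?A. Poly_Mapping.lookup r w * f w)" if "Poly_Mapping.keys r \<subseteq> ?A" for r
    using that by (intro lin_ext_superset) auto
  then show ?thesis
    using Poly_Mapping.keys_add[of p q] by (simp add: lookup_add distrib_right sum.distrib)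
qed

lemma lin_ext_0 [simp]: "lin_ext f 0 = 0"
  by (simp add: lin_ext_def)

lemma lin_ext_single [simp]: "lin_ext f (Poly_Mapping.single a c) = c * f a"
  by (subst lin_ext_superset[of "{a}"]) (auto simp: lookup_single)

lemma lin_ext_diff: "lin_ext f (p - q) = lin_ext f p - lin_ext f q"
  using lin_ext_add[of f "p - q" q] by simp

lemma lin_ext_uminus: "lin_ext f (- p) = - lin_ext f p"
  using lin_ext_diff[of f 0 p] by simp

lemma lin_ext_sum: "lin_ext f (\<Sum>i\<in>I. p i) = (\<Sum>i\<in>I. lin_ext f (p i))"
  by (induction I rule: infinite_finite_induct) (simp_all add: lin_ext_add)

lemma lin_ext_mult_left:
  "lin_ext f (Poly_Mapping.single a c * p) = c * lin_ext (\<lambda>w. f (a + w)) p"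
  by (induction p rule: poly_mapping_add_induct)
     (simp_all add: distrib_left lin_ext_add mult_single algebra_simps)

lemma lin_ext_mult_right:
  "lin_ext f (p * Poly_Mapping.single a c) = c * lin_ext (\<lambda>w. f (w + a)) p"
  by (induction p rule: poly_mapping_add_induct)
     (simp_all add: distrib_right lin_ext_add mult_single algebra_simps)

text \<open>
  A boundary path is an infinite path, or a finite one ending at a vertex in \<open>W\<close>, where its
  sequence takes the value \<^const>\<open>None\<close>; the entries after the first \<^const>\<open>None\<close> are junk.  The integer records the degree; without it a
  cycle without exits would act trivially on the path running around it.
\<close>

locale boundary_paths = leavitt G field_type
  for G :: "('a, 'b) pre_digraph" (structure) and field_type :: "'k::field itself" +
  fixes W :: "'a set"
  assumes W_sink: "w \<in> W \<Longrightarrow> out_arcs G w = {}"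
    and W_unique: "w \<in> W \<Longrightarrow> w' \<in> W \<Longrightarrow> w = w'"
begin

text \<open>An empty path does not record its vertex; this is why \<open>W\<close> may have at most
  one element.\<close>

definition starts_at :: "(nat \<Rightarrow> 'b option) \<Rightarrow> 'a \<Rightarrow> bool" where
  "starts_at \<alpha> v \<longleftrightarrow> (case \<alpha> 0 of None \<Rightarrow> v \<in> W | Some e \<Rightarrow> v = tail G e)"

definition boundary :: "(nat \<Rightarrow> 'b option) \<Rightarrow> bool" where
  "boundary \<alpha> \<longleftrightarrow> (\<forall>i e. \<alpha> i = Some e \<longrightarrow> e \<in> arcs G \<and> starts_at (\<lambda>j. \<alpha> (Suc (i + j))) (head G e))"

text \<open>Letters act as partial injections, so a word has a matrix of zeros and ones with at most
  one \<open>1\<close> in each row and column.\<close>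

fun act_gen :: "('a, 'b) lpa_generator \<Rightarrow> (nat \<Rightarrow> 'b option) \<times> int \<Rightarrow> ((nat \<Rightarrow> 'b option) \<times> int) option" where
  "act_gen (Vertex v) (\<alpha>, k) = (if starts_at \<alpha> v then Some (\<alpha>, k) else None)"
| "act_gen (Edge e) (\<alpha>, k) = (if starts_at \<alpha> (head G e) then Some (case_nat (Some e) \<alpha>, k + 1) else None)"
| "act_gen (Ghost e) (\<alpha>, k) = (if \<alpha> 0 = Some e then Some (\<lambda>j. \<alpha> (Suc j), k - 1) else None)"

definition act_word :: "('a, 'b) lpa_generator list \<Rightarrow> (nat \<Rightarrow> 'b option) \<times> int \<Rightarrow> ((nat \<Rightarrow> 'b option) \<times> int) option" where
  "act_word xs x = foldr (\<lambda>g r. Option.bind r (act_gen g)) xs (Some x)"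

lemma act_word_simps [simp]:
  "act_word [] x = Some x"
  "act_word (g # xs) x = Option.bind (act_word xs x) (act_gen g)"
  by (simp_all add: act_word_def)

lemma act_word_append: "act_word (xs @ ys) x = Option.bind (act_word ys x) (act_word xs)"
proof (induction xs)
  case Nil
  then show ?case by (cases "act_word ys x") auto
next
  case (Cons g xs)
  then show ?case by (cases "act_word ys x") auto
qed

lemma starts_at_unique: "starts_at \<alpha> v \<Longrightarrow> starts_at \<alpha> w \<Longrightarrow> v = w"
  using W_unique by (auto simp: starts_at_def split: option.splits)

lemma act_gen_boundary:
  assumes "boundary \<alpha>" "g \<in> gens" "act_gen g (\<alpha>, k) = Some (\<beta>, l)"
  shows "boundary \<beta>"
proof (cases g)
  case (Vertex v)
  then show ?thesis using assms by (auto split: if_splits)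
next
  case (Edge e)
  then have e: "e \<in> arcs G" "starts_at \<alpha> (head G e)" "\<beta> = case_nat (Some e) \<alpha>"
    using assms by (auto split: if_splits)
  show ?thesis
    unfolding boundary_def
  proof (intro allI impI)
    fix i f assume "\<beta> i = Some f"
    then show "f \<in> arcs G \<and> starts_at (\<lambda>j. \<beta> (Suc (i + j))) (head G f)"
      using e assms(1) unfolding boundary_def by (cases i) auto
  qed
next
  case (Ghost e)
  then have \<beta>: "\<beta> = (\<lambda>j. \<alpha> (Suc j))" using assms by (auto split: if_splits)
  show ?thesis
    unfolding boundary_def
  proof (intro allI impI)
    fix i f assume "\<beta> i = Some f"
    then have "\<alpha> (Suc i) = Some f" by (simp add: \<beta>)
    from assms(1)[unfolded boundary_def, rule_format, OF this]
    show "f \<in> arcs G \<and> starts_at (\<lambda>j. \<beta> (Suc (i + j))) (head G f)" by (simp add: \<beta>)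
  qed
qed

lemma act_word_boundary:
  assumes "boundary \<alpha>" "set xs \<subseteq> gens" "act_word xs (\<alpha>, k) = Some (\<beta>, l)"
  shows "boundary \<beta>"
  using assms(2,3)
proof (induction xs arbitrary: \<beta> l)
  case (Cons g xs)
  obtain \<gamma> j where "act_word xs (\<alpha>, k) = Some (\<gamma>, j)" "act_gen g (\<gamma>, j) = Some (\<beta>, l)"
    using Cons.prems(2) by (cases "act_word xs (\<alpha>, k)") auto
  then show ?case using Cons act_gen_boundary by auto
qed (use assms in auto)

lemma act_gen_inj:
  assumes "act_gen g x = Some z" "act_gen g y = Some z"
  shows "x = y"
proof -
  obtain \<alpha> k \<beta> l where xy: "x = (\<alpha>, k)" "y = (\<beta>, l)" by force
  show ?thesis
  proof (cases g)
    case (Edge e)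
    then have eq: "case_nat (Some e) \<alpha> = case_nat (Some e) \<beta>" and "k = l"
      using assms xy by (auto split: if_splits)
    have "\<alpha> i = \<beta> i" for i using fun_cong[OF eq, of "Suc i"] by simp
    then show ?thesis using xy \<open>k = l\<close> by auto
  next
    case (Ghost e)
    then have "\<alpha> 0 = \<beta> 0" "(\<lambda>j. \<alpha> (Suc j)) = (\<lambda>j. \<beta> (Suc j))" "k = l"
      using assms xy by (auto split: if_splits)
    then have "\<alpha> i = \<beta> i" for i using fun_cong[of "\<lambda>j. \<alpha> (Suc j)" _ "i - 1"] by (cases i) simp_all
    then show ?thesis using xy \<open>k = l\<close> by auto
  qed (use assms xy in \<open>auto split: if_splits\<close>)
qed

lemma act_word_inj: "act_word xs x = Some z \<Longrightarrow> act_word xs y = Some z \<Longrightarrow> x = y"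
proof (induction xs arbitrary: z)
  case (Cons g xs)
  then obtain a b where "act_word xs x = Some a" "act_word xs y = Some b"
    "act_gen g a = Some z" "act_gen g b = Some z"
    by (cases "act_word xs x"; cases "act_word xs y") auto
  then show ?case using act_gen_inj[of g a z b] Cons.IH by blast
qed simp

text \<open>The matrix coefficient of a word in column \<open>x\<close> and row \<open>y\<close>.
  Coefficients spare the construction of the module of formal combinations of boundary
  paths.\<close>

definition entry :: "(nat \<Rightarrow> 'b option) \<times> int \<Rightarrow> (nat \<Rightarrow> 'b option) \<times> int \<Rightarrow> ('a, 'b) lpa_generator free_word \<Rightarrow> 'k" where
  "entry x y w = (if act_word (letters w) x = Some y then 1 else 0)"

text \<open>The annihilator of the representation. Only columns at boundary paths count: on
  sequences that are not paths the relations can fail.\<close>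

definition act_kernel :: "('a, 'b, 'k) free_lpa set" where
  "act_kernel = {p \<in> carrier F. \<forall>\<alpha> k y. boundary \<alpha> \<longrightarrow> lin_ext (entry (\<alpha>, k) y) p = 0}"

text \<open>By injectivity a word on the left has at most one preimage \<open>z\<close> of
  \<open>y\<close>, so row \<open>y\<close> of the product is row \<open>z\<close> of
  \<open>p\<close>, or zero.\<close>

lemma entry_left: "lin_ext (entry x y) (q * p) = 0" if p: "\<And>z. lin_ext (entry x z) p = 0"
proof (induction q rule: poly_mapping_add_induct)
  case (add f a b)
  have "lin_ext (\<lambda>w. entry x y (a + w)) p = 0"
  proof (cases "\<exists>z. act_word (letters a) z = Some y")
    case True
    then obtain z where z: "act_word (letters a) z = Some y" by blast
    have iff: "act_word (letters a) z' = Some y \<longleftrightarrow> z' = z" for z'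
      using z act_word_inj by blast
    have "entry x y (a + w) = entry x z w" for w
      by (cases "act_word (letters w) x") (simp_all add: entry_def plus_free_word_def act_word_append iff)
    then show ?thesis using p by simp
  next
    case False
    then have no: "act_word (letters a) z \<noteq> Some y" for z by blast
    have "entry x y (a + w) = 0" for w
      by (cases "act_word (letters w) x") (simp_all add: entry_def plus_free_word_def act_word_append no)
    then show ?thesis by (simp add: lin_ext_def)
  qed
  then show ?case using add by (simp add: distrib_right lin_ext_add lin_ext_mult_left)
qed simp

text \<open>A word on the right moves the column to another boundary path or kills it, so only
  columns of \<open>p\<close> at boundary paths occur.\<close>

lemma entry_right:
  assumes p: "\<And>\<alpha> k z. boundary \<alpha> \<Longrightarrow> lin_ext (entry (\<alpha>, k) z) p = 0"
    and "boundary \<alpha>" and q: "q \<in> carrier F"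
  shows "lin_ext (entry (\<alpha>, k) y) (p * q) = 0"
proof -
  have "Poly_Mapping.keys q \<subseteq> {w. set (letters w) \<subseteq> gens}" using q by (auto simp: free_lpa_def)
  then show ?thesis
  proof (induction q rule: poly_mapping_keys_induct)
    case (add f a b)
    have "lin_ext (\<lambda>w. entry (\<alpha>, k) y (w + a)) p = 0"
    proof (cases "act_word (letters a) (\<alpha>, k)")
      case None
      then show ?thesis by (simp add: lin_ext_def entry_def plus_free_word_def act_word_append)
    next
      case (Some z)
      obtain \<beta> l where z: "z = (\<beta>, l)" by force
      have "boundary \<beta>" using act_word_boundary[OF assms(2)] add(2) Some z by blast
      moreover have "entry (\<alpha>, k) y (w + a) = entry (\<beta>, l) y w" for w
        using Some z by (simp add: entry_def plus_free_word_def act_word_append)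
      ultimately show ?thesis using p by simp
    qed
    then show ?case using add by (simp add: distrib_left lin_ext_add lin_ext_mult_right)
  qed simp
qed

lemma act_kernel_ideal: "ideal act_kernel F"
proof (rule idealI)
  show "ring F" by (rule ring_free_lpa)
  show "subgroup act_kernel (add_monoid F)"
  proof (rule F.add.subgroupI)
    show "\<ominus>\<^bsub>F\<^esub> p \<in> act_kernel" if "p \<in> act_kernel" for p
    proof -
      have p: "p \<in> carrier F" using that by (simp add: act_kernel_def)
      have "p + \<ominus>\<^bsub>F\<^esub> p = 0" using F.r_neg[OF p] by (simp add: F_simps)
      then have "\<ominus>\<^bsub>F\<^esub> p = - p" by (simp add: eq_neg_iff_add_eq_0 add.commute)
      moreover have "- p \<in> carrier F" using F_closed(3)[OF F_closed(4) p] by simp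
      ultimately show ?thesis using that by (simp add: act_kernel_def lin_ext_uminus)
    qed
    show "act_kernel \<noteq> {}" using F_closed(4) by (auto simp: act_kernel_def intro!: exI[of _ 0])
  qed (auto simp: act_kernel_def F_simps F_closed lin_ext_add)
  fix p q assume p: "p \<in> act_kernel" and q: "q \<in> carrier F"
  then have 0: "lin_ext (entry (\<alpha>, k) y) p = 0" if "boundary \<alpha>" for \<alpha> k y
    using that unfolding act_kernel_def by blast
  have pc: "p \<in> carrier F" using p by (simp add: act_kernel_def)
  show "q \<otimes>\<^bsub>F\<^esub> p \<in> act_kernel"
    unfolding F_simps act_kernel_def using F_closed(1)[OF q pc] entry_left[OF 0] by blast
  show "p \<otimes>\<^bsub>F\<^esub> q \<in> act_kernel"
    unfolding F_simps act_kernel_def using F_closed(1)[OF pc q] entry_right[OF 0 _ q] by blast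
qed

lemma lin_ext_word: "lin_ext (entry x y) (word xs) = (if act_word xs x = Some y then 1 else 0)"
  by (simp add: word_def entry_def)

lemma act_edge_ghost:
  "act_word [Edge e, Ghost e] (\<alpha>, k) = (if \<alpha> 0 = Some e \<and> starts_at (\<lambda>j. \<alpha> (Suc j)) (head G e) then Some (\<alpha>, k) else None)"
proof -
  have "case_nat (Some e) (\<lambda>j. \<alpha> (Suc j)) = \<alpha>" if "\<alpha> 0 = Some e"
    using that by (auto split: nat.split)
  then show ?thesis by simp
qed

lemma relators_act_kernel: "lpa_relators G \<subseteq> act_kernel"
proof
  fix r :: "('a, 'b, 'k) free_lpa" assume r: "r \<in> lpa_relators G"
  have pair: "gen x * gen y = word [x, y]" for x y
    using word_append[of "[x]" "[y]"] by (simp add: gen_word)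
  have "lin_ext (entry (\<alpha>, k) y) r = 0" if b: "boundary \<alpha>" for \<alpha> k y
  proof -
    have start: "starts_at (\<lambda>j. \<alpha> (Suc j)) (head G e)" if "\<alpha> 0 = Some e" for e
      using b[unfolded boundary_def, rule_format, OF that] by simp
    have start0: "starts_at \<alpha> (tail G e)" if "\<alpha> 0 = Some e" for e
      using that by (simp add: starts_at_def)
    consider (vv) v w where "r = word [Vertex v, Vertex w] - (if v = w then word [Vertex v] else 0)"
      | (se) e where "r = word [Vertex (tail G e), Edge e] - word [Edge e]"
      | (er) e where "r = word [Edge e, Vertex (head G e)] - word [Edge e]"
      | (rg) e where "r = word [Vertex (head G e), Ghost e] - word [Ghost e]"
      | (gs) e where "r = word [Ghost e, Vertex (tail G e)] - word [Ghost e]"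
      | (ge) e f where "r = word [Ghost e, Edge f] - (if e = f then word [Vertex (head G e)] else 0)"
      | (ck) v where "out_arcs G v \<noteq> {}" "r = word [Vertex v] - (\<Sum>e\<in>out_arcs G v. word [Edge e, Ghost e])"
      using r unfolding lpa_relators_def pair unfolding gen_word by blast
    then show ?thesis
    proof cases
      case vv
      then show ?thesis using starts_at_unique[of \<alpha> v w] by (auto simp: lin_ext_diff lin_ext_word)
    next
      case se
      moreover have "starts_at (case_nat (Some e) \<alpha>) (tail G e)" by (simp add: starts_at_def)
      ultimately show ?thesis by (auto simp: lin_ext_diff lin_ext_word)
    next
      case er
      then show ?thesis by (simp add: lin_ext_diff lin_ext_word)
    next
      case rg
      then show ?thesis using start[of e] by (auto simp: lin_ext_diff lin_ext_word)
    next
      case gs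
      then show ?thesis using start0[of e] by (simp add: lin_ext_diff lin_ext_word)
    next
      case ge
      then show ?thesis by (auto simp: lin_ext_diff lin_ext_word)
    next
      case ck
      have sum: "lin_ext (entry (\<alpha>, k) y) r = (if starts_at \<alpha> v \<and> (\<alpha>, k) = y then 1 else 0) -
          (\<Sum>e\<in>out_arcs G v. if \<alpha> 0 = Some e \<and> (\<alpha>, k) = y then 1 else 0)"
        unfolding ck(2) lin_ext_diff lin_ext_sum lin_ext_word act_edge_ghost
        using start by (auto intro!: arg_cong2[of _ _ _ _ "(-)"] sum.cong)
      \<comment> \<open>A nonempty path from \<open>v\<close> begins with exactly one of the edges
        leaving \<open>v\<close>, so one summand acts as \<open>v\<close> does. An empty path sits
        at a sink, which has no such relation.\<close>
      show ?thesis
      proof (cases "\<alpha> 0")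
        case None
        then have "\<not> starts_at \<alpha> v" using W_sink ck(1) by (auto simp: starts_at_def)
        then show ?thesis unfolding sum using None by simp
      next
        case (Some f)
        have f: "f \<in> arcs G" using b Some unfolding boundary_def by blast
        have "(\<Sum>e\<in>out_arcs G v. if \<alpha> 0 = Some e \<and> (\<alpha>, k) = y then 1 else (0::'k)) =
            (\<Sum>e\<in>out_arcs G v. if f = e then (if (\<alpha>, k) = y then 1 else 0) else 0)"
          using Some by (intro sum.cong) auto
        also have "\<dots> = (if f \<in> out_arcs G v \<and> (\<alpha>, k) = y then 1 else 0)" by simp
        also have "f \<in> out_arcs G v \<longleftrightarrow> starts_at \<alpha> v" using f Some by (auto simp: starts_at_def)
        finally show ?thesis unfolding sum by simp
      qed
    qed
  qed
  moreover have "r \<in> carrier F" using r lpa_relators_closed by blast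
  ultimately show "r \<in> act_kernel" by (simp add: act_kernel_def)
qed

lemma J_act_kernel: "J \<subseteq> act_kernel"
  unfolding lpa_ideal_def by (rule F.genideal_minimal[OF act_kernel_ideal relators_act_kernel])

definition matrix_entry :: "(nat \<Rightarrow> 'b option) \<times> int \<Rightarrow> (nat \<Rightarrow> 'b option) \<times> int \<Rightarrow> ('a, 'b, 'k) free_lpa set \<Rightarrow> 'k" where
  "matrix_entry x y X = lin_ext (entry x y) (SOME p. p \<in> carrier F \<and> cl p = X)"

lemma matrix_entry_cl:
  assumes "boundary \<alpha>" "p \<in> carrier F"
  shows "matrix_entry (\<alpha>, k) y (cl p) = lin_ext (entry (\<alpha>, k) y) p"
proof -
  define q where "q = (SOME q. q \<in> carrier F \<and> cl q = cl p)"
  have "q \<in> carrier F \<and> cl q = cl p" unfolding q_def by (rule someI[of _ p]) (use assms in simp)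
  then have "q - p \<in> J" using cl_eq_iff assms by blast
  then have "lin_ext (entry (\<alpha>, k) y) (q - p) = 0"
    using J_act_kernel assms(1) unfolding act_kernel_def by blast
  then show ?thesis by (simp add: matrix_entry_def q_def lin_ext_diff)
qed

lemma matrix_entry_linear:
  assumes "boundary \<alpha>" "x \<in> carrier L" "z \<in> carrier L"
  shows "matrix_entry (\<alpha>, k) y (x \<oplus>\<^bsub>L\<^esub> z) = matrix_entry (\<alpha>, k) y x + matrix_entry (\<alpha>, k) y z"
    and "matrix_entry (\<alpha>, k) y (c \<odot>\<^bsub>L\<^esub> x) = c * matrix_entry (\<alpha>, k) y x"
proof -
  obtain p q where pq: "p \<in> carrier F" "x = cl p" "q \<in> carrier F" "z = cl q"
    using assms L_elem by metis
  show "matrix_entry (\<alpha>, k) y (x \<oplus>\<^bsub>L\<^esub> z) = matrix_entry (\<alpha>, k) y x + matrix_entry (\<alpha>, k) y z"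
    using pq assms by (simp add: L_add matrix_entry_cl F_closed lin_ext_add)
  have "lin_ext (entry (\<alpha>, k) y) (Poly_Mapping.single 0 c * p) = c * lin_ext (entry (\<alpha>, k) y) p"
    by (simp add: lin_ext_mult_left)
  then show "matrix_entry (\<alpha>, k) y (c \<odot>\<^bsub>L\<^esub> x) = c * matrix_entry (\<alpha>, k) y x"
    using pq assms by (simp add: L_smult matrix_entry_cl F_closed)
qed

section \<open>Monomials and matrix coefficients dual to them\<close>

definition prepend :: "'b list \<Rightarrow> (nat \<Rightarrow> 'b option) \<Rightarrow> nat \<Rightarrow> 'b option" where
  "prepend p \<tau> i = (if i < length p then Some (p ! i) else \<tau> (i - length p))"

lemma prepend_Nil: "prepend [] \<tau> = \<tau>"
  by (rule ext) (simp add: prepend_def)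

lemma prepend_Cons: "prepend (e # p) \<tau> = case_nat (Some e) (prepend p \<tau>)"
  by (rule ext) (auto simp: prepend_def split: nat.split)

lemma act_ghosts:
  "act_word (map Ghost (rev q)) (\<alpha>, k) =
    (if \<forall>i<length q. \<alpha> i = Some (q ! i) then Some (\<lambda>j. \<alpha> (length q + j), k - int (length q)) else None)"
proof (induction q arbitrary: \<alpha> k)
  case (Cons a q)
  have "(\<forall>i<length (a # q). \<alpha> i = Some ((a # q) ! i)) \<longleftrightarrow>
      \<alpha> 0 = Some a \<and> (\<forall>i<length q. \<alpha> (Suc i) = Some (q ! i))"
    by (simp add: All_less_Suc2)
  then show ?case by (simp add: act_word_append Cons.IH algebra_simps)
qed simp

lemma act_edges:
  assumes "awalk u p z" "starts_at \<tau> z"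
  shows "act_word (map Edge p) (\<tau>, k) = Some (prepend p \<tau>, k + int (length p)) \<and>
    starts_at (prepend p \<tau>) u"
  using assms(1)
proof (induction p arbitrary: u)
  case Nil
  then show ?case using assms(2) by (simp add: awalk_simps prepend_Nil)
next
  case (Cons e p)
  then have e: "e \<in> arcs G" "tail G e = u" "awalk (head G e) p z" by (auto simp: awalk_simps)
  then show ?case
    using Cons.IH[OF e(3)] by (auto simp: prepend_Cons starts_at_def)
qed

lemma boundary_prepend:
  assumes "walk_to z p" "starts_at \<tau> z" "boundary \<tau>"
  shows "boundary (prepend p \<tau>)"
proof -
  have "act_word (map Edge p) (\<tau>, 0) = Some (prepend p \<tau>, int (length p))"
    using assms(1,2) act_edges by (auto simp: walk_to_def)
  with act_word_boundary[OF assms(3) edges_gens[OF walk_to_arcs[OF assms(1)]]] show ?thesis by blast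
qed

text \<open>The monomial of \<open>p\<close> and \<open>q\<close> sends \<open>q \<tau>\<close> to
  \<open>p \<tau>\<close>, and \<open>prefix\<close> says that no other member of \<open>Q\<close>
  can be stripped from \<open>q \<tau>\<close>. The degree separates paths \<open>p\<close> of
  different lengths that give the same \<open>p \<tau>\<close>. The bound \<open>2 * N + 1\<close>
  counts two paths and the vertex between them.\<close>

lemma growth_ge_product:
  assumes \<tau>: "boundary \<tau>" "starts_at \<tau> z"
    and PQ: "P \<subseteq> walks_upto N z" "Q \<subseteq> walks_upto N z"
    and prefix: "\<And>q q'. q \<in> Q \<Longrightarrow> q' \<in> Q \<Longrightarrow> (\<forall>i<length q'. prepend q \<tau> i = Some (q' ! i)) \<Longrightarrow>
      starts_at (\<lambda>j. prepend q \<tau> (length q' + j)) z \<Longrightarrow> q' = q"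
    and n: "2 * N + 1 \<le> n"
  shows "card P * card Q \<le> growth K L generating_space n"
proof -
  define \<psi> where "\<psi> = (\<lambda>(p, q). matrix_entry (prepend q \<tau>, 0) (prepend p \<tau>, int (length p) - int (length q)))"
  define b where "b = (\<lambda>(p, q). monomial p z q)"
  have fin: "finite (P \<times> Q)" using PQ finite_walks_upto finite_subset by blast
  have walk: "walk_to z p" "length p \<le> N" if "p \<in> P \<or> p \<in> Q" for p
    using that PQ by (auto simp: walks_upto_def)
  have bound: "boundary (prepend q \<tau>)" if "q \<in> Q" for q
    using boundary_prepend walk that \<tau> by blast
  have "card (P \<times> Q) \<le> growth K L generating_space n"
  proof (rule growth_lower[OF fin, of b _ \<psi>])
    fix t assume t: "t \<in> P \<times> Q"
    then obtain p q where pq: "t = (p, q)" "p \<in> P" "q \<in> Q" by auto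
    show "b t \<noteq> [] \<and> set (b t) \<subseteq> gens \<and> length (b t) \<le> n"
      using monomial_gens[of z p q] walk[of p] walk[of q] pq n
      by (auto simp: b_def monomial_def)
    show "\<psi> t (x \<oplus>\<^bsub>L\<^esub> y) = \<psi> t x + \<psi> t y" if "x \<in> carrier L" "y \<in> carrier L" for x y
      using matrix_entry_linear(1)[OF bound[OF pq(3)] that] by (simp add: \<psi>_def pq)
    show "\<psi> t (c \<odot>\<^bsub>L\<^esub> x) = c * \<psi> t x" if "x \<in> carrier L" for c x
      using matrix_entry_linear(2)[OF bound[OF pq(3)] that that] by (simp add: \<psi>_def pq)
    fix s assume s: "s \<in> P \<times> Q"
    then obtain p' q' where pq': "s = (p', q')" "p' \<in> P" "q' \<in> Q" by auto
    have word: "word (monomial p' z q') \<in> carrier F"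
      using monomial_gens walk pq' by (simp add: word_carrier)
    have target: "prepend p' \<tau> = prepend p \<tau> \<and> length p' = length p \<longleftrightarrow> p' = p"
      by (auto simp: prepend_def fun_eq_iff intro!: nth_equalityI split: if_splits)
    have "act_word (monomial p' z q') (prepend q \<tau>, 0) =
        (if q' = q then Some (prepend p' \<tau>, int (length p') - int (length q)) else None)"
    proof (cases "(\<forall>i<length q'. prepend q \<tau> i = Some (q' ! i)) \<and>
        starts_at (\<lambda>j. prepend q \<tau> (length q' + j)) z")
      case True
      then have "q' = q" using prefix pq pq' by blast
      moreover have "(\<lambda>j. prepend q \<tau> (length q + j)) = \<tau>" by (rule ext) (simp add: prepend_def)
      moreover obtain u where "awalk u p' z" using walk pq' by (auto simp: walk_to_def)
      ultimately show ?thesis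
        using act_edges[of u p' z \<tau> "- int (length q)"] \<tau>(2) True
        by (simp add: monomial_def act_word_append act_ghosts)
    next
      case False
      moreover have "q' \<noteq> q"
        using False \<tau>(2) by (auto simp: prepend_def)
      ultimately show ?thesis
        by (auto simp: monomial_def act_word_append act_ghosts)
    qed
    then have "\<psi> t (wd (b s)) = (if q' = q \<and> p' = p then 1 else 0)"
      using matrix_entry_cl[OF bound[OF pq(3)] word] target
      by (auto simp: \<psi>_def b_def pq pq' wd_def lin_ext_word)
    then show "\<psi> t (wd (b s)) = (if s = t then 1 else 0)" using pq pq' by auto
  qed
  then show ?thesis by (simp add: card_cartesian_product)
qed

end

context fin_digraph
begin

text \<open>Walks meeting \<open>u\<close> only at their end. If \<open>\<tau>\<close> runs around a
  cycle \<open>c\<close>, both \<open>q\<close> and \<open>q c\<close> can be stripped from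
  \<open>q \<tau>\<close>, so the second factor of \<open>growth_ge_product\<close> has to be
  restricted.\<close>

definition first_arrivals :: "nat \<Rightarrow> 'a \<Rightarrow> 'b list set" where
  "first_arrivals n u = {p \<in> walks_upto n u. \<forall>e\<in>set p. tail G e \<noteq> u}"

end

context leavitt
begin

text \<open>With \<open>\<tau>\<close> the empty path at \<open>w\<close>, the end of
  \<open>q \<tau>\<close> shows where \<open>q\<close> ends, as no edge leaves a sink. So both
  factors may consist of all walks.\<close>

lemma growth_ge_sink:
  assumes "w \<in> sinks" "2 * N + 1 \<le> n"
  shows "card (walks_upto N w) * card (walks_upto N w) \<le> growth K L generating_space n"
proof -
  interpret boundary_paths G field_type "{w}"
    using assms(1) by unfold_locales (auto simp: sinks_def)
  have out: "out_arcs G w = {}" using assms(1) by (simp add: sinks_def)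
  show ?thesis
  proof (rule growth_ge_product[where \<tau> = "\<lambda>_. None"])
    show "boundary (\<lambda>_. None)" "starts_at (\<lambda>_. None) w"
      by (simp_all add: boundary_def starts_at_def)
    fix q q' assume q: "q \<in> walks_upto N w" "q' \<in> walks_upto N w"
      and pre: "\<forall>i<length q'. prepend q (\<lambda>_. None) i = Some (q' ! i)"
      and st: "starts_at (\<lambda>j. prepend q (\<lambda>_. None) (length q' + j)) w"
    have len: "length q' \<le> length q"
      using pre by (rule_tac ccontr) (force simp: prepend_def not_le)
    have "length q' = length q"
    proof (rule ccontr)
      assume "length q' \<noteq> length q"
      then have lt: "length q' < length q" using len by simp
      then have "tail G (q ! length q') = w" using st by (simp add: starts_at_def prepend_def)
      moreover have "q ! length q' \<in> arcs G"
        using q(1) lt walk_to_arcs nth_mem unfolding walks_upto_def by blast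
      ultimately show False using out by auto
    qed
    then show "q' = q" using pre by (auto simp: prepend_def intro!: nth_equalityI)
  qed (use assms in auto)
qed

text \<open>Any infinite path from \<open>u\<close> can serve as \<open>\<tau>\<close>; here it
  keeps to vertices on cycles. A first arrival \<open>q\<close> ends where \<open>q \<tau>\<close>
  visits \<open>u\<close> for the first time.\<close>

lemma growth_ge_cycle:
  assumes "u \<in> cyclic_verts" "2 * N + 1 \<le> n"
  shows "card (walks_upto N u) * card (first_arrivals N u) \<le> growth K L generating_space n"
proof -
  interpret boundary_paths G field_type "{}" by unfold_locales auto
  have "\<exists>e. e \<in> out_arcs G v \<and> head G e \<in> cyclic_verts" if v: "v \<in> cyclic_verts" for v
  proof -
    obtain e where e: "e \<in> out_arcs G v" "head G e \<rightarrow>\<^sup>* v"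
      using v reachable_head unfolding cyclic_verts_def by blast
    then have "v \<rightarrow>\<^sup>* head G e" using arc_reachable by auto
    then show ?thesis using mutually_reachable_cyclic[OF v] e by blast
  qed
  then obtain f where f: "\<And>v. v \<in> cyclic_verts \<Longrightarrow> f v \<in> out_arcs G v"
    "\<And>v. v \<in> cyclic_verts \<Longrightarrow> head G (f v) \<in> cyclic_verts" by metis
  define x where "x i = ((\<lambda>v. head G (f v)) ^^ i) u" for i
  have x: "x i \<in> cyclic_verts" for i
    unfolding x_def by (induction i) (use assms(1) f in auto)
  define \<tau> where "\<tau> i = Some (f (x i))" for i
  have \<tau>_start: "starts_at \<tau> u"
    using f(1)[OF x[of 0]] by (simp add: starts_at_def \<tau>_def x_def)
  show ?thesis
  proof (rule growth_ge_product[where \<tau> = \<tau>])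
    show "boundary \<tau>"
      unfolding boundary_def
    proof (intro allI impI)
      fix i e assume "\<tau> i = Some e"
      then have e: "e = f (x i)" by (simp add: \<tau>_def)
      have "tail G (f (x (Suc i))) = x (Suc i)" using f(1)[OF x[of "Suc i"]] by simp
      moreover have "x (Suc i) = head G (f (x i))" by (simp add: x_def)
      ultimately show "e \<in> arcs G \<and> starts_at (\<lambda>j. \<tau> (Suc (i + j))) (head G e)"
        using f(1)[OF x[of i]] e by (simp add: starts_at_def \<tau>_def)
    qed
    show "starts_at \<tau> u" by (rule \<tau>_start)
    show "first_arrivals N u \<subseteq> walks_upto N u" by (auto simp: first_arrivals_def)
    fix q q' assume q: "q \<in> first_arrivals N u" "q' \<in> first_arrivals N u"
      and pre: "\<forall>i<length q'. prepend q \<tau> i = Some (q' ! i)"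
      and st: "starts_at (\<lambda>j. prepend q \<tau> (length q' + j)) u"
    have "length q' = length q"
    proof (rule ccontr)
      assume "length q' \<noteq> length q"
      then consider "length q' < length q" | "length q < length q'" by linarith
      then show False
      proof cases
        case 1
        then have "tail G (q ! length q') = u" using st by (simp add: starts_at_def prepend_def)
        with q(1) 1 show False using nth_mem[OF 1] unfolding first_arrivals_def by blast
      next
        case 2
        then have "\<tau> 0 = Some (q' ! length q)" using pre by (auto simp: prepend_def)
        then have "tail G (q' ! length q) = u" using \<tau>_start by (simp add: starts_at_def)
        with q(2) 2 show False using nth_mem[OF 2] unfolding first_arrivals_def by blast
      qed
    qed
    then show "q' = q" using pre by (auto simp: prepend_def intro!: nth_equalityI)
  qed (use assms in auto)
qed

end

section \<open>Counting walks\<close>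

lemma div_shift:
  assumes "m * Suc l \<le> (n::nat)" "0 < m"
  shows "n div (m * Suc l) \<le> (n - l) div m"
proof -
  have "n div (m * Suc l) * (m * Suc l) \<le> n" by (rule div_times_less_eq_dividend)
  moreover have "1 \<le> n div (m * Suc l)" using assms by (simp add: less_eq_div_iff_mult_less_eq)
  ultimately have "n div (m * Suc l) * m + l \<le> n"
  proof -
    let ?d = "n div (m * Suc l)"
    have "?d * m * l \<ge> 1 * 1 * l" using \<open>1 \<le> ?d\<close> assms(2) by (intro mult_le_mono) auto
    then have "?d * m + l \<le> ?d * (m * Suc l)" by (simp add: algebra_simps)
    also have "\<dots> \<le> n" by (rule div_times_less_eq_dividend)
    finally show ?thesis .
  qed
  then have "n div (m * Suc l) * m \<le> n - l" by simp
  then show ?thesis using assms(2) by (simp add: less_eq_div_iff_mult_less_eq)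
qed

text \<open>Lower bounds have the form \<open>(n div m) ^ i\<close>, so that prolonging walks by
  \<open>l\<close> edges only changes \<open>m\<close>. Below \<open>m * Suc l\<close> the left side
  is \<open>0\<close>, the exponent being positive.\<close>

lemma power_div_shift:
  assumes "\<And>n. (n div m) ^ Suc i \<le> f n" "0 < m" "\<And>n. f n \<le> g (n + l)"
  shows "(n div (m * Suc l)) ^ Suc i \<le> (g n :: nat)"
proof (cases "m * Suc l \<le> n")
  case True
  then have "l \<le> n" using assms(2) by (cases m) auto
  have "(n div (m * Suc l)) ^ Suc i \<le> ((n - l) div m) ^ Suc i"
    by (intro power_mono div_shift True assms(2)) simp
  also have "\<dots> \<le> f (n - l)" by (rule assms(1))
  also have "\<dots> \<le> g n" using assms(3)[of "n - l"] \<open>l \<le> n\<close> by simp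
  finally show ?thesis .
qed simp

context fin_digraph
begin

abbreviation corank :: "'a \<Rightarrow> nat" where
  "corank \<equiv> chain_rank (\<lambda>a b. b \<rightarrow>\<^sup>* a) cyclic_verts"

sublocale corank: preorder_on_finite "\<lambda>a b. b \<rightarrow>\<^sup>* a" cyclic_verts
  by (rule preorder_coreachable[OF cyclic_verts_subset])

lemma card_walks_append:
  assumes "awalk u g w"
  shows "card (walks_upto n u) \<le> card (walks_upto (n + length g) w)"
proof (rule card_inj_on_le[OF _ _ finite_walks_upto])
  show "inj_on (\<lambda>p. p @ g) (walks_upto n u)" by (auto simp: inj_on_def)
  show "(\<lambda>p. p @ g) ` walks_upto n u \<subseteq> walks_upto (n + length g) w"
    using assms by (auto simp: walks_upto_def walk_to_def intro: awalk_appendI)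
qed

lemma tail_in_walk_reaches: "walk_to w p \<Longrightarrow> e \<in> set p \<Longrightarrow> tail G e \<rightarrow>\<^sup>* w"
proof (induction p)
  case (Cons f p)
  then have f: "f \<in> arcs G" "awalk (head G f) p w" by (auto simp: walk_to_Cons)
  then have "tail G f \<rightarrow>\<^sup>* w" using arc_reachable reachable_awalkI reachable_trans by blast
  then show ?case using Cons f by (auto simp: walk_to_def)
qed simp

text \<open>Append a simple path \<open>g\<close> from \<open>u'\<close> to \<open>u\<close>. Its
  edges do not start at \<open>u\<close>, and those of a walk ending at \<open>u'\<close> cannot
  either, since \<open>u\<close> does not reach \<open>u'\<close>.\<close>

lemma card_first_arrivals_append:
  assumes "u' \<rightarrow>\<^sup>* u" "\<not> u \<rightarrow>\<^sup>* u'"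
  obtains l where "\<And>n. card (walks_upto n u') \<le> card (first_arrivals (n + l) u)"
proof -
  obtain g where g: "apath u' g u" using assms(1) reachable_apath by blast
  then have walk: "awalk u' g u" and "distinct (map (tail G) g @ [u])"
    by (auto simp: apath_def awalk_tails)
  from this(2) have tails: "\<forall>e\<in>set g. tail G e \<noteq> u" by auto
  have "card (walks_upto n u') \<le> card (first_arrivals (n + length g) u)" for n
  proof (rule card_inj_on_le)
    show "inj_on (\<lambda>p. p @ g) (walks_upto n u')" by (auto simp: inj_on_def)
    show "(\<lambda>p. p @ g) ` walks_upto n u' \<subseteq> first_arrivals (n + length g) u"
    proof
      fix x assume "x \<in> (\<lambda>p. p @ g) ` walks_upto n u'"
      then obtain p where p: "x = p @ g" "walk_to u' p" "length p \<le> n" by (auto simp: walks_upto_def)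
      have "walk_to u x" using p walk by (auto simp: walk_to_def intro: awalk_appendI)
      moreover have "tail G e \<noteq> u" if "e \<in> set p" for e
        using tail_in_walk_reaches[OF p(2) that] assms(2) by blast
      ultimately show "x \<in> first_arrivals (n + length g) u"
        using p tails by (auto simp: walks_upto_def first_arrivals_def)
    qed
    show "finite (first_arrivals (n + length g) u)"
      by (rule finite_subset[OF _ finite_walks_upto]) (auto simp: first_arrivals_def)
  qed
  then show thesis by (rule that)
qed

lemma awalk_replicate: "awalk u c u \<Longrightarrow> awalk u (concat (replicate k c)) u"
  by (induction k) (auto simp: awalk_simps intro: awalk_appendI)

text \<open>Follow a first arrival by fewer than \<open>k\<close> rounds. The arrival is recovered
  by cutting at the first visit to \<open>u\<close>, the number of rounds from the length.\<close>

lemma card_walks_around_cycle: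
  assumes "u \<in> cyclic_verts"
  obtains l where "0 < l" "\<And>n k. k * card (first_arrivals n u) \<le> card (walks_upto (n + k * l) u)"
proof -
  obtain c where c: "awalk u c u" "c \<noteq> []" using assms by (auto simp: cyclic_verts_def reachable1_awalk)
  then have hd: "tail G (hd c) = u" by (cases c) (auto simp: awalk_simps)
  define f where "f = (\<lambda>(q, k). q @ concat (replicate k c))"
  have first: "takeWhile (\<lambda>e. tail G e \<noteq> u) (q @ concat (replicate k c)) = q"
    if "\<forall>e\<in>set q. tail G e \<noteq> u" for q k
  proof (cases k)
    case (Suc j)
    have "takeWhile (\<lambda>e. tail G e \<noteq> u) (c @ concat (replicate j c)) = []"
      using c(2) hd by (cases c) auto
    then show ?thesis using that Suc by (subst takeWhile_append2) auto
  qed (use that in auto)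
  have len: "length (concat (replicate k c)) = k * length c" for k by (induction k) auto
  show thesis
  proof (rule that[of "length c"])
    fix n k
    have "card (first_arrivals n u \<times> {..<k}) \<le> card (walks_upto (n + k * length c) u)"
    proof (rule card_inj_on_le[OF _ _ finite_walks_upto])
      show "inj_on f (first_arrivals n u \<times> {..<k})"
      proof (rule inj_onI)
        fix x y assume "x \<in> first_arrivals n u \<times> {..<k}" "y \<in> first_arrivals n u \<times> {..<k}" "f x = f y"
        then obtain q i q' j where xy: "x = (q, i)" "y = (q', j)"
          and q: "\<forall>e\<in>set q. tail G e \<noteq> u" "\<forall>e\<in>set q'. tail G e \<noteq> u"
          and eq: "q @ concat (replicate i c) = q' @ concat (replicate j c)"
          by (auto simp: f_def first_arrivals_def)
        have "q = q'" using first[OF q(1), of i] first[OF q(2), of j] eq by simp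
        moreover have "i * length c = j * length c" using eq \<open>q = q'\<close> len by (metis same_append_eq)
        then have "i = j" using c(2) by simp
        ultimately show "x = y" using xy by simp
      qed
      show "f ` (first_arrivals n u \<times> {..<k}) \<subseteq> walks_upto (n + k * length c) u"
      proof
        fix x assume "x \<in> f ` (first_arrivals n u \<times> {..<k})"
        then obtain q j where x: "x = q @ concat (replicate j c)" "q \<in> walks_upto n u" "j < k"
          by (auto simp: f_def first_arrivals_def)
        have "j * length c \<le> k * length c" using x(3) by simp
        moreover have "length q \<le> n" using x(2) by (simp add: walks_upto_def)
        moreover have "length x = length q + j * length c" by (simp add: x(1) len)
        ultimately have "length x \<le> n + k * length c" by linarith
        moreover have "walk_to u x"
          using x(1,2) awalk_replicate[OF c(1)] by (auto simp: walks_upto_def walk_to_def intro: awalk_appendI)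
        ultimately show "x \<in> walks_upto (n + k * length c) u" by (simp add: walks_upto_def)
      qed
    qed
    then show "k * card (first_arrivals n u) \<le> card (walks_upto (n + k * length c) u)"
      by (simp add: card_cartesian_product mult.commute)
  qed (use c in simp)
qed

lemma card_walks_mono: "m \<le> n \<Longrightarrow> card (walks_upto m u) \<le> card (walks_upto n u)"
  by (rule card_mono[OF finite_walks_upto]) (auto simp: walks_upto_def)

text \<open>The two bounds support each other: walks to the preceding cycle of a longest chain yield
  first arrivals at \<open>u\<close>, and rounds at \<open>u\<close> gain one more power. The empty
  walk starts the induction.\<close>

lemma walks_lower_bound:
  assumes "u \<in> cyclic_verts" "corank u = Suc i"
  shows "\<exists>m>0. \<forall>n. (n div m) ^ Suc i \<le> card (walks_upto n u) \<and>
    (n div m) ^ i \<le> card (first_arrivals n u)"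
  using assms
proof (induction i arbitrary: u)
  have walks: "\<exists>m'>0. \<forall>n. (n div m') ^ Suc i \<le> card (walks_upto n u) \<and>
      (n div m') ^ i \<le> card (first_arrivals n u)"
    if u: "u \<in> cyclic_verts" and m: "0 < m" "\<And>n. (n div m) ^ i \<le> card (first_arrivals n u)" for u m i
  proof -
    obtain l where l: "0 < l" "\<And>n k. k * card (first_arrivals n u) \<le> card (walks_upto (n + k * l) u)"
      using card_walks_around_cycle[OF u] by blast
    \<comment> \<open>Half of the length goes to the first arrival and half to rounds of length
      \<open>l\<close>.\<close>
    define m' where "m' = 2 * m * l"
    have le: "n div m' \<le> n div 2 div m" "n div m' \<le> n div (2 * l)" "n div m' \<le> n div m" for n
    proof -
      have "2 * m \<le> m'" "2 * l \<le> m'" "m \<le> m'" using m(1) l(1) by (auto simp: m'_def)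
      then show "n div m' \<le> n div 2 div m" "n div m' \<le> n div (2 * l)" "n div m' \<le> n div m"
        using m(1) l(1) by (auto simp: div_mult2_eq[symmetric] intro: div_le_mono2)
    qed
    have "(n div m') ^ Suc i \<le> card (walks_upto n u)" for n
    proof -
      have "(n div m') * (n div m') ^ i \<le> (n div (2 * l)) * (n div 2 div m) ^ i"
        using le by (intro mult_le_mono power_mono) auto
      also have "\<dots> \<le> (n div (2 * l)) * card (first_arrivals (n div 2) u)"
        using m(2) by (intro mult_le_mono) auto
      also have "\<dots> \<le> card (walks_upto (n div 2 + n div (2 * l) * l) u)" by (rule l(2))
      also have "\<dots> \<le> card (walks_upto n u)"
      proof (rule card_walks_mono)
        have "n div (2 * l) * l \<le> n div 2" by (simp add: div_mult2_eq)
        then show "n div 2 + n div (2 * l) * l \<le> n" by linarith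
      qed
      finally show ?thesis by simp
    qed
    moreover have "(n div m') ^ i \<le> card (first_arrivals n u)" for n
      using power_mono[OF le(3)[of n], of i] m(2)[of n] by simp
    moreover have "0 < m'" using m(1) l(1) by (simp add: m'_def)
    ultimately show ?thesis by blast
  qed
  {
    case 0
    have "[] \<in> first_arrivals n u" for n
      using 0(1) cyclic_verts_subset by (auto simp: first_arrivals_def walks_upto_def)
    moreover have "finite (first_arrivals n u)" for n
      by (rule finite_subset[OF _ finite_walks_upto]) (auto simp: first_arrivals_def)
    ultimately have "(n div 1) ^ 0 \<le> card (first_arrivals n u)" for n
      by (simp add: Suc_le_eq card_gt_0_iff) blast
    then show ?case by (intro walks[OF 0(1), of 1]) auto
  next
    case (Suc i)
    obtain v where v: "v \<rightarrow>\<^sup>* u"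
      "Suc i \<noteq> 0 \<Longrightarrow> \<exists>u'\<in>cyclic_verts. u' \<rightarrow>\<^sup>* v \<and> \<not> v \<rightarrow>\<^sup>* u' \<and> corank u' = Suc i"
      using corank.chain_rank_step[OF Suc.prems(2)] by metis
    from v(2)[OF nat.distinct(2)] obtain u' where u': "u' \<in> cyclic_verts" "corank u' = Suc i" "u' \<rightarrow>\<^sup>* v" "\<not> v \<rightarrow>\<^sup>* u'" by blast
    obtain m where m: "0 < m" "\<And>n. (n div m) ^ Suc i \<le> card (walks_upto n u')"
      using Suc.IH[OF u'(1,2)] by blast
    have "u' \<rightarrow>\<^sup>* u" "\<not> u \<rightarrow>\<^sup>* u'" using u' v(1) reachable_trans by blast+
    then obtain l where l: "\<And>n. card (walks_upto n u') \<le> card (first_arrivals (n + l) u)"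
      using card_first_arrivals_append by blast
    have "(n div (m * Suc l)) ^ Suc i \<le> card (first_arrivals n u)" for n
      by (rule power_div_shift[where f = "\<lambda>n. card (walks_upto n u')" and g = "\<lambda>n. card (first_arrivals n u)",
            OF m(2) m(1) l])
    then show ?case using m(1) by (intro walks[OF Suc.prems(1), of "m * Suc l"]) auto
  }
qed

section \<open>Upper bounds for the number of walks\<close>

definition entering :: "'a \<Rightarrow> 'b set" where
  "entering w = {e \<in> in_arcs G w. \<not> w \<rightarrow>\<^sup>* tail G e}"

text \<open>Walks that do not move within the class of \<open>w\<close>: if not empty, they arrive
  there with their last edge.\<close>

definition entering_walks :: "nat \<Rightarrow> 'a \<Rightarrow> 'b list set" where
  "entering_walks n w = {p. p = [] \<or> (\<exists>e q. e \<in> entering w \<and> p = q @ [e])} \<inter> walks_upto n w"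

lemma finite_entering: "finite (entering w)"
  by (rule finite_subset[OF _ finite_in_arcs[of w]]) (auto simp: entering_def)

lemma entering_tail:
  assumes "e \<in> entering w"
  shows "tail G e \<rightarrow>\<^sup>* w" "\<not> w \<rightarrow>\<^sup>* tail G e" "tail G e \<in> verts G"
  using assms arc_reachable[of e] by (auto simp: entering_def)

lemma card_entering_walks:
  "card (entering_walks n w) \<le> 1 + (\<Sum>e\<in>entering w. card (walks_upto n (tail G e)))"
proof -
  have "entering_walks n w \<subseteq> {[]} \<union> (\<Union>e\<in>entering w. (\<lambda>q. q @ [e]) ` walks_upto n (tail G e))"
    by (auto simp: entering_walks_def walks_upto_def walk_to_snoc)
  then have "card (entering_walks n w) \<le>
      card ({[]} \<union> (\<Union>e\<in>entering w. (\<lambda>q. q @ [e]) ` walks_upto n (tail G e)))"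
    using finite_entering finite_walks_upto by (intro card_mono) auto
  also have "\<dots> \<le> card {[] :: 'b list} + card (\<Union>e\<in>entering w. (\<lambda>q. q @ [e]) ` walks_upto n (tail G e))"
    by (rule card_Un_le)
  also have "card (\<Union>e\<in>entering w. (\<lambda>q. q @ [e]) ` walks_upto n (tail G e)) \<le>
      (\<Sum>e\<in>entering w. card ((\<lambda>q. q @ [e]) ` walks_upto n (tail G e)))"
    by (rule card_UN_le[OF finite_entering])
  also have "\<dots> \<le> (\<Sum>e\<in>entering w. card (walks_upto n (tail G e)))"
    by (intro sum_mono card_image_le finite_walks_upto)
  finally show ?thesis by simp
qed

lemma entering_walks_bound:
  assumes "\<And>e. e \<in> entering w \<Longrightarrow> \<exists>K. \<forall>n. card (walks_upto n (tail G e)) \<le> K * Suc n ^ corank (tail G e)"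
    and "\<And>e. e \<in> entering w \<Longrightarrow> corank (tail G e) \<le> c"
  shows "\<exists>K. \<forall>n. card (entering_walks n w) \<le> K * Suc n ^ c"
proof -
  obtain K where K: "\<And>e n. e \<in> entering w \<Longrightarrow> card (walks_upto n (tail G e)) \<le> K e * Suc n ^ corank (tail G e)"
    using assms(1) by metis
  have "card (entering_walks n w) \<le> (1 + (\<Sum>e\<in>entering w. K e)) * Suc n ^ c" for n
  proof -
    have "card (walks_upto n (tail G e)) \<le> K e * Suc n ^ c" if e: "e \<in> entering w" for e
    proof -
      have "Suc n ^ corank (tail G e) \<le> Suc n ^ c"
        using assms(2)[OF e] by (intro power_increasing) auto
      from order_trans[OF K[OF e] mult_le_mono2[OF this]] show ?thesis .
    qed
    then have "(\<Sum>e\<in>entering w. card (walks_upto n (tail G e))) \<le> (\<Sum>e\<in>entering w. K e) * Suc n ^ c"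
      by (simp add: sum_distrib_right sum_mono)
    moreover have "1 \<le> Suc n ^ c" by simp
    ultimately show ?thesis using card_entering_walks[of n w] unfolding distrib_right mult_1 by linarith
  qed
  then show ?thesis by blast
qed

end

context disjoint_cycles_digraph
begin

text \<open>Off the cycles every walk is an entering walk. On a cycle the entering walks come from
  vertices of smaller corank, and every other walk ends with the unique edge of the class into its
  endpoint. Removing that edge gives a recursion in the length whose summation adds one
  power.\<close>

lemma walks_upper_bound:
  assumes "w \<in> verts G"
  shows "\<exists>K. \<forall>n. card (walks_upto n w) \<le> K * Suc n ^ corank w"
  using assms
proof (induction rule: coreachable_less_induct)
  case (less w)
  have ent: "\<exists>K. \<forall>n. card (entering_walks n v) \<le> K * Suc n ^ c"
    if v: "v \<rightarrow>\<^sup>* w" "w \<rightarrow>\<^sup>* v" and c: "\<And>e. e \<in> entering v \<Longrightarrow> corank (tail G e) \<le> c" for v c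
  proof (rule entering_walks_bound[OF _ c])
    fix e assume e: "e \<in> entering v"
    have "tail G e \<rightarrow>\<^sup>* w" "\<not> w \<rightarrow>\<^sup>* tail G e"
      using entering_tail[OF e] v reachable_trans by blast+
    then show "\<exists>K. \<forall>n. card (walks_upto n (tail G e)) \<le> K * Suc n ^ corank (tail G e)"
      by (rule less.IH)
  qed
  show ?case
  proof (cases "w \<in> cyclic_verts")
    case False
    have "walks_upto n w \<subseteq> entering_walks n w" for n
    proof
      fix p assume p: "p \<in> walks_upto n w"
      show "p \<in> entering_walks n w"
      proof (cases p rule: rev_cases)
        case (snoc q e)
        then have e: "e \<in> arcs G" "head G e = w" using p by (auto simp: walks_upto_def walk_to_snoc)
        have "\<not> w \<rightarrow>\<^sup>* tail G e"
        proof
          assume returns: "w \<rightarrow>\<^sup>* tail G e"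
          then have "tail G e \<in> cyclic_verts" using cyclic_if_arc_back e by blast
          then show False using mutually_reachable_cyclic[of "tail G e" w] returns arc_reachable e False by blast
        qed
        then show ?thesis using snoc e p by (auto simp: entering_walks_def entering_def)
      qed (use p in \<open>simp add: entering_walks_def\<close>)
    qed
    then have "card (walks_upto n w) \<le> card (entering_walks n w)" for n
      by (intro card_mono finite_subset[OF _ finite_walks_upto[of n w]]) (auto simp: entering_walks_def)
    moreover have "w \<rightarrow>\<^sup>* w" using less.hyps by auto
    then have "\<exists>K. \<forall>n. card (entering_walks n w) \<le> K * Suc n ^ corank w"
      by (intro ent corank.chain_rank_mono entering_tail)
    ultimately show ?thesis by (meson le_trans)
  next
    case True
    define S where "S = {v. v \<rightarrow>\<^sup>* w \<and> w \<rightarrow>\<^sup>* v}"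
    define c where "c = corank w - 1"
    have c: "corank w = Suc c" using corank.chain_rank_pos[OF True] by (simp add: c_def)
    have wS: "w \<in> S" using less.hyps by (simp add: S_def)
    have "\<exists>K. \<forall>n. card (entering_walks n v) \<le> K * Suc n ^ c" if v: "v \<in> S" for v
    proof (rule ent)
      show "v \<rightarrow>\<^sup>* w" "w \<rightarrow>\<^sup>* v" using v by (auto simp: S_def)
      fix e assume e: "e \<in> entering v"
      have "tail G e \<rightarrow>\<^sup>* w" "\<not> w \<rightarrow>\<^sup>* tail G e"
        using entering_tail[OF e] v reachable_trans unfolding S_def by blast+
      from corank.chain_rank_less[OF True this] show "corank (tail G e) \<le> c" using c by simp
    qed
    then obtain K where K: "\<And>v n. v \<in> S \<Longrightarrow> card (entering_walks n v) \<le> K v * Suc n ^ c" by metis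
    have finS: "finite S" by (rule finite_subset[OF _ finite_verts]) (auto simp: S_def reachable_in_verts)
    define M where "M = (\<Sum>v\<in>S. K v)"
    have M: "card (entering_walks n v) \<le> M * Suc n ^ c" if "v \<in> S" for n v
    proof -
      have "K v \<le> M" unfolding M_def using finS that by (intro member_le_sum) auto
      then show ?thesis using K[OF that, of n] by (meson le_trans mult_le_mono1)
    qed
    \<comment> \<open>Stated for the whole class with one constant, because removing the last edge
      moves the endpoint around the cycle.\<close>
    have "card (walks_upto n v) \<le> M * Suc n ^ Suc c" if "v \<in> S" for n v
      using that
    proof (induction n arbitrary: v)
      case 0
      have "walks_upto 0 v = entering_walks 0 v" by (auto simp: entering_walks_def walks_upto_def)
      then show ?case using M[OF 0, of 0] by simp
    next
      case (Suc n)
      have v: "v \<in> cyclic_verts" using Suc.prems mutually_reachable_cyclic[OF True] by (auto simp: S_def)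
      obtain e where e: "e \<in> in_arcs G v" "v \<rightarrow>\<^sup>* tail G e"
        using v reachable_tail unfolding cyclic_verts_def by blast
      have "tail G e \<rightarrow>\<^sup>* v" using arc_reachable[of e] e(1) by auto
      then have te: "tail G e \<in> S"
        using Suc.prems e(2) by (auto simp: S_def intro: reachable_trans)
      have "walks_upto (Suc n) v \<subseteq> entering_walks (Suc n) v \<union> (\<lambda>q. q @ [e]) ` walks_upto n (tail G e)"
      proof
        fix p assume p: "p \<in> walks_upto (Suc n) v"
        show "p \<in> entering_walks (Suc n) v \<union> (\<lambda>q. q @ [e]) ` walks_upto n (tail G e)"
        proof (cases p rule: rev_cases)
          case (snoc q f)
          then have f: "f \<in> arcs G" "head G f = v" "walk_to (tail G f) q"
            using p by (auto simp: walks_upto_def walk_to_snoc)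
          show ?thesis
          proof (cases "v \<rightarrow>\<^sup>* tail G f")
            case True
            then have "f = e" using unique_arc_from_back[of f e] f e by auto
            then show ?thesis using snoc p f by (auto simp: walks_upto_def)
          next
            case False
            then show ?thesis using snoc p f by (auto simp: entering_walks_def entering_def)
          qed
        qed (use p in \<open>simp add: entering_walks_def\<close>)
      qed
      then have "card (walks_upto (Suc n) v) \<le>
          card (entering_walks (Suc n) v \<union> (\<lambda>q. q @ [e]) ` walks_upto n (tail G e))"
        by (intro card_mono finite_UnI finite_imageI finite_walks_upto
            finite_subset[OF _ finite_walks_upto[of "Suc n" v]]) (auto simp: entering_walks_def)
      also have "\<dots> \<le> card (entering_walks (Suc n) v) + card ((\<lambda>q. q @ [e]) ` walks_upto n (tail G e))"
        by (rule card_Un_le)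
      also have "\<dots> \<le> M * Suc (Suc n) ^ c + M * Suc n ^ Suc c"
        using M[OF Suc.prems, of "Suc n"] Suc.IH[OF te]
          card_image_le[OF finite_walks_upto, of "\<lambda>q. q @ [e]" n "tail G e"] by linarith
      \<comment> \<open>Raising the base makes both terms multiples of
        \<open>Suc (Suc n) ^ c\<close>, with factors \<open>1\<close> and \<open>Suc n\<close> that
        add up to \<open>Suc (Suc n)\<close>.\<close>
      also have "\<dots> \<le> M * Suc (Suc n) ^ c + M * (Suc n * Suc (Suc n) ^ c)"
        unfolding power_Suc by (intro add_left_mono mult_le_mono2 power_mono) auto
      also have "\<dots> = M * Suc (Suc n) ^ Suc c" by (simp add: algebra_simps)
      finally show ?case .
    qed
    then show ?thesis using wS c by auto
  qed
qed

lemma reduced_pairs_bound: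
  assumes "w \<in> verts G"
  shows "\<exists>K. \<forall>n. card (reduced_pairs n w) \<le> K * Suc n ^ (2 * corank w)"
proof -
  obtain K where K: "\<And>n. card (walks_upto n w) \<le> K * Suc n ^ corank w"
    using walks_upper_bound[OF assms] by blast
  have "card (reduced_pairs n w) \<le> K * K * Suc n ^ (2 * corank w)" for n
  proof -
    have "card (reduced_pairs n w) \<le> card (walks_upto n w \<times> walks_upto n w)"
      by (intro card_mono finite_cartesian_product finite_walks_upto) (auto simp: reduced_pairs_def)
    also have "\<dots> \<le> (K * Suc n ^ corank w) * (K * Suc n ^ corank w)"
      unfolding card_cartesian_product by (intro mult_le_mono K)
    also have "\<dots> = K * K * Suc n ^ (2 * corank w)"
      by (simp add: mult_2 power_add algebra_simps)
    finally show ?thesis .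
  qed
  then show ?thesis by blast
qed

text \<open>
  On a cycle without exits at most one of the two paths of a reduced pair can end with an edge of
  the cycle, which saves one power.
\<close>

lemma reduced_pairs_bound_no_exit:
  assumes w: "w \<in> cyclic_verts"
    and no_exit: "\<And>v. v \<rightarrow>\<^sup>* w \<Longrightarrow> w \<rightarrow>\<^sup>* v \<Longrightarrow> \<exists>e. out_arcs G v = {e}"
  shows "\<exists>K. \<forall>n. card (reduced_pairs n w) \<le> K * Suc n ^ (2 * corank w - 1)"
proof -
  have wv: "w \<in> verts G" using w cyclic_verts_subset by blast
  obtain K where K: "\<And>n. card (walks_upto n w) \<le> K * Suc n ^ corank w"
    using walks_upper_bound[OF wv] by blast
  define c where "c = corank w - 1"
  have c: "corank w = Suc c" using corank.chain_rank_pos[OF w] by (simp add: c_def)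
  have "\<exists>K. \<forall>n. card (entering_walks n w) \<le> K * Suc n ^ c"
  proof (rule entering_walks_bound)
    fix e assume e: "e \<in> entering w"
    show "\<exists>K. \<forall>n. card (walks_upto n (tail G e)) \<le> K * Suc n ^ corank (tail G e)"
      by (rule walks_upper_bound[OF entering_tail(3)[OF e]])
    show "corank (tail G e) \<le> c"
      using corank.chain_rank_less[OF w entering_tail(1)[OF e] entering_tail(2)[OF e]] c by simp
  qed
  then obtain M where M: "\<And>n. card (entering_walks n w) \<le> M * Suc n ^ c" by blast
  have "card (reduced_pairs n w) \<le> 2 * (M * K) * Suc n ^ (2 * corank w - 1)" for n
  proof -
    let ?E = "entering_walks n w" and ?A = "walks_upto n w"
    have finE: "finite ?E"
      by (rule finite_subset[OF _ finite_walks_upto[of n w]]) (auto simp: entering_walks_def)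
    have not_entering: "\<exists>q e. p = q @ [e] \<and> e \<in> in_arcs G w \<and> w \<rightarrow>\<^sup>* tail G e"
      if "p \<in> ?A" "p \<notin> ?E" for p
      using that by (cases p rule: rev_cases) (auto simp: entering_walks_def entering_def walks_upto_def walk_to_snoc)
    have "reduced_pairs n w \<subseteq> ?E \<times> ?A \<union> ?A \<times> ?E"
    proof
      fix x assume x: "x \<in> reduced_pairs n w"
      obtain p q where pq: "x = (p, q)" by force
      show "x \<in> ?E \<times> ?A \<union> ?A \<times> ?E"
      proof (rule ccontr)
        assume "x \<notin> ?E \<times> ?A \<union> ?A \<times> ?E"
        then have "p \<in> ?A" "q \<in> ?A" "p \<notin> ?E" "q \<notin> ?E" "\<not> reducible p q"
          using x by (auto simp: pq reduced_pairs_def)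
        then obtain p' e q' f where pe: "p = p' @ [e]" "e \<in> in_arcs G w" "w \<rightarrow>\<^sup>* tail G e"
          and qf: "q = q' @ [f]" "f \<in> in_arcs G w" "w \<rightarrow>\<^sup>* tail G f"
          using not_entering by metis
        then have "e = f" using unique_arc_from_back[of e f] by auto
        moreover have "tail G e \<rightarrow>\<^sup>* w" using pe(2) arc_reachable[of e] by auto
        then obtain g where "out_arcs G (tail G e) = {g}" using no_exit pe(3) by blast
        then have "out_arcs G (tail G e) = {e}" using pe(2) by auto
        ultimately show False using \<open>\<not> reducible p q\<close> pe(1) qf(1) by (auto simp: reducible_def)
      qed
    qed
    then have "card (reduced_pairs n w) \<le> card (?E \<times> ?A \<union> ?A \<times> ?E)"
      using finE finite_walks_upto by (intro card_mono) auto
    also have "\<dots> \<le> card (?E \<times> ?A) + card (?A \<times> ?E)" by (rule card_Un_le)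
    also have "\<dots> = 2 * (card ?E * card ?A)" by (simp add: card_cartesian_product)
    also have "\<dots> \<le> 2 * ((M * Suc n ^ c) * (K * Suc n ^ corank w))"
      by (intro mult_le_mono M K order.refl)
    also have "\<dots> = 2 * (M * K) * Suc n ^ (2 * corank w - 1)"
      using power_add[of "Suc n" c "Suc c"] by (simp add: c algebra_simps flip: mult_2)
    finally show ?thesis .
  qed
  then show ?thesis by blast
qed


section \<open>Chains of cycles\<close>

lemma corank_le_max_chain: "corank w \<le> max_chain cyclic_verts"
proof -
  obtain us where us: "chain (\<lambda>a b. b \<rightarrow>\<^sup>* a) cyclic_verts us" "length us = corank w"
    using corank.chain_rank_witness by metis
  then have "chain (\<lambda>a b. a \<rightarrow>\<^sup>* b) cyclic_verts (rev us)"
    using chain_rev[of "\<lambda>a b. b \<rightarrow>\<^sup>* a"] by simp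
  from chain_le_max_chain[OF cyclic_verts_subset this] us(2) show ?thesis by simp
qed

lemma max_chain_corank:
  assumes "Z \<subseteq> cyclic_verts" "0 < max_chain Z"
  obtains u where "u \<in> Z" "max_chain Z \<le> corank u"
proof -
  have Z: "Z \<subseteq> verts G" using assms(1) cyclic_verts_subset by blast
  obtain us where us: "chain (\<lambda>a b. a \<rightarrow>\<^sup>* b) Z us" "length us = max_chain Z"
    using max_chain_witness[OF Z] by blast
  then obtain us' u where u: "us = us' @ [u]" using assms(2) by (cases us rule: rev_cases) auto
  have uZ: "u \<in> Z" and below: "\<And>a. a \<in> set us \<Longrightarrow> a \<rightarrow>\<^sup>* u"
    using us(1) Z by (auto simp: u chain_def sorted_wrt_append)
  have "chain (\<lambda>a b. b \<rightarrow>\<^sup>* a) cyclic_verts (rev us)"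
    unfolding chain_rev using us(1) assms(1) by (rule chain_mono)
  from corank.chain_rank_ge[OF this, of u] below us(2) have "max_chain Z \<le> corank u" by simp
  with uZ that show thesis by blast
qed

lemma max_chain_mono:
  assumes "Z \<subseteq> Z'" "Z' \<subseteq> verts G"
  shows "max_chain Z \<le> max_chain Z'"
proof -
  obtain us where us: "chain (\<lambda>a b. a \<rightarrow>\<^sup>* b) Z us" "length us = max_chain Z"
    using max_chain_witness[of Z] assms by blast
  from chain_le_max_chain[OF assms(2) chain_mono[OF us(1) assms(1)]] us(2) show ?thesis by simp
qed

text \<open>Let \<open>u\<close> end a longest chain before \<open>w\<close>. If \<open>u\<close>
  reached a sink, so would the whole chain, making the two maxima equal. So everything reachable
  from \<open>u\<close> reaches a cycle, which must lead back to \<open>u\<close>, or else the chain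
  could be prolonged. Hence no edge leaves the class of \<open>u\<close>, which contains
  \<open>w\<close>.\<close>

lemma top_corank_no_exit:
  assumes d: "max_chain (cyclic_verts \<inter> reaches_sink) \<noteq> max_chain cyclic_verts"
    and w: "corank w = max_chain cyclic_verts"
  shows "w \<in> cyclic_verts" "v \<rightarrow>\<^sup>* w \<Longrightarrow> w \<rightarrow>\<^sup>* v \<Longrightarrow> \<exists>e. out_arcs G v = {e}"
proof -
  let ?R = "\<lambda>a b. b \<rightarrow>\<^sup>* a" and ?Z = "cyclic_verts \<inter> reaches_sink"
  have sub: "?Z \<subseteq> verts G" using cyclic_verts_subset by blast
  have lt: "max_chain ?Z < max_chain cyclic_verts"
    using max_chain_mono[of ?Z cyclic_verts] cyclic_verts_subset d by simp
  then have "corank w \<noteq> 0" using w by simp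
  then obtain k where k: "corank w = Suc k" using not0_implies_Suc by blast
  obtain u where u: "u \<in> cyclic_verts" "u \<rightarrow>\<^sup>* w" "corank u = Suc k"
    using corank.chain_rank_step[OF k] by blast
  have "u \<notin> reaches_sink"
  proof
    assume u_sink: "u \<in> reaches_sink"
    obtain us where us: "chain ?R cyclic_verts us" "\<And>a. a \<in> set us \<Longrightarrow> a \<rightarrow>\<^sup>* u" "length us = corank u"
      using corank.chain_rank_witness by metis
    obtain z where z: "z \<in> sinks" "u \<rightarrow>\<^sup>* z" using u_sink by (auto simp: reaches_sink_def)
    have "set us \<subseteq> reaches_sink"
    proof
      fix a assume "a \<in> set us"
      from reachable_trans[OF us(2)[OF this] z(2)] z(1) show "a \<in> reaches_sink"
        by (auto simp: reaches_sink_def)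
    qed
    then have "chain ?R ?Z us" using us(1) by (auto simp: chain_def)
    then have "chain (\<lambda>a b. a \<rightarrow>\<^sup>* b) ?Z (rev us)" using chain_rev[of ?R] by simp
    from chain_le_max_chain[OF sub this] show False using lt us(3) u(3) k w by simp
  qed
  have returns: "x \<rightarrow>\<^sup>* u" if ux: "u \<rightarrow>\<^sup>* x" for x
  proof -
    obtain y where y: "x \<rightarrow>\<^sup>* y" "y \<in> sinks \<union> cyclic_verts"
      using reaches_sink_or_cycle[of x] ux by (auto simp: reachable_in_verts)
    have uy: "u \<rightarrow>\<^sup>* y" using ux y(1) by (rule reachable_trans)
    then have yc: "y \<in> cyclic_verts" using y(2) \<open>u \<notin> reaches_sink\<close> by (auto simp: reaches_sink_def)
    have "y \<rightarrow>\<^sup>* u"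
    proof (rule ccontr)
      assume "\<not> y \<rightarrow>\<^sup>* u"
      from corank.chain_rank_less[OF yc uy this] show False
        using corank_le_max_chain[of y] u(3) k w by simp
    qed
    with y(1) show ?thesis by (rule reachable_trans)
  qed
  have wu: "w \<rightarrow>\<^sup>* u" by (rule returns[OF u(2)])
  show "w \<in> cyclic_verts" by (rule mutually_reachable_cyclic[OF u(1) u(2) wu])
  assume v: "v \<rightarrow>\<^sup>* w" "w \<rightarrow>\<^sup>* v"
  have uv: "u \<rightarrow>\<^sup>* v" "v \<rightarrow>\<^sup>* u" using u(2) wu v reachable_trans by blast+
  then have vc: "v \<in> cyclic_verts" by (rule mutually_reachable_cyclic[OF u(1)])
  obtain e where e: "e \<in> out_arcs G v" "head G e \<rightarrow>\<^sup>* v"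
    using vc reachable_head unfolding cyclic_verts_def by blast
  have "f = e" if f: "f \<in> out_arcs G v" for f
  proof -
    have "u \<rightarrow>\<^sup>* head G f" using uv(1) f arc_reachable[of f] reachable_trans by auto
    then have "head G f \<rightarrow>\<^sup>* v" using returns uv(1) reachable_trans by blast
    then show ?thesis using unique_arc_back[of f e] e f by auto
  qed
  with e(1) show "\<exists>e. out_arcs G v = {e}" by blast
qed

end


section \<open>The Gelfand-Kirillov dimension\<close>

lemma limsup_log_le:
  fixes g :: "nat \<Rightarrow> nat"
  assumes "\<And>n. g n \<le> K * Suc (m * n) ^ D"
  shows "limsup (\<lambda>n. ereal (log (real n) (real (g n)))) \<le> ereal (real D)"
proof -
  \<comment> \<open>\<open>Suc K\<close> ensures \<open>C \<ge> 1\<close>. So the bound is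
    nonnegative also where \<open>g n = 0\<close>, at which \<open>log\<close> returns
    \<open>0\<close>.\<close>
  define C where "C = real (Suc K) * real (Suc m) ^ D"
  have C: "1 \<le> C"
  proof -
    have "1 * 1 \<le> real (Suc K) * real (Suc m) ^ D" by (intro mult_mono one_le_power) auto
    then show ?thesis by (simp add: C_def)
  qed
  have bound: "log (real n) (real (g n)) \<le> log (real n) C + real D" if n: "2 \<le> n" for n
  proof -
    have "real (g n) \<le> real (K * Suc (m * n) ^ D)" using assms[of n] of_nat_le_iff by blast
    also have "\<dots> = real K * real (Suc (m * n)) ^ D" by simp
    also have "\<dots> \<le> real (Suc K) * (real (Suc m) * real n) ^ D"
      using n by (intro mult_mono power_mono) (auto simp: algebra_simps)
    also have "\<dots> = C * real n ^ D" by (simp add: C_def power_mult_distrib)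
    finally have le: "real (g n) \<le> C * real n ^ D" .
    have rhs: "log (real n) C + real D = log (real n) (C * real n ^ D)"
      using n C by (simp add: log_mult log_nat_power)
    show ?thesis
    proof (cases "g n = 0")
      case True
      have "0 \<le> log (real n) C" using n C by simp
      then show ?thesis using True by (simp add: log_def)
    next
      case False
      then show ?thesis unfolding rhs using le n C by (intro log_mono) auto
    qed
  qed
  have "(\<lambda>n. log (real n) C + real D) \<longlonglongrightarrow> 0 + real D"
  proof (intro tendsto_intros)
    have "filterlim (\<lambda>n. ln (real n)) at_top sequentially"
      using ln_at_top filterlim_real_sequentially by (rule filterlim_compose)
    then have "(\<lambda>n. ln C / ln (real n)) \<longlonglongrightarrow> 0"
      by (intro real_tendsto_divide_at_top[OF tendsto_const])
    then show "(\<lambda>n. log (real n) C) \<longlonglongrightarrow> 0" by (simp add: log_def)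
  qed
  then have "(\<lambda>n. ereal (log (real n) C + real D)) \<longlonglongrightarrow> ereal (real D)" by simp
  then have "limsup (\<lambda>n. ereal (log (real n) C + real D)) = ereal (real D)"
    by (intro lim_imp_Limsup) auto
  moreover have "limsup (\<lambda>n. ereal (log (real n) (real (g n)))) \<le> limsup (\<lambda>n. ereal (log (real n) C + real D))"
    by (rule Limsup_mono) (auto intro!: eventually_sequentiallyI[of 2] bound)
  ultimately show ?thesis by simp
qed

lemma limsup_log_ge:
  fixes g :: "nat \<Rightarrow> nat"
  assumes "0 < m" "\<And>n. (n div m) ^ D \<le> g n"
  shows "ereal (real D) \<le> limsup (\<lambda>n. ereal (log (real n) (real (g n))))"
proof -
  \<comment> \<open>Rounding down loses at most a factor \<open>2\<close> once
    \<open>n \<ge> m\<close>. The threshold \<open>2 * m\<close> also gives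
    \<open>n \<ge> 2\<close>, a proper base for the logarithm.\<close>
  have bound: "real D * (1 - log (real n) (real (2 * m))) \<le> log (real n) (real (g n))"
    if n: "2 * m \<le> n" for n
  proof -
    have n2: "2 \<le> n" using n assms(1) by linarith
    have "n < Suc (n div m) * m" using assms(1) by (simp add: dividend_less_div_times)
    moreover have "m \<le> n div m * m"
    proof -
      have "1 \<le> n div m" using n assms(1) by (simp add: less_eq_div_iff_mult_less_eq)
      then show ?thesis using mult_le_mono1[of 1 "n div m" m] by simp
    qed
    ultimately have "n \<le> n div m * m + n div m * m" unfolding mult_Suc by linarith
    then have "n \<le> 2 * m * (n div m)" by (simp add: algebra_simps)
    then have "real n \<le> real (2 * m) * real (n div m)" by (metis of_nat_le_iff of_nat_mult)
    then have q: "real n / real (2 * m) \<le> real (n div m)"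
      using assms(1) by (simp add: divide_le_eq mult.commute)
    have pos: "0 < real n / real (2 * m)" using n2 assms(1) by simp
    have "1 - log (real n) (real (2 * m)) = log (real n) (real n / real (2 * m))"
      using n2 assms(1) by (subst log_divide) auto
    also have "real D * \<dots> = log (real n) ((real n / real (2 * m)) ^ D)"
      using log_nat_power[OF less_imp_le[OF pos]] by simp
    also have "\<dots> \<le> log (real n) (real (g n))"
    proof (rule log_mono)
      have "(real n / real (2 * m)) ^ D \<le> real (n div m) ^ D"
        using q pos by (intro power_mono) auto
      also have "\<dots> \<le> real (g n)" using assms(2)[of n] by (metis of_nat_le_iff of_nat_power)
      finally show "(real n / real (2 * m)) ^ D \<le> real (g n)" .
    qed (use n2 pos in auto)
    finally show ?thesis .
  qed
  have "(\<lambda>n. real D * (1 - log (real n) (real (2 * m)))) \<longlonglongrightarrow> real D * (1 - 0)"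
  proof (intro tendsto_intros)
    have "filterlim (\<lambda>n. ln (real n)) at_top sequentially"
      using ln_at_top filterlim_real_sequentially by (rule filterlim_compose)
    then have "(\<lambda>n. ln (real (2 * m)) / ln (real n)) \<longlonglongrightarrow> 0"
      by (intro real_tendsto_divide_at_top[OF tendsto_const])
    then show "(\<lambda>n. log (real n) (real (2 * m))) \<longlonglongrightarrow> 0" by (simp add: log_def)
  qed
  then have "(\<lambda>n. ereal (real D * (1 - log (real n) (real (2 * m))))) \<longlonglongrightarrow> ereal (real D)" by simp
  then have "limsup (\<lambda>n. ereal (real D * (1 - log (real n) (real (2 * m))))) = ereal (real D)"
    by (intro lim_imp_Limsup) auto
  moreover have "limsup (\<lambda>n. ereal (real D * (1 - log (real n) (real (2 * m)))))
      \<le> limsup (\<lambda>n. ereal (log (real n) (real (g n))))"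
    by (rule Limsup_mono) (auto intro!: eventually_sequentiallyI[of "2 * m"] bound simp del: of_nat_mult)
  ultimately show ?thesis by simp
qed

locale leavitt_disjoint = leavitt G field_type + disjoint_cycles_digraph G
  for G :: "('a, 'b) pre_digraph" (structure) and field_type :: "'k::field itself"
begin

lemma GKdim_le:
  assumes "\<And>w. w \<in> verts G \<Longrightarrow> \<exists>K. \<forall>n. card (reduced_pairs n w) \<le> K * Suc n ^ D"
  shows "GKdim K L \<le> ereal (real D)"
  unfolding GKdim_def
proof (rule SUP_least)
  fix V assume "V \<in> {V. VectorSpace.subspace K V L \<and> vectorspace.fin_dim K (L\<lparr>carrier := V\<rparr>)}"
  then obtain m where m: "\<And>n. growth K L V n \<le> (\<Sum>w\<in>verts G. card (reduced_pairs (m * n) w))"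
    using growth_upper[of V] by blast
  obtain C where C: "\<And>w n. w \<in> verts G \<Longrightarrow> card (reduced_pairs n w) \<le> C w * Suc n ^ D"
    using assms by metis
  have "growth K L V n \<le> (\<Sum>w\<in>verts G. C w) * Suc (m * n) ^ D" for n
  proof -
    have "(\<Sum>w\<in>verts G. card (reduced_pairs (m * n) w)) \<le> (\<Sum>w\<in>verts G. C w * Suc (m * n) ^ D)"
      by (intro sum_mono C)
    then show ?thesis using m[of n] by (simp add: sum_distrib_right)
  qed
  then show "limsup (\<lambda>n. ereal (log (real n) (real (growth K L V n)))) \<le> ereal (real D)"
    by (rule limsup_log_le)
qed

lemma GKdim_ge:
  assumes "0 < m" "\<And>n. (n div m) ^ D \<le> growth K L generating_space n"
  shows "ereal (real D) \<le> GKdim K L"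
  unfolding GKdim_def
  by (rule SUP_upper2[of generating_space]) (use generating_space limsup_log_ge[OF assms] in auto)

text \<open>For \<open>d1 = 0\<close> this replaces \<open>GKdim_ge\<close>: the growth for the
  empty graph is \<open>0\<close>, below a power with exponent \<open>0\<close>.\<close>

lemma GKdim_nonneg: "0 \<le> GKdim K L"
  unfolding GKdim_def
proof (rule SUP_upper2[of generating_space])
  have "0 \<le> log (real n) (real (growth K L generating_space n))" if "2 \<le> n" for n
    using that by (cases "growth K L generating_space n = 0") (auto simp: log_def)
  then have "limsup (\<lambda>n. 0 :: ereal) \<le> limsup (\<lambda>n. ereal (log (real n) (real (growth K L generating_space n))))"
    by (intro Limsup_mono eventually_sequentiallyI[of 2]) auto
  then show "0 \<le> limsup (\<lambda>n. ereal (log (real n) (real (growth K L generating_space n))))"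
    by (simp add: Limsup_const)
qed (use generating_space in auto)

theorem GKdim_max_chain:
  defines "d1 \<equiv> max_chain cyclic_verts" and "d2 \<equiv> max_chain (cyclic_verts \<inter> reaches_sink)"
  shows "GKdim K L = (if d1 = d2 then ereal (2 * real d1) else ereal (2 * real d1 - 1))"
proof (cases "d1 = d2")
  case True
  have "GKdim K L \<le> ereal (real (2 * d1))"
  proof (rule GKdim_le)
    fix w assume "w \<in> verts G"
    then obtain C where C: "\<And>n. card (reduced_pairs n w) \<le> C * Suc n ^ (2 * corank w)"
      using reduced_pairs_bound by blast
    have "card (reduced_pairs n w) \<le> C * Suc n ^ (2 * d1)" for n
    proof -
      have "Suc n ^ (2 * corank w) \<le> Suc n ^ (2 * d1)"
        using corank_le_max_chain[of w] by (intro power_increasing) (auto simp: d1_def)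
      then show ?thesis using C[of n] by (meson le_trans mult_le_mono2)
    qed
    then show "\<exists>C. \<forall>n. card (reduced_pairs n w) \<le> C * Suc n ^ (2 * d1)" by blast
  qed
  moreover have "ereal (real (2 * d1)) \<le> GKdim K L"
  proof (cases "d1 = 0")
    case True
    then show ?thesis using GKdim_nonneg by (simp add: zero_ereal_def)
  next
    case False
    \<comment> \<open>Since \<open>d1 = d2\<close>, some longest chain ends in a cycle that reaches
      a sink; prolonging the walks to that sink keeps their order of growth.\<close>
    then have "0 < max_chain (cyclic_verts \<inter> reaches_sink)" using True by (simp add: d2_def)
    then obtain u where u: "u \<in> cyclic_verts" "u \<in> reaches_sink" "d2 \<le> corank u"
      using max_chain_corank[of "cyclic_verts \<inter> reaches_sink"] by (auto simp: d2_def)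
    then have "corank u = d1" using corank_le_max_chain[of u] True by (simp add: d1_def)
    then obtain i where i: "corank u = Suc i" "d1 = Suc i" using False by (cases d1) auto
    obtain m where m: "0 < m" "\<And>n. (n div m) ^ Suc i \<le> card (walks_upto n u)"
      using walks_lower_bound[OF u(1) i(1)] by blast
    obtain w where w: "w \<in> sinks" "u \<rightarrow>\<^sup>* w" using u(2) by (auto simp: reaches_sink_def)
    obtain g where g: "awalk u g w" using w(2) reachable_awalk by auto
    define m' where "m' = m * Suc (length g)"
    have sink: "(n div m') ^ Suc i \<le> card (walks_upto n w)" for n
      unfolding m'_def
      by (rule power_div_shift[where f = "\<lambda>n. card (walks_upto n u)" and g = "\<lambda>n. card (walks_upto n w)",
            OF m(2) m(1) card_walks_append[OF g]])
    show ?thesis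
    proof (rule GKdim_ge)
      \<comment> \<open>Paths of length \<open>N = n div 3\<close> satisfy
        \<open>2 * N + 1 \<le> n\<close> for all \<open>n \<ge> 1\<close>.\<close>
      show "0 < 3 * m'" using m(1) by (simp add: m'_def)
      fix n
      show "(n div (3 * m')) ^ (2 * d1) \<le> growth K L generating_space n"
      proof (cases "n = 0")
        case True
        then show ?thesis using False by (simp add: power_0_left)
      next
        case False
        have "(n div (3 * m')) ^ (2 * d1) = (n div 3 div m') ^ Suc i * (n div 3 div m') ^ Suc i"
          by (simp add: i(2) div_mult2_eq mult_2 power_add flip: power_Suc)
        also have "\<dots> \<le> card (walks_upto (n div 3) w) * card (walks_upto (n div 3) w)"
          by (intro mult_le_mono sink)
        also have "\<dots> \<le> growth K L generating_space n"
          by (rule growth_ge_sink[OF w(1)]) (use False in linarith)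
        finally show ?thesis .
      qed
    qed
  qed
  ultimately show ?thesis using True by (simp add: antisym)
next
  case False
  have "d2 \<le> d1"
    unfolding d1_def d2_def by (rule max_chain_mono) (use cyclic_verts_subset in auto)
  then have "0 < d1" using False by simp
  then obtain i where i: "d1 = Suc i" by (cases d1) auto
  define D where "D = 2 * d1 - 1"
  have "GKdim K L \<le> ereal (real D)"
  proof (rule GKdim_le)
    fix w assume w: "w \<in> verts G"
    show "\<exists>C. \<forall>n. card (reduced_pairs n w) \<le> C * Suc n ^ D"
    proof (cases "corank w = d1")
      case True
      then have "w \<in> cyclic_verts" "\<And>v. v \<rightarrow>\<^sup>* w \<Longrightarrow> w \<rightarrow>\<^sup>* v \<Longrightarrow> \<exists>e. out_arcs G v = {e}"
        using top_corank_no_exit[of w] False by (auto simp: d1_def d2_def)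
      from reduced_pairs_bound_no_exit[OF this] show ?thesis by (simp add: True D_def)
    next
      case False
      obtain C where C: "\<And>n. card (reduced_pairs n w) \<le> C * Suc n ^ (2 * corank w)"
        using reduced_pairs_bound[OF w] by blast
      have "card (reduced_pairs n w) \<le> C * Suc n ^ D" for n
      proof -
        \<comment> \<open>Here \<open>corank w\<close> is at most \<open>d1 - 1\<close>, so the
          general exponent \<open>2 * corank w\<close> is already below \<open>D\<close>.\<close>
        have "Suc n ^ (2 * corank w) \<le> Suc n ^ D"
          using corank_le_max_chain[of w] False
          by (intro power_increasing) (auto simp: d1_def[symmetric] D_def)
        then show ?thesis using C[of n] by (meson le_trans mult_le_mono2)
      qed
      then show ?thesis by blast
    qed
  qed
  moreover have "ereal (real D) \<le> GKdim K L"
  proof -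
    obtain u where u: "u \<in> cyclic_verts" "d1 \<le> corank u"
      using max_chain_corank[of cyclic_verts] \<open>0 < d1\<close> by (auto simp: d1_def)
    then have "corank u = Suc i" using corank_le_max_chain[of u] i by (simp add: d1_def)
    then obtain m where m: "0 < m" "\<And>n. (n div m) ^ Suc i \<le> card (walks_upto n u)"
      "\<And>n. (n div m) ^ i \<le> card (first_arrivals n u)"
      using walks_lower_bound[OF u(1)] by blast
    show ?thesis
    proof (rule GKdim_ge)
      show "0 < 3 * m" using m(1) by simp
      fix n
      show "(n div (3 * m)) ^ D \<le> growth K L generating_space n"
      proof (cases "n = 0")
        case True
        then show ?thesis using i by (simp add: D_def)
      next
        case False
        \<comment> \<open>All walks to \<open>u\<close> contribute the power \<open>Suc i\<close>,
          first arrivals the power \<open>i\<close>.\<close>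
        have "D = Suc i + i" by (simp add: D_def i)
        then have "(n div (3 * m)) ^ D = (n div 3 div m) ^ Suc i * (n div 3 div m) ^ i"
          by (simp only: div_mult2_eq power_add)
        also have "\<dots> \<le> card (walks_upto (n div 3) u) * card (first_arrivals (n div 3) u)"
          by (intro mult_le_mono m)
        also have "\<dots> \<le> growth K L generating_space n"
          by (rule growth_ge_cycle[OF u(1)]) (use False in linarith)
        finally show ?thesis .
      qed
    qed
  qed
  moreover have "real D = 2 * real d1 - 1" using \<open>0 < d1\<close> by (simp add: D_def of_nat_diff)
  ultimately show ?thesis using False by (simp add: antisym)
qed

end

theorem theorem4p4:
  fixes E :: "('v, 'e) pre_digraph"
  assumes "fin_digraph E"
    and "disjoint_cycles E"
  shows
    "let L = (leavitt_path_algebra E :: ('k::field, ('v, 'e, 'k) free_lpa set) module);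
         T = talented_monoid E;
         S = largest_noncomparable_ideal T;
         I = leading_ideal T;
         d1 = cyclic_length (quot_ideal T S);
         d2 = cyclic_length (quot_ideal T (S <#>\<^bsub>T\<^esub> I))
     in GKdim (class_ring :: 'k ring) L =
          (if d1 = d2 then ereal (2 * real d1) else ereal (2 * real d1 - 1))"
proof -
  interpret leavitt_disjoint E "TYPE('k)"
    by (intro leavitt_disjoint.intro leavitt.intro disjoint_cycles_digraph.intro
        disjoint_cycles_digraph_axioms.intro assms)
  show ?thesis unfolding Let_def cyclic_length_quotients by (rule GKdim_max_chain)
qed

end
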